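(* Assume that $\mathcal{G}$ is the disjoint union of directed cycle graphs and that, for $l_1\ne l_2$ in $\{1,\dots,L\}$, $$\frac{\sum_{j\in\mathcal{J}_{l_1}}\zeta_j}{\sum_{j\in\mathcal{J}_{l_1}}\tau_j}\ne\frac{\sum_{j\in\mathcal{J}_{l_2}}\zeta_j}{\sum_{j\in\mathcal{J}_{l_2}}\tau_j}.$$ Then the network system (N) is $L^1$-exactly controllable in time $\tau_1+\dots+\tau_n$ if and only if $\tilde Y_l(N)^T\Gamma\ne0$ for every $l\in\{1,\dots,L\}$ and every $N\in\overline{H_{\rm net}(\mathbb{C})}$ such that the $l$th diagonal block of $N$ is singular.
   Context: Graph. $\mathcal{G}=(\mathcal{V},\mathcal{E})$ is a directed graph with vertices $\mathcal{V}=\{v_1,\dots,v_k\}$ and edges $\mathcal{E}=\{\varepsilon_1,\dots,\varepsilon_n\}$; each edge $\varepsilon_j$ is oriented from its endpoint $\varepsilon_j(1)\in\mathcal{V}$ to its endpoint $\varepsilon_j(0)\in\mathcal{V}$. A directed cycle graph may have a single edge (a loop). Data. The $k\times n$ matrices $\mathcal{I}^-=(i^-_{ij})$ and $\mathcal{I}^+=(i^+_{ij})$ are defined by $i^-_{ij}=1$ if $v_i=\varepsilon_j(1)$ and $0$ otherwise, $i^+_{ij}=1$ if $v_i=\varepsilon_j(0)$ and $0$ otherwise. Weights $w^-_{ij}\in[0,1]$, $i\in\{1,\dots,k\}$, $j\in\{1,\dots,n\}$, are given with $\sum_{j=1}^nw^-_{ij}=1$ for every $i$, and $w^-_{ij}=0$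 if and only if $i^-_{ij}=0$; $\mathcal{I}^-_w=(w^-_{ij})$. $\Gamma=(\gamma_{il})$ is a real $k\times m$ matrix. For $j\in\{1,\dots,n\}$, $d_j\in L^1([0,1],\mathbb{R})$, $\lambda_j$ is negative on $[0,1]$, and $\lambda_j,\frac1{\lambda_j}\in L^\infty([0,1],\mathbb{R})$. Set $\tau_j=\int_0^1\frac{dx}{|\lambda_j(x)|}$ and $\zeta_j=\int_0^1\frac{d_j(x)}{|\lambda_j(x)|}dx$. Network system (N). For unknown $z=(z_1,\dots,z_n)^T$ and control $u=(u_1,\dots,u_m)^T$, $$\partial_tz_j(t,x)+\lambda_j(x)\partial_xz_j(t,x)+d_j(x)z_j(t,x)=0,\quad t>0,\ x\in(0,1),$$ $$i^-_{ij}z_j(t,1)=w^-_{ij}\sum_{e=1}^ni^+_{ie}z_e(t,0)+w^-_{ij}\sum_{l=1}^m\gamma_{il}u_l(t),\quad i\in\{1,\dots,k\},\ j\in\{1,\dots,n\};$$ the second line is equivalent to $z(t,1)=(\mathcal{I}^-_w)^T\mathcal{I}^+z(t,0)+(\mathcal{I}^-_w)^T\Gamma u(t)$. Solutions. For $T>0$, $z:[0,T]\times[0,1]\to\mathbb{R}^n$ is a solution of (N) with initial condition $\bar z$ and control $u$ if $z(0,\cdot)=\bar z$, the boundary condition holds for $t\in[0,T]$, and $z_j\big(t+\int_x^{x+h}\frac{d\xi}{\lambda_j(\xi)},x+h\big)=e^{-\int_x^{x+h}\frac{d_j(\xi)}{\lambda_j(\xi)}d\xi}z_j(t,x)$ for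 all $j$, $t\in[0,T]$, $x\in[0,1]$ and $h\in\mathbb{R}$ with $t+\int_x^{x+h}\frac{d\xi}{\lambda_j(\xi)}\in[0,T]$ and $x+h\in[0,1]$. For $L^1$ data, functions are identified when equal almost everywhere; in this sense, for $\bar z\in L^1$ and $u\in L^1$ there is a unique solution, and $z(t,\cdot)\in L^1$ for all $t$. Controllability. (N) is $L^1$-exactly controllable in time $T$ if for every $\phi,\psi\in L^1([0,1],\mathbb{R}^n)$ there is $u\in L^1([0,T],\mathbb{R}^m)$ such that the solution $z$ with initial condition $\phi$ and control $u$ satisfies $z(T,\cdot)=\psi$. Notation when $\mathcal{G}$ is a disjoint union of directed cycle graphs. Let $L$ be the number of cycles, $h_l$ the number of edges of the $l$th cycle, and $\mathcal{J}_l=\{1+\sum_{r=1}^{l-1}h_r,\dots,\sum_{r=1}^lh_r\}$, $l\in\{1,\dots,L\}$. Edges are relabeled so that $\varepsilon_j$ belongs to the $l$th cycle iff $j\in\mathcal{J}_l$, with $\varepsilon_j(0)=\varepsilon_{j+1}(1)$ for $j\in\mathcal{J}_l\setminus\{\max\mathcal{J}_l\}$ and $\varepsilon_{\max\mathcal{J}_l}(0)=\varepsilon_{\min\mathcal{J}_l}(1)$. Then $k=n$ and vertices are relabeled so that $\varepsilon_j(1)=v_j$ for all $j$ (and $\Gamma$, $\tau_j$, $\zeta_j$ are indexed accordingly). For $h\ge1$, $C_h$ is the $h\times h$ cyclic permutation matrix with $C_he_h=e_1$, $C_he_j=e_{j+1}$ for $1\le j\le h-1$ ($C_1=(1)$).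 Set $Z_l=\operatorname{diag}(e^{-\zeta_j})_{j\in\mathcal{J}_l}$, $\mathcal{T}_l(p)=\operatorname{diag}(e^{p\tau_j})_{j\in\mathcal{J}_l}$, and let $H_{\rm net}(p)$, $p\in\mathbb{C}$, be the block-diagonal $n\times n$ matrix with diagonal blocks $\mathcal{T}_l(p)-C_{h_l}Z_l$, $l=1,\dots,L$; $\overline{H_{\rm net}(\mathbb{C})}$ is the closure of its image in the complex $n\times n$ matrices. For $p\in\mathbb{C}$, let $y_l(p)=(y_{lj}(p))_{j=1}^{h_l}$ with $y_{lj}(p)=\prod_{t=\min\mathcal{J}_l}^{j-2+\min\mathcal{J}_l}e^{p\tau_t+\zeta_t}$ (empty product equal to $1$). For $N\in\overline{H_{\rm net}(\mathbb{C})}$ with $N=\lim_{\nu\to\infty}H_{\rm net}(p_\nu)$, the numbers $e^{p_\nu\tau_j}$ converge for every $j$; if the $l$th diagonal block of $N$ is singular, set $Y_l(N)=\lim_{\nu\to\infty}y_l(p_\nu)\in\mathbb{C}^{h_l}$, and let $\tilde Y_l(N)\in\mathbb{C}^n$ be obtained from $Y_l(N)$ by identifying $\mathbb{C}^{h_l}$ with the subspace of $\mathbb{C}^n$ corresponding to the indices in $\mathcal{J}_l$ (other components zero). *)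

theory Defs
  imports "HOL-Analysis.Analysis" "Jordan_Normal_Form.Determinant"
begin

no_notation vec_index (infixl "$" 100)

text \<open>
  Edges, vertices and controls are the elements of the finite types \<open>'n\<close>, \<open>'k\<close>, \<open>'m\<close>.
  The edge \<open>j\<close> goes from \<open>src j\<close> (its endpoint at \<open>x = 1\<close>) to \<open>tgt j\<close> (its endpoint at \<open>x = 0\<close>).
\<close>

definition Iminus :: "('n::finite \<Rightarrow> 'k::finite) \<Rightarrow> real ^ 'n ^ 'k" where
  "Iminus src = (\<chi> i j. if i = src j then 1 else 0)"

definition Iplus :: "('n::finite \<Rightarrow> 'k::finite) \<Rightarrow> real ^ 'n ^ 'k" where
  "Iplus tgt = (\<chi> i j. if i = tgt j then 1 else 0)"

definition admissible_weights :: "('n::finite \<Rightarrow> 'k::finite) \<Rightarrow> real ^ 'n ^ 'k \<Rightarrow> bool" where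
  "admissible_weights src w \<longleftrightarrow>
     (\<forall>i j. 0 \<le> w $ i $ j \<and> w $ i $ j \<le> 1) \<and>
     (\<forall>i. (\<Sum>j\<in>UNIV. w $ i $ j) = 1) \<and>
     (\<forall>i j. w $ i $ j = 0 \<longleftrightarrow> Iminus src $ i $ j = 0)"

definition L_infinity :: "(real \<Rightarrow> real) \<Rightarrow> bool" where
  "L_infinity f \<longleftrightarrow> f \<in> borel_measurable (lebesgue_on {0..1}) \<and>
     (\<exists>C. AE x in lebesgue_on {0..1}. \<bar>f x\<bar> \<le> C)"

definition tau :: "('n \<Rightarrow> real \<Rightarrow> real) \<Rightarrow> 'n \<Rightarrow> real" where
  "tau lam j = (LINT x=0..1|lebesgue. (1 / \<bar>lam j x\<bar>))"

definition zeta :: "('n \<Rightarrow> real \<Rightarrow> real) \<Rightarrow> ('n \<Rightarrow> real \<Rightarrow> real) \<Rightarrow> 'n \<Rightarrow> real" where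
  "zeta lam d j = (LINT x=0..1|lebesgue. (d j x / \<bar>lam j x\<bar>))"

text \<open>Solutions along characteristics; all the conditions are pointwise. The interval integrals
  are oriented, so \<open>h\<close> may be negative.\<close>

definition network_solution ::
  "('n::finite \<Rightarrow> 'k::finite) \<Rightarrow> ('n \<Rightarrow> 'k) \<Rightarrow> real ^ 'n ^ 'k \<Rightarrow> real ^ 'm::finite ^ 'k \<Rightarrow>
   ('n \<Rightarrow> real \<Rightarrow> real) \<Rightarrow> ('n \<Rightarrow> real \<Rightarrow> real) \<Rightarrow> real \<Rightarrow>
   (real \<Rightarrow> real ^ 'n) \<Rightarrow> (real \<Rightarrow> real ^ 'm) \<Rightarrow> (real \<Rightarrow> real \<Rightarrow> real ^ 'n) \<Rightarrow> bool" where
  "network_solution src tgt w \<Gamma> lam d T \<phi> u z \<longleftrightarrow>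
     (\<forall>x\<in>{0..1}. z 0 x = \<phi> x) \<and>
     (\<forall>t\<in>{0..T}. \<forall>i j.
        Iminus src $ i $ j * z t 1 $ j =
          w $ i $ j * (\<Sum>e\<in>UNIV. Iplus tgt $ i $ e * z t 0 $ e) +
          w $ i $ j * (\<Sum>c\<in>UNIV. \<Gamma> $ i $ c * u t $ c)) \<and>
     (\<forall>j. \<forall>t\<in>{0..T}. \<forall>x\<in>{0..1}. \<forall>h.
        t + (LINT \<xi>=ereal x..ereal (x + h)|lebesgue. (1 / lam j \<xi>)) \<in> {0..T} \<longrightarrow>
        x + h \<in> {0..1} \<longrightarrow>
        z (t + (LINT \<xi>=ereal x..ereal (x + h)|lebesgue. (1 / lam j \<xi>))) (x + h) $ j =
          exp (- (LINT \<xi>=ereal x..ereal (x + h)|lebesgue. (d j \<xi> / lam j \<xi>))) * z t x $ j)"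

text \<open>For integrable data a solution is a solution for some representatives of the classes of
  \<open>\<phi>\<close> and \<open>u\<close> modulo equality almost everywhere; the pointwise notion alone would impose the
  compatibility of \<open>\<phi> 1\<close> with \<open>\<phi> 0\<close> and \<open>u 0\<close>.\<close>

definition L1_network_solution ::
  "('n::finite \<Rightarrow> 'k::finite) \<Rightarrow> ('n \<Rightarrow> 'k) \<Rightarrow> real ^ 'n ^ 'k \<Rightarrow> real ^ 'm::finite ^ 'k \<Rightarrow>
   ('n \<Rightarrow> real \<Rightarrow> real) \<Rightarrow> ('n \<Rightarrow> real \<Rightarrow> real) \<Rightarrow> real \<Rightarrow>
   (real \<Rightarrow> real ^ 'n) \<Rightarrow> (real \<Rightarrow> real ^ 'm) \<Rightarrow> (real \<Rightarrow> real \<Rightarrow> real ^ 'n) \<Rightarrow> bool" where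
  "L1_network_solution src tgt w \<Gamma> lam d T \<phi> u z \<longleftrightarrow>
     (\<exists>\<phi>' u'. (AE x in lebesgue_on {0..1}. \<phi>' x = \<phi> x) \<and>
              (AE t in lebesgue_on {0..T}. u' t = u t) \<and>
              network_solution src tgt w \<Gamma> lam d T \<phi>' u' z)"

text \<open>For integrable \<open>\<phi>\<close> and \<open>u\<close> the solution exists, and each \<open>z t\<close> is unique up to null sets;
  hence ``the solution satisfies'' is written existentially.\<close>

definition L1_exactly_controllable ::
  "('n::finite \<Rightarrow> 'k::finite) \<Rightarrow> ('n \<Rightarrow> 'k) \<Rightarrow> real ^ 'n ^ 'k \<Rightarrow> real ^ 'm::finite ^ 'k \<Rightarrow>
   ('n \<Rightarrow> real \<Rightarrow> real) \<Rightarrow> ('n \<Rightarrow> real \<Rightarrow> real) \<Rightarrow> real \<Rightarrow> bool" where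
  "L1_exactly_controllable src tgt w \<Gamma> lam d T \<longleftrightarrow>
     (\<forall>\<phi> \<psi>. \<phi> absolutely_integrable_on {0..1} \<longrightarrow> \<psi> absolutely_integrable_on {0..1} \<longrightarrow>
        (\<exists>u. u absolutely_integrable_on {0..T} \<and>
          (\<exists>z. L1_network_solution src tgt w \<Gamma> lam d T \<phi> u z \<and>
               (AE x in lebesgue_on {0..1}. z T x = \<psi> x))))"

text \<open>Cycles are numbered \<open>0, \<dots>, L - 1\<close>, and \<open>\<epsilon>\<close> enumerates the edges as
  \<open>\<epsilon> 0, \<dots>, \<epsilon> (n - 1)\<close>, cycle by cycle: all indices are one less than the usual ones.\<close>

definition offset :: "(nat \<Rightarrow> nat) \<Rightarrow> nat \<Rightarrow> nat" where
  "offset h l = (\<Sum>r<l. h r)"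

definition J :: "(nat \<Rightarrow> nat) \<Rightarrow> nat \<Rightarrow> nat set" where
  "J h l = {offset h l..<offset h (Suc l)}"

text \<open>The graph is the disjoint union of \<open>L\<close> directed cycles of lengths \<open>h 0, \<dots>, h (L - 1)\<close>, with
  edges enumerated by \<open>\<epsilon>\<close> along the cycles. The \<open>j\<close>-th vertex is \<open>src (\<epsilon> j)\<close>; the cycles do not
  share vertices and cover all the vertices because \<open>src \<circ> \<epsilon>\<close> is a bijection.\<close>

definition disjoint_cycles ::
  "('n::finite \<Rightarrow> 'k::finite) \<Rightarrow> ('n \<Rightarrow> 'k) \<Rightarrow> nat \<Rightarrow> (nat \<Rightarrow> nat) \<Rightarrow> (nat \<Rightarrow> 'n) \<Rightarrow> bool" where
  "disjoint_cycles src tgt L h \<epsilon> \<longleftrightarrow>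
     (\<forall>l<L. 1 \<le> h l) \<and>
     bij_betw \<epsilon> {..<offset h L} UNIV \<and>
     bij_betw (\<lambda>j. src (\<epsilon> j)) {..<offset h L} UNIV \<and>
     (\<forall>l<L. \<forall>j\<in>J h l.
        tgt (\<epsilon> j) = (if j = Max (J h l) then src (\<epsilon> (Min (J h l))) else src (\<epsilon> (Suc j))))"

text \<open>Below, \<open>\<tau>\<close> and \<open>\<zeta>\<close> are indexed by edge numbers.\<close>

definition cyclic_perm_mat :: "nat \<Rightarrow> complex mat" where
  "cyclic_perm_mat h = Matrix.mat h h (\<lambda>(r, c). if r = Suc c mod h then 1 else 0)"

definition Z_mat :: "(nat \<Rightarrow> real) \<Rightarrow> (nat \<Rightarrow> nat) \<Rightarrow> nat \<Rightarrow> complex mat" where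
  "Z_mat \<zeta> h l = mat_diag (h l) (\<lambda>r. of_real (exp (- \<zeta> (offset h l + r))))"

definition T_mat :: "(nat \<Rightarrow> real) \<Rightarrow> (nat \<Rightarrow> nat) \<Rightarrow> nat \<Rightarrow> complex \<Rightarrow> complex mat" where
  "T_mat \<tau> h l p = mat_diag (h l) (\<lambda>r. exp (p * of_real (\<tau> (offset h l + r))))"

definition Hnet ::
  "(nat \<Rightarrow> real) \<Rightarrow> (nat \<Rightarrow> real) \<Rightarrow> nat \<Rightarrow> (nat \<Rightarrow> nat) \<Rightarrow> complex \<Rightarrow> complex mat" where
  "Hnet \<tau> \<zeta> L h p =
     diag_block_mat (map (\<lambda>l. T_mat \<tau> h l p - cyclic_perm_mat (h l) * Z_mat \<zeta> h l) [0..<L])"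

text \<open>The type of matrices of all dimensions carries no topology: convergence in the space of
  \<open>n \<times> n\<close> matrices is convergence of the entries, and closures are sequential.\<close>

definition mat_tendsto :: "nat \<Rightarrow> (nat \<Rightarrow> complex mat) \<Rightarrow> complex mat \<Rightarrow> bool" where
  "mat_tendsto n X N \<longleftrightarrow> N \<in> carrier_mat n n \<and>
     (\<forall>\<nu>. X \<nu> \<in> carrier_mat n n) \<and>
     (\<forall>r<n. \<forall>c<n. (\<lambda>\<nu>. X \<nu> $$ (r, c)) \<longlonglongrightarrow> N $$ (r, c))"

definition mat_closure :: "nat \<Rightarrow> complex mat set \<Rightarrow> complex mat set" where
  "mat_closure n S = {N. \<exists>X. (\<forall>\<nu>. X \<nu> \<in> S) \<and> mat_tendsto n X N}"

definition diagonal_block :: "(nat \<Rightarrow> nat) \<Rightarrow> complex mat \<Rightarrow> nat \<Rightarrow> complex mat" where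
  "diagonal_block h N l =
     Matrix.mat (h l) (h l) (\<lambda>(r, c). N $$ (offset h l + r, offset h l + c))"

definition y_vec ::
  "(nat \<Rightarrow> real) \<Rightarrow> (nat \<Rightarrow> real) \<Rightarrow> (nat \<Rightarrow> nat) \<Rightarrow> nat \<Rightarrow> complex \<Rightarrow> nat \<Rightarrow> complex" where
  "y_vec \<tau> \<zeta> h l p j =
     (\<Prod>t\<in>{offset h l..<offset h l + j}. exp (p * of_real (\<tau> t) + of_real (\<zeta> t)))"

text \<open>The \<open>j\<close>-th component of the common limit of \<open>y_vec\<close> along all the sequences \<open>p\<close> for which
  \<open>Hnet (p \<nu>)\<close> tends to \<open>N\<close>.\<close>

definition Y_vec ::
  "(nat \<Rightarrow> real) \<Rightarrow> (nat \<Rightarrow> real) \<Rightarrow> nat \<Rightarrow> (nat \<Rightarrow> nat) \<Rightarrow> nat \<Rightarrow> complex mat \<Rightarrow> nat \<Rightarrow> complex" where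
  "Y_vec \<tau> \<zeta> L h l N j =
     (THE c. \<forall>p. mat_tendsto (offset h L) (\<lambda>\<nu>. Hnet \<tau> \<zeta> L h (p \<nu>)) N \<longrightarrow>
        (\<lambda>\<nu>. y_vec \<tau> \<zeta> h l (p \<nu>) j) \<longlonglongrightarrow> c)"

definition Y_tilde ::
  "(nat \<Rightarrow> real) \<Rightarrow> (nat \<Rightarrow> real) \<Rightarrow> nat \<Rightarrow> (nat \<Rightarrow> nat) \<Rightarrow> nat \<Rightarrow> complex mat \<Rightarrow> nat \<Rightarrow> complex" where
  "Y_tilde \<tau> \<zeta> L h l N j = (if j \<in> J h l then Y_vec \<tau> \<zeta> L h l N (j - offset h l) else 0)"

text \<open>The product of a row vector with the matrix whose \<open>j\<close>-th row is the row of \<open>\<Gamma>\<close> at the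
  \<open>j\<close>-th vertex.\<close>

definition row_times_Gamma ::
  "nat \<Rightarrow> (nat \<Rightarrow> 'k::finite) \<Rightarrow> (nat \<Rightarrow> complex) \<Rightarrow> real ^ 'm::finite ^ 'k \<Rightarrow> complex ^ 'm" where
  "row_times_Gamma n v y \<Gamma> = (\<chi> c. \<Sum>j<n. y j * of_real (\<Gamma> $ v j $ c))"

end

theory Submission
  imports Defs
begin

text \<open>
  Along the characteristics, the edge \<open>j\<close> is a pure delay \<open>\<tau> j\<close> with gain \<open>exp (- \<zeta> j)\<close>, so a cycle of total
  delay \<open>W\<close> and total gain \<open>\<kappa>\<close> is a circle of length \<open>W\<close> on which waves travel without distortion. In the
  travelling frame the state at the final time, extended by \<open>f (s + W) = \<kappa> * f s\<close>, is the free evolution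
  plus a convolution: the sum over the vertices \<open>i\<close> and the controls \<open>c\<close> of
  \<open>exp (b i) * \<Gamma> i c * v c (s + a i)\<close>, where \<open>v c\<close> is the periodization of the control \<open>u c\<close> with weight \<open>\<kappa>\<close>.
  The singular blocks in the closure of \<open>Hnet\<close> are the limits along the frequencies
  \<open>p = \<sigma> + 2 * pi * \<i> * k / W\<close> with \<open>\<sigma> = ln \<kappa> / W\<close>, at which \<open>y_vec\<close> times \<open>\<Gamma>\<close> is the symbol of this convolution;
  by compactness the condition of the theorem says that the symbol is bounded away from zero on them.

  If it is, the convolution system has a right inverse on \<open>L1\<close>: this is Wiener's lemma for a trigonometric
  polynomial with finitely many frequencies, proved by a Neumann series. If \<open>0 \<le> q < 1\<close> bounds the symbol of
  \<open>E\<close>, then \<open>E ^ n\<close> has at most \<open>(n + 1) ^ r\<close> frequencies and each coefficient is at most \<open>q ^ n\<close>, since it is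
  a mean value of the \<open>n\<close>-th power of the symbol; hence the norms of the powers are summable. If the symbol is not bounded away
  from zero, a lacunary series is a final state out of reach. Finally, a control on \<open>[0, \<Sum>l. W l]\<close> can have
  arbitrary periodizations with respect to all the cycles at once, by a Chinese remainder argument which
  uses that the lines \<open>Re p = \<sigma> l\<close> are pairwise distinct.
\<close>

section \<open>Translation-invariant operators on periodic functions\<close>

text \<open>On \<open>L1\<close> there is no Plancherel theorem, so a bound on a symbol does not
  bound the operator; finite sums of translations are saved by the fact that their shifts can be
  counted. The convolution has several inputs and one output. Its right inverse has the form adjoint
  times inverse of (row times adjoint), and the operator \<open>E\<close> is the identity minus row
  times adjoint divided by an upper bound \<open>M\<close> of its symbol; the symbol of
  \<open>E\<close> then lies in [0, 1 - \<delta> / M]. Adjoints refer to the weight exp (- 2 *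
  \<sigma> * s), under which translations of quasiperiodic functions by a period are isometric.

  The control time comes from supports: a periodization for one period is prescribed by a control on
  a window of that length, and the operator that annihilates it lengthens the support of a control
  by the same length. Summing over the cycles gives exactly the total delay.

  Solutions are pointwise objects whose measurability is not assumed. Hence statements about null
  sets are made for arbitrary predicates, uniqueness is shown without measurability, and
  integrability is demanded only of Borel representatives.\<close>

definition periodic :: "real \<Rightarrow> (real \<Rightarrow> 'a) \<Rightarrow> bool" where
  "periodic W f \<longleftrightarrow> (\<forall>s. f (s + W) = f s)"

lemma periodic_of_nat:
  assumes "periodic W f" shows "f (s + of_nat n * W) = f s"
proof (induction n)
  case (Suc n)
  have "f (s + of_nat (Suc n) * W) = f ((s + of_nat n * W) + W)"
    by (simp add: algebra_simps)
  then show ?case using Suc assms by (simp add: periodic_def)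
qed simp

lemma periodic_of_int:
  assumes "periodic W f" shows "f (s + of_int k * W) = f s"
proof (cases "k \<ge> 0")
  case True
  then show ?thesis using periodic_of_nat[OF assms, of s "nat k"] by simp
next
  case False
  then show ?thesis using periodic_of_nat[OF assms, of "s + of_int k * W" "nat (-k)"]
    by simp
qed

definition mod_period :: "real \<Rightarrow> real \<Rightarrow> real" where "mod_period W x = x - of_int \<lfloor>x / W\<rfloor> * W"

lemma mod_period_bounds: assumes "W > 0" shows "0 \<le> mod_period W x" "mod_period W x < W"
proof -
  have "of_int \<lfloor>x / W\<rfloor> * W \<le> x" "x < (of_int \<lfloor>x / W\<rfloor> + 1) * W"
    using floor_divide_lower[OF assms] floor_divide_upper[OF assms] by auto
  then show "0 \<le> mod_period W x" "mod_period W x < W" by (simp_all add: mod_period_def algebra_simps)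
qed

lemma mod_period_add_int: assumes "W > 0" shows "mod_period W (x + of_int k * W) = mod_period W x"
  using assms by (simp add: mod_period_def add_divide_distrib algebra_simps)

lemma mod_period_add_mod_period: assumes "W > 0" shows "mod_period W (mod_period W x + y) = mod_period W (x + y)"
  using mod_period_add_int[OF assms, of "x + y" "- \<lfloor>x / W\<rfloor>"] by (simp add: mod_period_def[of W x] algebra_simps)

lemma periodic_mod_period: assumes "periodic W f" shows "f (s + mod_period W x) = f (s + x)"
  using periodic_of_int[OF assms, of "s + x" "- \<lfloor>x / W\<rfloor>"] by (simp add: mod_period_def algebra_simps)

text \<open>Borel rather than Lebesgue measurability keeps the class stable under translations and
  reflections; Lebesgue integrable data enter through Borel representatives.\<close>

definition locint :: "(real \<Rightarrow> real) \<Rightarrow> bool" where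
  "locint f \<longleftrightarrow> f \<in> borel_measurable borel \<and> (\<forall>a b. set_integrable lborel {a..b} f)"

lemma locint_measurable [measurable_dest]: "locint f \<Longrightarrow> f \<in> borel_measurable borel"
  by (simp add: locint_def)

lemma locint_0: "locint (\<lambda>s. 0)"
  by (simp add: locint_def set_integrable_def)

lemma locint_add: "locint f \<Longrightarrow> locint g \<Longrightarrow> locint (\<lambda>s. f s + g s)"
  by (auto simp: locint_def)

lemma locint_diff: "locint f \<Longrightarrow> locint g \<Longrightarrow> locint (\<lambda>s. f s - g s)"
  by (auto simp: locint_def)

lemma locint_cmult: "locint f \<Longrightarrow> locint (\<lambda>s. c * f s)"
  by (auto simp: locint_def)

lemma locint_sum: "(\<And>i. i \<in> I \<Longrightarrow> locint (f i)) \<Longrightarrow> locint (\<lambda>s. \<Sum>i\<in>I. f i s)"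
  by (induction I rule: infinite_finite_induct) (auto intro: locint_0 locint_add)

lemma locint_shift:
  assumes "locint f" shows "locint (\<lambda>s. f (s + c))"
proof -
  have "set_integrable lborel {a..b} (\<lambda>s. f (s + c))" for a b
  proof -
    have "integrable lborel (\<lambda>x. indicat_real {a + c..b + c} x *\<^sub>R f x)"
      using assms by (simp add: locint_def set_integrable_def)
    from lborel_integrable_real_affine[OF this, of 1 c]
    have "integrable lborel (\<lambda>x. indicat_real {a + c..b + c} (c + x) *\<^sub>R f (c + x))" by simp
    moreover have "indicat_real {a + c..b + c} (c + x) = indicat_real {a..b} x" for x
      by (simp add: indicator_def)
    ultimately show ?thesis by (simp add: set_integrable_def add.commute)
  qed
  moreover have "(\<lambda>s. f (s + c)) \<in> borel_measurable borel"
    using locint_measurable[OF assms] by measurable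
  ultimately show ?thesis by (simp add: locint_def)
qed

lemma locint_mult_continuous:
  assumes "locint f" and g: "continuous_on UNIV (g :: real \<Rightarrow> real)" shows "locint (\<lambda>s. g s * f s)"
proof -
  have gm[measurable]: "g \<in> borel_measurable borel"
    using g by (rule borel_measurable_continuous_onI)
  have fm[measurable]: "f \<in> borel_measurable borel" using assms by (simp add: locint_def)
  have "set_integrable lborel {a..b} (\<lambda>s. g s * f s)" for a b
  proof -
    have "compact (g ` {a..b})"
      by (rule compact_continuous_image[OF continuous_on_subset[OF g]]) simp_all
    then obtain B where "\<forall>y\<in>g ` {a..b}. norm y \<le> B"
      by (meson bounded_iff compact_imp_bounded)
    then have B: "\<And>s. s \<in> {a..b} \<Longrightarrow> \<bar>g s\<bar> \<le> B" by simp
    have "integrable lborel (\<lambda>x. indicat_real {a..b} x *\<^sub>R f x)"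
      using assms(1) by (simp add: locint_def set_integrable_def)
    then have "integrable lborel (\<lambda>x. B * (indicat_real {a..b} x *\<^sub>R f x))"
      by (rule integrable_mult_right)
    then show ?thesis unfolding set_integrable_def
    proof (rule Bochner_Integration.integrable_bound)
      show "AE x in lborel. norm (indicat_real {a..b} x *\<^sub>R (g x * f x)) \<le> norm (B * (indicat_real {a..b} x *\<^sub>R f x))"
      proof (rule AE_I2)
        fix x show "norm (indicat_real {a..b} x *\<^sub>R (g x * f x)) \<le> norm (B * (indicat_real {a..b} x *\<^sub>R f x))"
        proof (cases "x \<in> {a..b}")
          case True
          have "\<bar>g x\<bar> * \<bar>f x\<bar> \<le> \<bar>B\<bar> * \<bar>f x\<bar>"
            using B[OF True] by (intro mult_right_mono) linarith+
          then show ?thesis using True by (simp add: abs_mult)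
        qed simp
      qed
      show "(\<lambda>x. indicat_real {a..b} x *\<^sub>R (g x * f x)) \<in> borel_measurable lborel" by measurable
    qed
  qed
  then show ?thesis by (simp add: locint_def)
qed

section \<open>Translations, null sets and integrals over a period\<close>

lemma nn_integral_shift:
  fixes f :: "real \<Rightarrow> ennreal"
  assumes [measurable]: "f \<in> borel_measurable borel"
  shows "(\<integral>\<^sup>+ s. f (s + c) \<partial>lborel) = (\<integral>\<^sup>+ s. f s \<partial>lborel)"
  using nn_integral_real_affine[of f 1 c] by (simp add: add.commute)

text \<open>The predicate need not be measurable, so the translation is applied to a measurable null
  set containing the exceptions.\<close>

lemma AE_lborel_shift:
  fixes P :: "real \<Rightarrow> bool"
  assumes "AE s in lborel. P s" shows "AE s in lborel. P (s + c)"
proof -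
  obtain N where N: "{x \<in> space lborel. \<not> P x} \<subseteq> N" "emeasure lborel N = 0" "N \<in> sets lborel"
    using assms by (rule AE_E)
  then have "(\<integral>\<^sup>+ s. indicator N (s + c) \<partial>lborel) = 0"
    using nn_integral_shift[of "indicator N" c] by simp
  then have "AE s in lborel. indicator N (s + c) = (0 :: ennreal)"
    using N(3) by (subst (asm) nn_integral_0_iff_AE) auto
  then show ?thesis
    by (rule AE_mp) (use N(1) in \<open>auto intro!: AE_I2 simp: indicator_def\<close>)
qed

text \<open>After reducing \<open>c\<close> modulo \<open>W\<close>, the translated window is cut at
  \<open>W\<close>, and the piece beyond \<open>W\<close> is moved back by one period.\<close>

lemma nn_integral_periodic_shift:
  fixes f :: "real \<Rightarrow> ennreal"
  assumes W: "W > 0" and f: "periodic W f" and [measurable]: "f \<in> borel_measurable borel"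
  shows "(\<integral>\<^sup>+ s. f (s + c) * indicator {0..<W} s \<partial>lborel) = (\<integral>\<^sup>+ s. f s * indicator {0..<W} s \<partial>lborel)"
proof -
  define r where "r = mod_period W c"
  have r: "0 \<le> r" "r < W" unfolding r_def using mod_period_bounds[OF W] by auto
  have fr: "f (s + c) = f (s + r)" for s
    unfolding r_def by (simp add: periodic_mod_period[OF f])
  have "(\<integral>\<^sup>+ s. f (s + r) * indicator {0..<W} s \<partial>lborel)
      = (\<integral>\<^sup>+ s. f (s + r) * indicator {r..<W+r} (s + r) \<partial>lborel)"
    by (intro nn_integral_cong) (auto simp: indicator_def)
  also have "\<dots> = (\<integral>\<^sup>+ s. f s * indicator {r..<W+r} s \<partial>lborel)"
    by (rule nn_integral_shift) measurable
  also have "\<dots> = (\<integral>\<^sup>+ s. f s * indicator {r..<W} s + f s * indicator {W..<W+r} s \<partial>lborel)"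
    using r by (intro nn_integral_cong) (auto simp: indicator_def)
  also have "\<dots> = (\<integral>\<^sup>+ s. f s * indicator {r..<W} s \<partial>lborel) + (\<integral>\<^sup>+ s. f s * indicator {W..<W+r} s \<partial>lborel)"
    by (rule nn_integral_add) measurable
  also have "(\<integral>\<^sup>+ s. f s * indicator {W..<W+r} s \<partial>lborel) = (\<integral>\<^sup>+ s. f (s + W) * indicator {W..<W+r} (s + W) \<partial>lborel)"
    by (rule nn_integral_shift[symmetric]) measurable
  also have "\<dots> = (\<integral>\<^sup>+ s. f s * indicator {0..<r} s \<partial>lborel)"
    using f by (intro nn_integral_cong) (auto simp: indicator_def periodic_def)
  also have "(\<integral>\<^sup>+ s. f s * indicator {r..<W} s \<partial>lborel) + \<dots> = (\<integral>\<^sup>+ s. f s * indicator {r..<W} s + f s * indicator {0..<r} s \<partial>lborel)"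
    by (rule nn_integral_add[symmetric]) measurable
  also have "\<dots> = (\<integral>\<^sup>+ s. f s * indicator {0..<W} s \<partial>lborel)"
    using r by (intro nn_integral_cong) (auto simp: indicator_def)
  finally show ?thesis by (simp add: fr)
qed

lemma AE_periodic:
  assumes W: "W > 0" and P: "periodic W P" and ae: "AE s in lborel. s \<in> {0..<W} \<longrightarrow> P s"
  shows "AE s in lborel. P s"
proof -
  have "AE s in lborel. (s + of_int k * W \<in> {0..<W} \<longrightarrow> P (s + of_int k * W))" for k :: int
    using AE_lborel_shift[OF ae] .
  then have "AE s in lborel. \<forall>k::int. s + of_int k * W \<in> {0..<W} \<longrightarrow> P (s + of_int k * W)"
    by (simp add: AE_all_countable)
  then show ?thesis
  proof (rule AE_mp, intro AE_I2 impI)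
    fix s assume *: "\<forall>k::int. s + of_int k * W \<in> {0..<W} \<longrightarrow> P (s + of_int k * W)"
    have "s + of_int (- \<lfloor>s / W\<rfloor>) * W \<in> {0..<W}"
      using mod_period_bounds[OF W, of s] by (simp add: mod_period_def)
    with * have "P (s + of_int (- \<lfloor>s / W\<rfloor>) * W)" by blast
    then show "P s" by (simp only: periodic_of_int[OF P])
  qed
qed

lemma locint_periodic:
  assumes W: "W > 0" and f: "periodic W f" and m[measurable]: "f \<in> borel_measurable borel"
    and fin: "(\<integral>\<^sup>+ s. ennreal \<bar>f s\<bar> * indicator {0..<W} s \<partial>lborel) < \<infinity>"
  shows "locint f"
proof -
  have per: "periodic W (\<lambda>s. ennreal \<bar>f s\<bar>)" using f by (simp add: periodic_def)
  have "set_integrable lborel {a..b} f" for a b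
  proof -
    obtain n :: nat where n: "b - a < of_nat n * W"
      using W by (metis reals_Archimedean3)
    \<comment> \<open>Finitely many consecutive periods cover the interval, and each carries the
      same integral as {0..<W}.\<close>
    have fin': "(\<integral>\<^sup>+ s. ennreal \<bar>f s\<bar> * indicator {a..<a + of_nat n * W} s \<partial>lborel) < \<infinity>"
    proof (induction n)
      case (Suc n)
      have "indicator {a..<a + of_nat (Suc n) * W} s = (indicator {a..<a + of_nat n * W} s + indicator {a + of_nat n * W..<a + of_nat n * W + W} s :: ennreal)" for s
      proof -
        define q where "q = of_nat n * W"
        have "0 \<le> q" "of_nat (Suc n) * W = q + W" using W by (simp_all add: q_def algebra_simps)
        then show ?thesis using W unfolding indicator_def q_def[symmetric] by auto
      qed
      then have "(\<integral>\<^sup>+ s. ennreal \<bar>f s\<bar> * indicator {a..<a + of_nat (Suc n) * W} s \<partial>lborel)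
         = (\<integral>\<^sup>+ s. ennreal \<bar>f s\<bar> * indicator {a..<a + of_nat n * W} s + ennreal \<bar>f s\<bar> * indicator {a + of_nat n * W..<a + of_nat n * W + W} s \<partial>lborel)"
        by (simp add: distrib_left)
      also have "\<dots> = (\<integral>\<^sup>+ s. ennreal \<bar>f s\<bar> * indicator {a..<a + of_nat n * W} s \<partial>lborel)
          + (\<integral>\<^sup>+ s. ennreal \<bar>f s\<bar> * indicator {a + of_nat n * W..<a + of_nat n * W + W} s \<partial>lborel)"
        by (rule nn_integral_add) measurable
      also have "(\<integral>\<^sup>+ s. ennreal \<bar>f s\<bar> * indicator {a + of_nat n * W..<a + of_nat n * W + W} s \<partial>lborel)
        = (\<integral>\<^sup>+ s. ennreal \<bar>f (s + (a + of_nat n * W))\<bar> * indicator {a + of_nat n * W..<a + of_nat n * W + W} (s + (a + of_nat n * W)) \<partial>lborel)"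
        by (rule nn_integral_shift[symmetric]) measurable
      also have "\<dots> = (\<integral>\<^sup>+ s. ennreal \<bar>f (s + (a + of_nat n * W))\<bar> * indicator {0..<W} s \<partial>lborel)"
        by (intro nn_integral_cong) (auto simp: indicator_def)
      also have "\<dots> = (\<integral>\<^sup>+ s. ennreal \<bar>f s\<bar> * indicator {0..<W} s \<partial>lborel)"
        by (rule nn_integral_periodic_shift[OF W per]) measurable
      finally show ?case using Suc fin by simp
    qed simp
    have "(\<integral>\<^sup>+ s. ennreal (norm (indicat_real {a..b} s *\<^sub>R f s)) \<partial>lborel)
       \<le> (\<integral>\<^sup>+ s. ennreal \<bar>f s\<bar> * indicator {a..<a + of_nat n * W} s \<partial>lborel)"
      using n by (intro nn_integral_mono) (auto simp: indicator_def)
    also note fin'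
    finally show ?thesis unfolding set_integrable_def
      by (intro integrableI_bounded) auto
  qed
  then show ?thesis by (simp add: locint_def m)
qed

lemma locint_nn_integral:
  assumes "locint f" shows "(\<integral>\<^sup>+ s. ennreal \<bar>f s\<bar> * indicator {a..<b} s \<partial>lborel) < \<infinity>"
proof -
  have "integrable lborel (\<lambda>s. indicat_real {a..b} s *\<^sub>R f s)"
    using assms by (simp add: locint_def set_integrable_def)
  then have "(\<integral>\<^sup>+ s. ennreal (norm (indicat_real {a..b} s *\<^sub>R f s)) \<partial>lborel) < \<infinity>"
    by (simp add: integrable_iff_bounded)
  moreover have "(\<integral>\<^sup>+ s. ennreal \<bar>f s\<bar> * indicator {a..<b} s \<partial>lborel) \<le> (\<integral>\<^sup>+ s. ennreal (norm (indicat_real {a..b} s *\<^sub>R f s)) \<partial>lborel)"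
    by (intro nn_integral_mono) (auto simp: indicator_def)
  ultimately show ?thesis by (rule order.strict_trans1[rotated])
qed

section \<open>Powers of finite sums of translations\<close>

definition translation_sum :: "'r set \<Rightarrow> ('r \<Rightarrow> real) \<Rightarrow> ('r \<Rightarrow> real) \<Rightarrow> (real \<Rightarrow> 'a::real_vector) \<Rightarrow> real \<Rightarrow> 'a" where
  "translation_sum R e \<omega> f s = (\<Sum>r\<in>R. e r *\<^sub>R f (s + \<omega> r))"

text \<open>These are the shifts that can occur in the \<open>n\<close>-th power, modulo
  \<open>W\<close>. Letting each multiplicity range over {..n}, instead of fixing their total,
  enlarges the set but keeps its size polynomial in \<open>n\<close>.\<close>

definition frequencies :: "'r set \<Rightarrow> ('r \<Rightarrow> real) \<Rightarrow> real \<Rightarrow> nat \<Rightarrow> real set" where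
  "frequencies R \<omega> W n = (\<lambda>\<mu>. mod_period W (\<Sum>r\<in>R. of_nat (\<mu> r) * \<omega> r)) ` (R \<rightarrow>\<^sub>E {..n})"

lemma finite_frequencies: "finite R \<Longrightarrow> finite (frequencies R \<omega> W n)"
  by (simp add: frequencies_def finite_PiE)

lemma card_frequencies: assumes "finite R" shows "card (frequencies R \<omega> W n) \<le> (n + 1) ^ card R"
proof -
  have "card (frequencies R \<omega> W n) \<le> card (R \<rightarrow>\<^sub>E {..n})"
    unfolding frequencies_def by (rule card_image_le) (simp add: finite_PiE assms)
  also have "\<dots> = (n + 1) ^ card R" by (simp add: card_PiE assms)
  finally show ?thesis .
qed

lemma frequencies_Suc:
  assumes W: "W > 0" and R: "finite R" and r: "r \<in> R" and \<theta>: "\<theta> \<in> frequencies R \<omega> W n"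
  shows "mod_period W (\<theta> + \<omega> r) \<in> frequencies R \<omega> W (Suc n)"
proof -
  obtain \<mu> where \<mu>: "\<mu> \<in> R \<rightarrow>\<^sub>E {..n}" "\<theta> = mod_period W (\<Sum>r\<in>R. of_nat (\<mu> r) * \<omega> r)"
    using \<theta> by (auto simp: frequencies_def)
  define \<mu>' where "\<mu>' = \<mu>(r := Suc (\<mu> r))"
  have "(\<Sum>q\<in>R. of_nat (\<mu>' q) * \<omega> q) = (\<Sum>q\<in>R. of_nat (\<mu> q) * \<omega> q + (if q = r then \<omega> r else 0))"
    by (rule sum.cong) (auto simp: \<mu>'_def algebra_simps)
  also have "\<dots> = (\<Sum>q\<in>R. of_nat (\<mu> q) * \<omega> q) + \<omega> r"
    using R r by (simp add: sum.distrib)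
  finally have "mod_period W (\<theta> + \<omega> r) = mod_period W (\<Sum>q\<in>R. of_nat (\<mu>' q) * \<omega> q)"
    by (simp add: \<mu>(2) mod_period_add_mod_period[OF W])
  moreover have "\<mu>' \<in> R \<rightarrow>\<^sub>E {..Suc n}"
  proof (rule PiE_I)
    fix x assume "x \<in> R"
    then have "\<mu> x \<le> n" using \<mu>(1) by (auto simp: PiE_def Pi_def)
    then show "\<mu>' x \<in> {..Suc n}" by (auto simp: \<mu>'_def)
  next
    fix x assume "x \<notin> R"
    then show "\<mu>' x = undefined" using \<mu>(1) r by (auto simp: \<mu>'_def PiE_def extensional_def)
  qed
  ultimately show ?thesis unfolding frequencies_def by (rule image_eqI)
qed

lemma frequencies_bounds: "W > 0 \<Longrightarrow> \<theta> \<in> frequencies R \<omega> W n \<Longrightarrow> 0 \<le> \<theta> \<and> \<theta> < W"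
  by (auto simp: frequencies_def mod_period_bounds)

text \<open>The order of the quantifiers matters: one family \<open>C\<close> serves every periodic
  \<open>f\<close>. For complex values it can therefore be tested on characters and then applied to
  embedded real functions.\<close>

lemma translation_sum_power_expansion:
  assumes W: "W > 0" and R: "finite R"
  shows "\<exists>C. \<forall>f :: real \<Rightarrow> 'a::real_vector. periodic W f \<longrightarrow>
     (\<forall>s. (translation_sum R e \<omega> ^^ n) f s = (\<Sum>\<theta>\<in>frequencies R \<omega> W n. C \<theta> *\<^sub>R f (s + \<theta>)))"
proof (induction n)
  case 0
  have "(\<lambda>\<mu>. mod_period W (\<Sum>r\<in>R. of_nat (\<mu> r) * \<omega> r)) ` (R \<rightarrow>\<^sub>E {..0}) = (\<lambda>\<mu>. 0) ` (R \<rightarrow>\<^sub>E {..0::nat})"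
  proof (rule image_cong)
    fix \<mu> :: "'b \<Rightarrow> nat" assume "\<mu> \<in> R \<rightarrow>\<^sub>E {..0}"
    then have "(\<Sum>r\<in>R. of_nat (\<mu> r) * \<omega> r) = 0" by (intro sum.neutral) (auto simp: PiE_def Pi_def)
    then show "mod_period W (\<Sum>r\<in>R. of_nat (\<mu> r) * \<omega> r) = 0" by (simp add: mod_period_def)
  qed simp
  moreover have "(\<lambda>r. if r \<in> R then 0 else undefined) \<in> R \<rightarrow>\<^sub>E {..0::nat}" by auto
  then have "(\<lambda>\<mu>. 0::real) ` (R \<rightarrow>\<^sub>E {..0::nat}) = {0}" by blast
  ultimately have "frequencies R \<omega> W 0 = {0}" unfolding frequencies_def by (rule trans)
  then show ?case by (intro exI[of _ "\<lambda>_. 1"]) simp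
next
  case (Suc n)
  then obtain C where C: "\<And>f::real \<Rightarrow> 'a. \<And>s. periodic W f \<Longrightarrow> (translation_sum R e \<omega> ^^ n) f s = (\<Sum>\<theta>\<in>frequencies R \<omega> W n. C \<theta> *\<^sub>R f (s + \<theta>))"
    by blast
  let ?I = "R \<times> frequencies R \<omega> W n"
  let ?g = "\<lambda>(r, \<theta>). mod_period W (\<theta> + \<omega> r)"
  \<comment> \<open>Pairs with the same shift modulo \<open>W\<close> are merged, because characters
    separate only shifts that are distinct modulo \<open>W\<close>.\<close>
  define C' where "C' \<theta>' = (\<Sum>x\<in>{x \<in> ?I. ?g x = \<theta>'}. e (fst x) * C (snd x))" for \<theta>'
  have "(translation_sum R e \<omega> ^^ Suc n) f s = (\<Sum>\<theta>\<in>frequencies R \<omega> W (Suc n). C' \<theta> *\<^sub>R f (s + \<theta>))"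
    if f: "periodic W f" for f :: "real \<Rightarrow> 'a" and s
  proof -
    have "(translation_sum R e \<omega> ^^ Suc n) f s = (\<Sum>r\<in>R. \<Sum>\<theta>\<in>frequencies R \<omega> W n. (e r * C \<theta>) *\<^sub>R f (s + \<omega> r + \<theta>))"
      by (simp add: translation_sum_def C[OF f] scaleR_sum_right)
    also have "\<dots> = (\<Sum>x\<in>?I. (e (fst x) * C (snd x)) *\<^sub>R f (s + ?g x))"
      unfolding sum.cartesian_product
    proof (rule sum.cong, rule refl)
      fix x assume "x \<in> ?I"
      obtain r \<theta> where x: "x = (r, \<theta>)" by (cases x)
      have "f (s + \<omega> r + \<theta>) = f (s + mod_period W (\<theta> + \<omega> r))"
        by (simp add: periodic_mod_period[OF f] algebra_simps)
      then show "(case x of (r, \<theta>) \<Rightarrow> (e r * C \<theta>) *\<^sub>R f (s + \<omega> r + \<theta>)) = (e (fst x) * C (snd x)) *\<^sub>R f (s + ?g x)"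
        by (simp add: x)
    qed
    also have "\<dots> = (\<Sum>\<theta>\<in>frequencies R \<omega> W (Suc n). \<Sum>x\<in>{x \<in> ?I. ?g x = \<theta>}. (e (fst x) * C (snd x)) *\<^sub>R f (s + ?g x))"
    proof (rule sum.group[symmetric])
      show "?g ` ?I \<subseteq> frequencies R \<omega> W (Suc n)" using frequencies_Suc[OF W R] by auto
    qed (simp_all add: R finite_frequencies)
    also have "\<dots> = (\<Sum>\<theta>\<in>frequencies R \<omega> W (Suc n). C' \<theta> *\<^sub>R f (s + \<theta>))"
      by (rule sum.cong) (auto simp: C'_def scaleR_sum_left intro!: sum.cong)
    finally show ?thesis .
  qed
  then show ?case by blast
qed

section \<open>Coefficients recovered from the symbol\<close>

lemma geometric_sum_cis_bound:
  assumes "z \<noteq> 1" "norm (z::complex) = 1"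
  shows "norm (\<Sum>k<N. z ^ k) \<le> 2 / norm (1 - z)"
proof -
  have "(\<Sum>k<N. z ^ k) = (1 - z ^ N) / (1 - z)" using assms(1) by (simp add: sum_gp_strict)
  also have "norm \<dots> \<le> 2 / norm (1 - z)"
    using norm_triangle_ineq4[of 1 "z ^ N"] assms(2)
    by (simp add: norm_divide norm_power divide_right_mono)
  finally show ?thesis .
qed

text \<open>Distinct points of one period are separated by the character of index 1; this keeps the
  ratio of the geometric sums below different from 1.\<close>

lemma cis_distinct:
  assumes "W > 0" "0 \<le> x" "x < W" "0 \<le> y" "y < W" "x \<noteq> y"
  shows "cis (2 * pi * (x - y) / W) \<noteq> 1"
proof
  assume "cis (2 * pi * (x - y) / W) = 1"
  then have "cos (2 * pi * (x - y) / W) = 1" by (metis cis.simps(1) one_complex.simps(1))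
  then obtain n :: int where "2 * pi * (x - y) / W = of_int n * (2 * pi)"
    by (auto simp: cos_one_2pi_int)
  then have "2 * pi * (x - y - of_int n * W) = 0" using assms(1) by (simp add: field_simps)
  then have "x - y = of_int n * W" by simp
  moreover have "\<bar>x - y\<bar> < 1 * W" using assms by auto
  ultimately have "\<bar>of_int n\<bar> * W < 1 * W" using assms(1) by (simp add: abs_mult)
  then have "\<bar>of_int n :: real\<bar> < 1" using assms(1) by (simp only: mult_less_cancel_right)
  then have "n = 0" by linarith
  with \<open>x - y = of_int n * W\<close> assms show False by simp
qed

text \<open>The coefficient at \<open>\<theta>0\<close> is the mean of the sums multiplied by the conjugate character.\<close>

lemma coefficient_bound:
  assumes W: "W > 0" and G: "finite G" and G': "\<And>\<theta>. \<theta> \<in> G \<Longrightarrow> 0 \<le> \<theta> \<and> \<theta> < W"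
    and Q: "\<And>k::nat. norm (\<Sum>\<theta>\<in>G. C \<theta> *\<^sub>R cis (2 * pi * of_nat k * \<theta> / W)) \<le> Q"
    and \<theta>0: "\<theta>0 \<in> G"
  shows "\<bar>C \<theta>0\<bar> \<le> Q"
proof (rule ccontr)
  assume neg: "\<not> \<bar>C \<theta>0\<bar> \<le> Q"
  define z where "z \<theta> = cis (2 * pi * (\<theta> - \<theta>0) / W)" for \<theta>
  \<comment> \<open>The geometric sums of the other frequencies are bounded independently of
    \<open>N\<close>, so they disappear from the mean as \<open>N\<close> grows.\<close>
  define B where "B = (\<Sum>\<theta>\<in>G - {\<theta>0}. \<bar>C \<theta>\<bar> * (2 / norm (1 - z \<theta>)))"
  have "of_nat N * \<bar>C \<theta>0\<bar> \<le> of_nat N * Q + B" for N :: nat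
  proof -
    have zk: "C \<theta> *\<^sub>R cis (2 * pi * of_nat k * \<theta> / W) * cis (- 2 * pi * of_nat k * \<theta>0 / W) = C \<theta> *\<^sub>R z \<theta> ^ k" for \<theta> k
    proof -
      have "2 * pi * of_nat k * \<theta> / W + - 2 * pi * of_nat k * \<theta>0 / W = of_nat k * (2 * pi * (\<theta> - \<theta>0) / W)"
        by (simp add: diff_divide_distrib algebra_simps)
      then have "cis (2 * pi * of_nat k * \<theta> / W) * cis (- 2 * pi * of_nat k * \<theta>0 / W) = z \<theta> ^ k"
        unfolding z_def cis_mult Complex.DeMoivre by (rule arg_cong)
      then show ?thesis by (simp only: mult_scaleR_left)
    qed
    let ?S = "\<Sum>k<N. (\<Sum>\<theta>\<in>G. C \<theta> *\<^sub>R cis (2 * pi * of_nat k * \<theta> / W)) * cis (- 2 * pi * of_nat k * \<theta>0 / W)"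
    have S1: "norm ?S \<le> of_nat N * Q"
    proof -
      have "norm ?S \<le> (\<Sum>k<N. Q)" by (rule sum_norm_le) (use Q in \<open>simp add: norm_mult\<close>)
      then show ?thesis by simp
    qed
    have "?S = (\<Sum>k<N. \<Sum>\<theta>\<in>G. C \<theta> *\<^sub>R z \<theta> ^ k)"
      by (simp only: sum_distrib_right zk)
    also have "\<dots> = (\<Sum>\<theta>\<in>G. C \<theta> *\<^sub>R (\<Sum>k<N. z \<theta> ^ k))"
      by (subst sum.swap) (simp add: scaleR_sum_right)
    also have "\<dots> = C \<theta>0 *\<^sub>R of_nat N + (\<Sum>\<theta>\<in>G - {\<theta>0}. C \<theta> *\<^sub>R (\<Sum>k<N. z \<theta> ^ k))"
      by (subst sum.remove[OF G \<theta>0]) (simp add: z_def)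
    finally have "C \<theta>0 *\<^sub>R of_nat N = ?S - (\<Sum>\<theta>\<in>G - {\<theta>0}. C \<theta> *\<^sub>R (\<Sum>k<N. z \<theta> ^ k))" by simp
    then have "norm (C \<theta>0 *\<^sub>R (of_nat N :: complex)) \<le> norm ?S + norm (\<Sum>\<theta>\<in>G - {\<theta>0}. C \<theta> *\<^sub>R (\<Sum>k<N. z \<theta> ^ k))"
      by (simp only: norm_triangle_ineq4)
    also have "norm (\<Sum>\<theta>\<in>G - {\<theta>0}. C \<theta> *\<^sub>R (\<Sum>k<N. z \<theta> ^ k)) \<le> B"
      unfolding B_def
    proof (rule sum_norm_le)
      fix \<theta> assume \<theta>: "\<theta> \<in> G - {\<theta>0}"
      have "z \<theta> \<noteq> 1" unfolding z_def using \<theta> \<theta>0 G' W by (intro cis_distinct) auto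
      then have "norm (\<Sum>k<N. z \<theta> ^ k) \<le> 2 / norm (1 - z \<theta>)"
        by (rule geometric_sum_cis_bound) (simp add: z_def)
      then show "norm (C \<theta> *\<^sub>R (\<Sum>k<N. z \<theta> ^ k)) \<le> \<bar>C \<theta>\<bar> * (2 / norm (1 - z \<theta>))"
        by (simp only: norm_scaleR) (rule mult_left_mono, simp_all)
    qed
    finally show ?thesis using S1 by (simp add: mult.commute)
  qed
  then have *: "of_nat N * (\<bar>C \<theta>0\<bar> - Q) \<le> B" for N :: nat
    by (simp add: algebra_simps)
  obtain N :: nat where "B < of_nat N * (\<bar>C \<theta>0\<bar> - Q)"
    using neg by (metis reals_Archimedean3 diff_gt_0_iff_gt not_le)
  with *[of N] show False by simp
qed

lemma translation_sum_power_of_real: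
  "(translation_sum R e \<omega> ^^ n) (\<lambda>s. complex_of_real (f s)) s = complex_of_real ((translation_sum R e \<omega> ^^ n) f s)"
  by (induction n arbitrary: s) (simp_all add: translation_sum_def scaleR_conv_of_real)

text \<open>Characters are eigenfunctions of all translations, with the symbol as the eigenvalue of
  their sum.\<close>

lemma translation_sum_power_cis:
  shows "(translation_sum R e \<omega> ^^ n) (\<lambda>s. cis (a * s)) s = (\<Sum>r\<in>R. e r *\<^sub>R cis (a * \<omega> r)) ^ n * cis (a * s)"
proof (induction n arbitrary: s)
  case (Suc n)
  define g where "g = (translation_sum R e \<omega> ^^ n) (\<lambda>s. cis (a * s))"
  define E where "E = (\<Sum>r\<in>R. e r *\<^sub>R cis (a * \<omega> r))"
  have g: "g t = E ^ n * cis (a * t)" for t unfolding g_def E_def by (rule Suc)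
  have "cis (a * (s + \<omega> r)) = cis (a * \<omega> r) * cis (a * s)" for r
    by (simp add: cis_mult algebra_simps)
  then have "translation_sum R e \<omega> g s = (\<Sum>r\<in>R. (e r *\<^sub>R cis (a * \<omega> r)) * (E ^ n * cis (a * s)))"
    by (simp add: translation_sum_def g mult_ac)
  also have "\<dots> = E * (E ^ n * cis (a * s))"
    unfolding E_def[symmetric] sum_distrib_right[symmetric] ..
  also have "\<dots> = E ^ Suc n * cis (a * s)" by simp
  finally show ?case by (simp add: g_def E_def)
qed simp

lemma periodic_cis:
  assumes "W > 0" shows "periodic W (\<lambda>s. cis (2 * pi * of_nat k / W * s))"
proof -
  have "cis (2 * pi * of_nat k / W * (s + W)) = cis (2 * pi * of_nat k / W * s) * cis (2 * pi * of_nat k)" for s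
    using assms by (simp add: cis_mult field_simps)
  moreover have "cis (2 * pi * of_nat k) = 1" by (rule cis_multiple_2pi) simp
  ultimately show ?thesis by (simp add: periodic_def)
qed

text \<open>Applied to the \<open>k\<close>-th character and evaluated at 0, the expansion of the
  \<open>n\<close>-th power gives the \<open>n\<close>-th power of the symbol. So q ^ n bounds all
  the sums that \<open>coefficient_bound\<close> asks for.\<close>

lemma translation_sum_power_bound:
  assumes W: "W > 0" and R: "finite R"
    and q: "\<And>k::nat. norm (\<Sum>r\<in>R. e r *\<^sub>R cis (2 * pi * of_nat k / W * \<omega> r)) \<le> q"
    and f: "periodic W (f :: real \<Rightarrow> real)"
  shows "\<exists>C. (\<forall>s. (translation_sum R e \<omega> ^^ n) f s = (\<Sum>\<theta>\<in>frequencies R \<omega> W n. C \<theta> * f (s + \<theta>))) \<and>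
     (\<forall>\<theta>\<in>frequencies R \<omega> W n. \<bar>C \<theta>\<bar> \<le> q ^ n)"
proof -
  obtain C where "\<forall>f::real \<Rightarrow> complex. periodic W f \<longrightarrow> (\<forall>s. (translation_sum R e \<omega> ^^ n) f s = (\<Sum>\<theta>\<in>frequencies R \<omega> W n. C \<theta> *\<^sub>R f (s + \<theta>)))"
    using translation_sum_power_expansion[OF W R] ..
  then have C: "\<And>f::real \<Rightarrow> complex. \<And>s. periodic W f \<Longrightarrow> (translation_sum R e \<omega> ^^ n) f s = (\<Sum>\<theta>\<in>frequencies R \<omega> W n. C \<theta> *\<^sub>R f (s + \<theta>))"
    by (simp only:)
  have "complex_of_real ((translation_sum R e \<omega> ^^ n) f s) = complex_of_real (\<Sum>\<theta>\<in>frequencies R \<omega> W n. C \<theta> * f (s + \<theta>))" for s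
  proof -
    have "periodic W (\<lambda>s. complex_of_real (f s))" using f by (simp add: periodic_def)
    from C[OF this, of s] show ?thesis
      by (simp only: translation_sum_power_of_real) (simp add: scaleR_conv_of_real)
  qed
  then have 1: "(translation_sum R e \<omega> ^^ n) f s = (\<Sum>\<theta>\<in>frequencies R \<omega> W n. C \<theta> * f (s + \<theta>))" for s
    by (simp only: of_real_eq_iff)
  have "\<bar>C \<theta>\<bar> \<le> q ^ n" if "\<theta> \<in> frequencies R \<omega> W n" for \<theta>
  proof (rule coefficient_bound[OF W finite_frequencies[OF R] frequencies_bounds[OF W] _ that])
    fix k :: nat
    have "(\<Sum>\<theta>\<in>frequencies R \<omega> W n. C \<theta> *\<^sub>R cis (2 * pi * of_nat k * \<theta> / W))
        = (translation_sum R e \<omega> ^^ n) (\<lambda>s. cis (2 * pi * of_nat k / W * s)) 0"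
      unfolding C[OF periodic_cis[OF W]] by (intro sum.cong refl) (simp add: ac_simps)
    also have "norm \<dots> \<le> q ^ n"
      by (simp only: translation_sum_power_cis norm_mult norm_power norm_cis mult_1_right)
        (rule power_mono[OF q norm_ge_zero])
    finally show "norm (\<Sum>\<theta>\<in>frequencies R \<omega> W n. C \<theta> *\<^sub>R cis (2 * pi * of_nat k * \<theta> / W)) \<le> q ^ n" .
  qed
  with 1 show ?thesis by (intro exI[of _ C] conjI allI ballI)
qed

lemma translation_sum_power_measurable:
  "(f :: real \<Rightarrow> real) \<in> borel_measurable borel \<Longrightarrow> (translation_sum R e \<omega> ^^ n) f \<in> borel_measurable borel"
proof (induction n)
  case (Suc n)
  define g where "g = (translation_sum R e \<omega> ^^ n) f"
  have [measurable]: "g \<in> borel_measurable borel" using Suc by (simp add: g_def)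
  have "translation_sum R e \<omega> g = (\<lambda>s. \<Sum>r\<in>R. e r *\<^sub>R g (s + \<omega> r))" by (simp add: translation_sum_def fun_eq_iff)
  also have "\<dots> \<in> borel_measurable borel" by measurable
  finally show ?case by (simp add: g_def)
qed simp

lemma translation_sum_power_periodic:
  "periodic W f \<Longrightarrow> periodic W ((translation_sum R e \<omega> ^^ n) f)"
proof (induction n)
  case (Suc n)
  define g where "g = (translation_sum R e \<omega> ^^ n) f"
  have *: "g (s + W) = g s" for s using Suc by (simp add: g_def periodic_def)
  have "g (s + W + \<omega> r) = g (s + \<omega> r)" for s r
    using *[of "s + \<omega> r"] by (simp add: algebra_simps)
  then have "periodic W (translation_sum R e \<omega> g)" by (simp add: periodic_def translation_sum_def)
  then show ?case by (simp add: g_def)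
qed simp

text \<open>All translates of \<open>f\<close> have the same integral over a period; the factor is
  the bound on the number of shifts times the bound on a coefficient.\<close>

lemma translation_sum_power_nn_integral:
  assumes W: "W > 0" and R: "finite R"
    and q: "\<And>k::nat. norm (\<Sum>r\<in>R. e r *\<^sub>R cis (2 * pi * of_nat k / W * \<omega> r)) \<le> q"
    and f: "periodic W (f :: real \<Rightarrow> real)" and m[measurable]: "f \<in> borel_measurable borel"
  shows "(\<integral>\<^sup>+ s. ennreal \<bar>(translation_sum R e \<omega> ^^ n) f s\<bar> * indicator {0..<W} s \<partial>lborel)
     \<le> ennreal (of_nat (n + 1) ^ card R * q ^ n) * (\<integral>\<^sup>+ s. ennreal \<bar>f s\<bar> * indicator {0..<W} s \<partial>lborel)"
proof -
  have q0: "0 \<le> q" using q[of 0] norm_ge_zero by (rule order.trans[rotated])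
  let ?F = "frequencies R \<omega> W n" and ?I = "\<integral>\<^sup>+ s. ennreal \<bar>f s\<bar> * indicator {0..<W} s \<partial>lborel"
  obtain C where C: "\<And>s. (translation_sum R e \<omega> ^^ n) f s = (\<Sum>\<theta>\<in>?F. C \<theta> * f (s + \<theta>))"
     "\<And>\<theta>. \<theta> \<in> ?F \<Longrightarrow> \<bar>C \<theta>\<bar> \<le> q ^ n"
    using translation_sum_power_bound[OF W R q f] by blast
  have "(\<integral>\<^sup>+ s. ennreal \<bar>(translation_sum R e \<omega> ^^ n) f s\<bar> * indicator {0..<W} s \<partial>lborel)
     \<le> (\<integral>\<^sup>+ s. (\<Sum>\<theta>\<in>?F. ennreal (q ^ n) * (ennreal \<bar>f (s + \<theta>)\<bar> * indicator {0..<W} s)) \<partial>lborel)"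
  proof (rule nn_integral_mono)
    fix s
    have "\<bar>(translation_sum R e \<omega> ^^ n) f s\<bar> \<le> (\<Sum>\<theta>\<in>?F. q ^ n * \<bar>f (s + \<theta>)\<bar>)"
      unfolding C(1) by (rule order.trans[OF sum_abs sum_mono]) (simp add: abs_mult C(2) mult_right_mono)
    then have "ennreal \<bar>(translation_sum R e \<omega> ^^ n) f s\<bar> \<le> ennreal (\<Sum>\<theta>\<in>?F. q ^ n * \<bar>f (s + \<theta>)\<bar>)"
      by (rule ennreal_leI)
    also have "\<dots> = (\<Sum>\<theta>\<in>?F. ennreal (q ^ n) * ennreal \<bar>f (s + \<theta>)\<bar>)"
      using q0 by (subst sum_ennreal[symmetric]) (auto simp: ennreal_mult')
    finally show "ennreal \<bar>(translation_sum R e \<omega> ^^ n) f s\<bar> * indicator {0..<W} s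
       \<le> (\<Sum>\<theta>\<in>?F. ennreal (q ^ n) * (ennreal \<bar>f (s + \<theta>)\<bar> * indicator {0..<W} s))"
      by (simp add: indicator_def)
  qed
  also have "\<dots> = (\<Sum>\<theta>\<in>?F. ennreal (q ^ n) * (\<integral>\<^sup>+ s. ennreal \<bar>f (s + \<theta>)\<bar> * indicator {0..<W} s \<partial>lborel))"
    by (subst nn_integral_sum) (auto simp: nn_integral_cmult)
  also have "\<dots> = (\<Sum>\<theta>\<in>?F. ennreal (q ^ n) * ?I)"
  proof -
    have "periodic W (\<lambda>s. ennreal \<bar>f s\<bar>)" using f by (simp add: periodic_def)
    from nn_integral_periodic_shift[OF W this] show ?thesis by simp
  qed
  also have "\<dots> = of_nat (card ?F) * (ennreal (q ^ n) * ?I)" by simp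
  also have "\<dots> \<le> of_nat ((n + 1) ^ card R) * (ennreal (q ^ n) * ?I)"
    using card_frequencies[OF R] by (intro mult_right_mono) (simp_all only: of_nat_le_iff zero_le)
  also have "\<dots> = ennreal (of_nat (n + 1) ^ card R * q ^ n) * ?I"
    using q0 by (simp add: ennreal_mult' ennreal_of_nat_eq_real_of_nat mult.assoc)
  finally show ?thesis .
qed

section \<open>The Neumann series\<close>

lemma summable_poly_geometric:
  assumes "0 \<le> q" "q < 1" shows "summable (\<lambda>n. of_nat (n + 1) ^ m * q ^ n :: real)"
proof -
  have "(\<lambda>n. (1 + inverse (of_nat (Suc n))) ^ m * q) \<longlonglongrightarrow> (1 + 0) ^ m * q"
    by (intro tendsto_intros LIMSEQ_inverse_real_of_nat)
  \<comment> \<open>The ratio of consecutive terms tends to \<open>q\<close>, and (1 + q) / 2 lies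
    strictly between \<open>q\<close> and 1.\<close>
  then have "\<forall>\<^sub>F n in sequentially. (1 + inverse (of_nat (Suc n))) ^ m * q < (1 + q) / 2"
    using assms by (intro order_tendstoD(2)) auto
  then obtain N where N: "\<And>n. n \<ge> N \<Longrightarrow> (1 + inverse (of_nat (Suc n))) ^ m * q < (1 + q) / 2"
    by (auto simp: eventually_sequentially)
  show ?thesis
  proof (rule summable_ratio_test[of "(1 + q) / 2" N])
    fix n assume "N \<le> n"
    have "of_nat (Suc n + 1) = (of_nat (n + 1) * (1 + inverse (of_nat (Suc n))) :: real)"
      by (simp add: field_simps)
    then have "of_nat (Suc n + 1) ^ m * q ^ Suc n = of_nat (n + 1) ^ m * q ^ n * ((1 + inverse (of_nat (Suc n))) ^ m * q)"
      by (simp only: power_mult_distrib) simp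
    also have "\<dots> \<le> of_nat (n + 1) ^ m * q ^ n * ((1 + q) / 2)"
      using N[OF \<open>N \<le> n\<close>] assms by (intro mult_left_mono) auto
    finally show "norm (of_nat (Suc n + 1) ^ m * q ^ Suc n) \<le> (1 + q) / 2 * norm (of_nat (n + 1) ^ m * q ^ n)"
      using assms by (simp add: abs_mult mult.commute)
  qed (use assms in simp)
qed

text \<open>The series of powers converges in mean over one period, hence absolutely almost
  everywhere on the line by periodicity. Where it converges absolutely at \<open>s\<close> and at
  the finitely many points \<open>s + \<omega> r\<close>, the operator may be applied termwise and
  only the first term remains.\<close>

theorem translation_sum_neumann:
  assumes W: "W > 0" and R: "finite R" and q1: "q < 1"
    and q: "\<And>k::nat. norm (\<Sum>r\<in>R. e r *\<^sub>R cis (2 * pi * of_nat k / W * \<omega> r)) \<le> q"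
    and g: "periodic W (g :: real \<Rightarrow> real)" "locint g"
  shows "\<exists>f :: real \<Rightarrow> real. periodic W f \<and> locint f \<and> (AE s in lborel. f s - translation_sum R e \<omega> f s = g s)"
proof -
  have q0: "0 \<le> q" using q[of 0] norm_ge_zero by (rule order.trans[rotated])
  have [measurable]: "g \<in> borel_measurable borel" using g(2) by (rule locint_measurable)
  define F where "F n = (translation_sum R e \<omega> ^^ n) g" for n
  have Fm[measurable]: "F n \<in> borel_measurable borel" for n
    unfolding F_def by (rule translation_sum_power_measurable) measurable
  have Fp: "periodic W (F n)" for n unfolding F_def by (rule translation_sum_power_periodic[OF g(1)])
  have F0: "F 0 = g" and FS: "F (Suc n) = translation_sum R e \<omega> (F n)" for n by (simp_all add: F_def)
  \<comment> \<open>At points of divergence \<open>suminf\<close> has some default value; this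
    leaves \<open>f\<close> measurable and periodic, and these points form a null set.\<close>
  define f where "f s = (\<Sum>n. F n s)" for s
  define K where "K n = of_nat (n + 1) ^ card R * q ^ n" for n :: nat
  let ?N = "\<lambda>f. \<integral>\<^sup>+ s. ennreal \<bar>f s\<bar> * indicator {0..<W} s \<partial>lborel"
  have K0: "0 \<le> K n" for n using q0 by (simp add: K_def)
  have Ksum: "summable K" unfolding K_def[abs_def] by (rule summable_poly_geometric[OF q0 q1])
  have fin: "(\<integral>\<^sup>+ s. (\<Sum>n. ennreal \<bar>F n s\<bar> * indicator {0..<W} s) \<partial>lborel) < \<infinity>"
  proof -
    have "(\<integral>\<^sup>+ s. (\<Sum>n. ennreal \<bar>F n s\<bar> * indicator {0..<W} s) \<partial>lborel) = (\<Sum>n. ?N (F n))"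
      by (rule nn_integral_suminf) measurable
    also have "\<dots> \<le> (\<Sum>n. ennreal (K n) * ?N g)"
    proof (intro suminf_le summableI)
      fix n show "?N (F n) \<le> ennreal (K n) * ?N g"
        unfolding F_def K_def by (rule translation_sum_power_nn_integral[OF W R q g(1)]) measurable
    qed
    also have "\<dots> = ennreal (suminf K) * ?N g"
      by (simp add: ennreal_suminf_multc[symmetric] suminf_ennreal2[OF K0 Ksum])
    also have "\<dots> < \<infinity>" using locint_nn_integral[OF g(2), of 0 W]
      by (simp add: ennreal_mult_less_top)
    finally show ?thesis .
  qed
  have f_per: "periodic W f" using Fp by (simp add: f_def periodic_def)
  have f_meas[measurable]: "f \<in> borel_measurable borel" unfolding f_def[abs_def] by measurable
  have sm: "AE s in lborel. summable (\<lambda>n. \<bar>F n s\<bar>)"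
  proof (rule AE_periodic[OF W])
    show "periodic W (\<lambda>s. summable (\<lambda>n. \<bar>F n s\<bar>))" using Fp by (simp add: periodic_def)
    have "AE s in lborel. (\<Sum>n. ennreal \<bar>F n s\<bar> * indicator {0..<W} s) \<noteq> \<infinity>"
      by (rule nn_integral_PInf_AE) (use fin in auto)
    then show "AE s in lborel. s \<in> {0..<W} \<longrightarrow> summable (\<lambda>n. \<bar>F n s\<bar>)"
    proof (rule AE_mp, intro AE_I2 impI)
      fix s assume "(\<Sum>n. ennreal \<bar>F n s\<bar> * indicator {0..<W} s) \<noteq> \<infinity>" "s \<in> {0..<W}"
      then have "(\<Sum>n. ennreal \<bar>F n s\<bar>) \<noteq> \<infinity>" by simp
      then show "summable (\<lambda>n. \<bar>F n s\<bar>)" by (intro summable_suminf_not_top) auto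
    qed
  qed
  have "?N f \<le> (\<integral>\<^sup>+ s. (\<Sum>n. ennreal \<bar>F n s\<bar> * indicator {0..<W} s) \<partial>lborel)"
  proof (rule nn_integral_mono_AE, rule AE_mp[OF sm], intro AE_I2 impI)
    fix s assume s: "summable (\<lambda>n. \<bar>F n s\<bar>)"
    have "ennreal \<bar>f s\<bar> \<le> ennreal (\<Sum>n. \<bar>F n s\<bar>)"
      unfolding f_def by (intro ennreal_leI summable_rabs s)
    also have "\<dots> = (\<Sum>n. ennreal \<bar>F n s\<bar>)" by (rule suminf_ennreal2[symmetric]) (use s in auto)
    finally show "ennreal \<bar>f s\<bar> * indicator {0..<W} s \<le> (\<Sum>n. ennreal \<bar>F n s\<bar> * indicator {0..<W} s)"
      by (simp add: indicator_def)
  qed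
  then have "locint f" using fin by (intro locint_periodic[OF W f_per]) auto
  moreover have "AE s in lborel. f s - translation_sum R e \<omega> f s = g s"
  proof -
    have "AE s in lborel. summable (\<lambda>n. \<bar>F n s\<bar>) \<and> (\<forall>r\<in>R. summable (\<lambda>n. \<bar>F n (s + \<omega> r)\<bar>))"
      using R by (intro AE_conjI sm AE_finite_allI AE_lborel_shift)
    then show ?thesis
    proof (rule AE_mp, intro AE_I2 impI)
      fix s assume s: "summable (\<lambda>n. \<bar>F n s\<bar>) \<and> (\<forall>r\<in>R. summable (\<lambda>n. \<bar>F n (s + \<omega> r)\<bar>))"
      have s0: "summable (\<lambda>n. F n s)" using s by (blast intro: summable_rabs_cancel)
      have sr: "summable (\<lambda>n. F n (s + \<omega> r))" if "r \<in> R" for r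
        using s that by (blast intro: summable_rabs_cancel)
      have "translation_sum R e \<omega> f s = (\<Sum>r\<in>R. \<Sum>n. e r * F n (s + \<omega> r))"
        unfolding translation_sum_def f_def real_scaleR_def
        by (intro sum.cong refl suminf_mult[symmetric] sr)
      also have "\<dots> = (\<Sum>n. \<Sum>r\<in>R. e r * F n (s + \<omega> r))"
        by (rule suminf_sum[symmetric]) (intro summable_mult sr)
      also have "\<dots> = (\<Sum>n. F (Suc n) s)" by (simp add: FS translation_sum_def)
      also have "\<dots> = f s - F 0 s"
        unfolding f_def by (rule suminf_split_head[OF s0])
      finally show "f s - translation_sum R e \<omega> f s = g s" by (simp add: F0)
    qed
  qed
  ultimately show ?thesis using f_per by blast
qed

section \<open>Quasiperiodic functions and periodization\<close>

definition quasiperiodic :: "real \<Rightarrow> real \<Rightarrow> (real \<Rightarrow> real) \<Rightarrow> bool" where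
  "quasiperiodic \<kappa> W v \<longleftrightarrow> (\<forall>s. v (s + W) = \<kappa> * v s)"

text \<open>Half-open intervals are used because windows of length \<open>W\<close> then tile the
  line without overlap.\<close>

definition supported :: "real \<Rightarrow> real \<Rightarrow> (real \<Rightarrow> real) \<Rightarrow> bool" where
  "supported a b u \<longleftrightarrow> (\<forall>s. s \<notin> {a..<b} \<longrightarrow> u s = 0)"

text \<open>The sum is only meaningful for functions with bounded support, for which its index set is finite.\<close>

definition periodize :: "real \<Rightarrow> real \<Rightarrow> (real \<Rightarrow> real) \<Rightarrow> real \<Rightarrow> real" where
  "periodize \<kappa> W u s = (\<Sum>n | u (s - of_int n * W) \<noteq> 0. \<kappa> powi n * u (s - of_int n * W))"

lemma periodize_superset:
  assumes "finite A" "\<And>n. u (s - of_int n * W) \<noteq> 0 \<Longrightarrow> n \<in> A"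
  shows "periodize \<kappa> W u s = (\<Sum>n\<in>A. \<kappa> powi n * u (s - of_int n * W))"
  unfolding periodize_def by (rule sum.mono_neutral_left) (use assms in auto)

lemma supported_index:
  assumes W: "W > 0" and u: "supported a b u" and n: "u (s - of_int n * W) \<noteq> 0"
    and s: "c \<le> s" "s \<le> d"
  shows "n \<in> {\<lfloor>(c - b) / W\<rfloor>..\<lceil>(d - a) / W\<rceil>}"
proof -
  have "s - of_int n * W \<in> {a..<b}" using u n by (auto simp: supported_def)
  with s have "c - b \<le> of_int n * W" "of_int n * W \<le> d - a" by auto
  then have "(c - b) / W \<le> of_int n" "of_int n \<le> (d - a) / W"
    using W by (simp_all add: pos_divide_le_eq pos_le_divide_eq)
  then show ?thesis by (simp add: floor_le_iff le_ceiling_iff)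
qed

text \<open>On a bounded interval one finite index set serves all points. Locally the periodization
  is thus a finite sum of translates, from which linearity and local integrability follow.\<close>

lemma periodize_eq:
  assumes W: "W > 0" and u: "supported a b u" and s: "c \<le> s" "s \<le> d"
  shows "periodize \<kappa> W u s = (\<Sum>n\<in>{\<lfloor>(c - b) / W\<rfloor>..\<lceil>(d - a) / W\<rceil>}. \<kappa> powi n * u (s - of_int n * W))"
  by (rule periodize_superset) (auto intro: supported_index[OF W u _ s] simp del: atLeastAtMost_iff)

lemma periodize_quasiperiodic:
  assumes "\<kappa> \<noteq> 0" shows "quasiperiodic \<kappa> W (periodize \<kappa> W u)"
proof -
  have "periodize \<kappa> W u (s + W) = \<kappa> * periodize \<kappa> W u s" for s
  proof -
    have "(\<Sum>n | u (s + W - of_int n * W) \<noteq> 0. \<kappa> powi n * u (s + W - of_int n * W))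
       = (\<Sum>n | u (s - of_int n * W) \<noteq> 0. \<kappa> powi (n + 1) * u (s - of_int n * W))"
      by (rule sum.reindex_bij_witness[where i = "\<lambda>n. n + 1" and j = "\<lambda>n. n - 1"]) (auto simp: algebra_simps)
    also have "\<dots> = \<kappa> * (\<Sum>n | u (s - of_int n * W) \<noteq> 0. \<kappa> powi n * u (s - of_int n * W))"
      using assms by (simp add: power_int_add sum_distrib_left mult_ac)
    finally show ?thesis by (simp add: periodize_def)
  qed
  then show ?thesis by (simp add: quasiperiodic_def)
qed

lemma periodize_shift: "periodize \<kappa> W (\<lambda>s. u (s + c)) s = periodize \<kappa> W u (s + c)"
  by (simp add: periodize_def algebra_simps)

lemma supported_mono: "supported a b u \<Longrightarrow> a' \<le> a \<Longrightarrow> b \<le> b' \<Longrightarrow> supported a' b' u"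
  by (force simp: supported_def)

lemma supported_shift: "supported a b u \<Longrightarrow> supported (a - c) (b - c) (\<lambda>s. u (s + c))"
  by (auto simp: supported_def)

lemma supported_cmult: "supported a b u \<Longrightarrow> supported a b (\<lambda>s. c * u s)"
  by (auto simp: supported_def)

lemma supported_add: "supported a b u \<Longrightarrow> supported a b v \<Longrightarrow> supported a b (\<lambda>s. u s + v s)"
  by (auto simp: supported_def)

lemma supported_sum: "(\<And>i. i \<in> I \<Longrightarrow> supported a b (u i)) \<Longrightarrow> supported a b (\<lambda>s. \<Sum>i\<in>I. u i s)"
  by (auto simp: supported_def intro!: sum.neutral)

lemma periodize_cmult:
  assumes "W > 0" "supported a b u"
  shows "periodize \<kappa> W (\<lambda>s. c * u s) s = c * periodize \<kappa> W u s"
  unfolding periodize_eq[OF assms order.refl order.refl] periodize_eq[OF assms(1) supported_cmult[OF assms(2)] order.refl order.refl]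
  by (simp add: sum_distrib_left mult_ac)

lemma periodize_add:
  assumes "W > 0" "supported a b u" "supported a' b' v"
  shows "periodize \<kappa> W (\<lambda>s. u s + v s) s = periodize \<kappa> W u s + periodize \<kappa> W v s"
proof -
  have u: "supported (min a a') (max b b') u" and v: "supported (min a a') (max b b') v"
    using assms by (auto intro: supported_mono)
  show ?thesis
    unfolding periodize_eq[OF assms(1) u order.refl order.refl] periodize_eq[OF assms(1) v order.refl order.refl]
      periodize_eq[OF assms(1) supported_add[OF u v] order.refl order.refl]
    by (simp add: sum.distrib distrib_left)
qed

lemma periodize_sum:
  assumes "W > 0" "\<And>i. i \<in> I \<Longrightarrow> supported a b (u i)"
  shows "periodize \<kappa> W (\<lambda>s. \<Sum>i\<in>I. u i s) s = (\<Sum>i\<in>I. periodize \<kappa> W (u i) s)"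
  using assms(2)
proof (induction I rule: infinite_finite_induct)
  case (insert i I)
  have "supported a b (\<lambda>s. \<Sum>i\<in>I. u i s)" using insert by (intro supported_sum) auto
  from periodize_add[OF assms(1) _ this, of a b "u i"] show ?case using insert by simp
qed (simp_all add: periodize_def)

lemma quasiperiodic_of_int:
  assumes "quasiperiodic \<kappa> W v" "\<kappa> \<noteq> 0" shows "v (s + of_int n * W) = \<kappa> powi n * v s"
proof (induction n rule: int_induct[where k = 0])
  case (step1 n)
  have "v (s + of_int (n + 1) * W) = v ((s + of_int n * W) + W)" by (simp add: algebra_simps)
  also have "\<dots> = \<kappa> * v (s + of_int n * W)" using assms(1) by (simp add: quasiperiodic_def)
  finally show ?case using step1 assms(2) by (simp add: power_int_add)
next
  case (step2 n)
  have "v (s + of_int n * W) = v ((s + of_int (n - 1) * W) + W)" by (simp add: algebra_simps)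
  also have "\<dots> = \<kappa> * v (s + of_int (n - 1) * W)" using assms(1) by (simp add: quasiperiodic_def)
  finally show ?case using step2 assms(2) by (simp add: power_int_diff field_simps)
qed simp

lemma shift_into_period:
  fixes s :: real
  assumes "W > 0" shows "\<exists>n::int. s - of_int n * W \<in> {a..<a + W}"
proof
  show "s - of_int \<lfloor>(s - a) / W\<rfloor> * W \<in> {a..<a + W}"
    using mod_period_bounds[OF assms, of "s - a"] by (auto simp: mod_period_def)
qed

lemma periodize_fundamental:
  assumes W: "W > 0" and u: "supported a (a + W) u" and s: "s \<in> {a..<a + W}"
  shows "periodize \<kappa> W u s = u s"
proof -
  have "periodize \<kappa> W u s = (\<Sum>n\<in>{0}. \<kappa> powi n * u (s - of_int n * W))"
  proof (rule periodize_superset)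
    fix n assume "u (s - of_int n * W) \<noteq> 0"
    then have "s - of_int n * W \<in> {a..<a + W}" using u by (auto simp: supported_def)
    with s have "\<bar>of_int n * W\<bar> < 1 * W" by auto
    then have "\<bar>of_int n :: real\<bar> < 1" using W by (simp only: abs_mult abs_of_pos mult_less_cancel_right)
    then show "n \<in> {0}" by auto
  qed simp
  then show ?thesis by simp
qed

text \<open>Both sides agree on the window {a..<a + W} and have the same multiplier. Cutting to one
  period therefore inverts \<open>periodize\<close>, which provides controls for a single
  cycle.\<close>

lemma periodize_restrict:
  assumes W: "W > 0" and \<kappa>: "\<kappa> \<noteq> 0" and v: "quasiperiodic \<kappa> W v"
  shows "periodize \<kappa> W (\<lambda>s. indicator {a..<a + W} s * v s) s = v s"
proof -
  let ?u = "\<lambda>s. indicator {a..<a + W} s * v s"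
  obtain n :: int where n: "s - of_int n * W \<in> {a..<a + W}" using shift_into_period[OF W] ..
  have "supported a (a + W) ?u" by (auto simp: supported_def)
  from periodize_fundamental[OF W this n] n
  have "periodize \<kappa> W ?u (s - of_int n * W) = v (s - of_int n * W)" by simp
  moreover have "periodize \<kappa> W ?u s = \<kappa> powi n * periodize \<kappa> W ?u (s - of_int n * W)"
    using quasiperiodic_of_int[OF periodize_quasiperiodic[OF \<kappa>] \<kappa>, of W ?u "s - of_int n * W" n] by simp
  moreover have "v s = \<kappa> powi n * v (s - of_int n * W)"
    using quasiperiodic_of_int[OF v \<kappa>, of "s - of_int n * W" n] by simp
  ultimately show ?thesis by simp
qed

lemma locint_periodize:
  assumes W: "W > 0" and u: "supported a b u" and l: "locint u"
  shows "locint (periodize \<kappa> W u)"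
proof -
  have fin: "locint (\<lambda>s. \<Sum>n\<in>A. \<kappa> powi n * u (s - of_int n * W))" for A
  proof (intro locint_sum locint_cmult)
    fix n :: int
    show "locint (\<lambda>s. u (s - of_int n * W))" using locint_shift[OF l, of "- of_int n * W"] by simp
  qed
  have eq: "indicator {c..d} s * periodize \<kappa> W u s =
     indicator {c..d} s * (\<Sum>n\<in>{\<lfloor>(c - b) / W\<rfloor>..\<lceil>(d - a) / W\<rceil>}. \<kappa> powi n * u (s - of_int n * W))" for c d s
    using periodize_eq[OF W u, of c s d] by (auto simp: indicator_def)
  \<comment> \<open>The finite index set depends on the interval, so measurability is first obtained
    on bounded intervals and then passed to the limit.\<close>
  have "(\<lambda>s. indicator {- of_nat i..of_nat i} s * periodize \<kappa> W u s) \<in> borel_measurable borel" for i :: nat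
    unfolding eq using locint_measurable[OF fin] by measurable
  moreover have "(\<lambda>i. indicator {- of_nat i..of_nat i} s * periodize \<kappa> W u s) \<longlonglongrightarrow> periodize \<kappa> W u s" for s :: real
  proof (rule tendsto_eventually)
    obtain N :: nat where N: "\<bar>s\<bar> \<le> of_nat N" using real_arch_simple by blast
    show "\<forall>\<^sub>F i in sequentially. indicator {- of_nat i..of_nat i} s * periodize \<kappa> W u s = periodize \<kappa> W u s"
      using eventually_ge_at_top[of N]
    proof eventually_elim
      case (elim i)
      then have "\<bar>s\<bar> \<le> of_nat i" using N by (meson of_nat_le_iff order.trans)
      then show ?case by (auto simp: indicator_def)
    qed
  qed
  ultimately have m: "periodize \<kappa> W u \<in> borel_measurable borel"
    by (rule borel_measurable_LIMSEQ_real[rotated])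
  have "set_integrable lborel {c..d} (periodize \<kappa> W u)" for c d
    using fin[of "{\<lfloor>(c - b) / W\<rfloor>..\<lceil>(d - a) / W\<rceil>}"]
    by (simp add: locint_def set_integrable_def eq)
  with m show ?thesis by (simp add: locint_def)
qed

lemma locint_indicator:
  assumes "locint f" shows "locint (\<lambda>s. indicator {a..<b} s * f s)"
proof -
  have [measurable]: "f \<in> borel_measurable borel" using assms by (rule locint_measurable)
  have "set_integrable lborel {c..d} (\<lambda>s. indicator {a..<b} s * f s)" for c d
  proof -
    have "integrable lborel (\<lambda>s. indicat_real {c..d} s *\<^sub>R f s)"
      using assms by (simp add: locint_def set_integrable_def)
    then show ?thesis unfolding set_integrable_def
      by (rule Bochner_Integration.integrable_bound) (auto simp: indicator_def)
  qed
  then show ?thesis by (simp add: locint_def)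
qed

lemma supported_indicator: "supported a b (\<lambda>s. indicator {a..<b} s * f s)"
  by (auto simp: supported_def)

section \<open>Translation equations for quasiperiodic functions\<close>

lemma quasiperiodic_weight:
  assumes "\<kappa> = exp (\<sigma> * W)"
  shows "quasiperiodic \<kappa> W v \<longleftrightarrow> periodic W (\<lambda>s. exp (- \<sigma> * s) * v s)"
proof -
  have "exp (- \<sigma> * (s + W)) * v (s + W) = exp (- \<sigma> * s) * v s \<longleftrightarrow> v (s + W) = \<kappa> * v s" for s
  proof -
    have "exp (- \<sigma> * (s + W)) = exp (- \<sigma> * s) / \<kappa>"
      by (simp add: assms exp_diff[symmetric] algebra_simps)
    moreover have "a / k * x = a * y \<longleftrightarrow> x = k * y" if "a > 0" "k > 0" for a k x y :: real
      using that by (auto simp: field_simps)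
    ultimately show ?thesis using assms by simp
  qed
  then show ?thesis by (simp add: quasiperiodic_def periodic_def)
qed

lemma periodic_weight:
  assumes "\<kappa> = exp (\<sigma> * W)" "periodic W f"
  shows "quasiperiodic \<kappa> W (\<lambda>s. exp (\<sigma> * s) * f s)"
proof -
  have "exp (- \<sigma> * s) * (exp (\<sigma> * s) * f s) = f s" for s
    by (simp add: mult.assoc[symmetric] exp_add[symmetric])
  then have "(\<lambda>s. exp (- \<sigma> * s) * (exp (\<sigma> * s) * f s)) = f" by (rule ext)
  with assms(2) show ?thesis unfolding quasiperiodic_weight[OF assms(1)] by (simp only:)
qed

text \<open>Conjugation by exp (\<sigma> * s) turns the multiplier into 1 and multiplies each
  coefficient by the same exponential at its shift. This is the origin of the weights in the
  symbol.\<close>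

lemma quasiperiodic_translate_combination:
  assumes W: "W > 0" and \<kappa>: "\<kappa> = exp (\<sigma> * W)" and R: "finite R" and q1: "q < 1"
    and q: "\<And>k::nat. norm (\<Sum>r\<in>R. (e r * exp (\<sigma> * \<omega> r)) *\<^sub>R cis (2 * pi * of_nat k / W * \<omega> r)) \<le> q"
    and g: "quasiperiodic \<kappa> W g" "locint g"
  shows "\<exists>f. quasiperiodic \<kappa> W f \<and> locint f \<and> (AE s in lborel. f s - (\<Sum>r\<in>R. e r * f (s + \<omega> r)) = g s)"
proof -
  let ?e = "\<lambda>r. e r * exp (\<sigma> * \<omega> r)"
  have cont: "continuous_on UNIV (\<lambda>s. exp (c * s))" for c :: real by (intro continuous_intros)
  have "periodic W (\<lambda>s. exp (- \<sigma> * s) * g s)" using g(1) quasiperiodic_weight[OF \<kappa>] by simp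
  moreover have "locint (\<lambda>s. exp (- \<sigma> * s) * g s)"
    by (rule locint_mult_continuous[OF g(2) cont])
  ultimately obtain f where f: "periodic W f" "locint f"
      "AE s in lborel. f s - translation_sum R ?e \<omega> f s = exp (- \<sigma> * s) * g s"
    using translation_sum_neumann[OF W R q1 q, of "\<lambda>s. exp (- \<sigma> * s) * g s"] by blast
  have "AE s in lborel. exp (\<sigma> * s) * f s - (\<Sum>r\<in>R. e r * (exp (\<sigma> * (s + \<omega> r)) * f (s + \<omega> r))) = g s"
    using f(3)
  proof eventually_elim
    case (elim s)
    have "(\<Sum>r\<in>R. e r * (exp (\<sigma> * (s + \<omega> r)) * f (s + \<omega> r))) = exp (\<sigma> * s) * translation_sum R ?e \<omega> f s"
      by (simp add: translation_sum_def sum_distrib_left distrib_left exp_add mult_ac)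
    then have "exp (\<sigma> * s) * f s - (\<Sum>r\<in>R. e r * (exp (\<sigma> * (s + \<omega> r)) * f (s + \<omega> r)))
      = exp (\<sigma> * s) * (f s - translation_sum R ?e \<omega> f s)" by (simp add: right_diff_distrib)
    also have "\<dots> = g s" unfolding elim by (simp add: mult.assoc[symmetric] exp_add[symmetric])
    finally show ?case .
  qed
  moreover have "quasiperiodic \<kappa> W (\<lambda>s. exp (\<sigma> * s) * f s)" by (rule periodic_weight[OF \<kappa> f(1)])
  moreover have "locint (\<lambda>s. exp (\<sigma> * s) * f s)" by (rule locint_mult_continuous[OF f(2) cont])
  ultimately show ?thesis by (intro exI[of _ "\<lambda>s. exp (\<sigma> * s) * f s"]) blast
qed

lemma quasiperiodic_shift: "quasiperiodic \<kappa> W f \<Longrightarrow> quasiperiodic \<kappa> W (\<lambda>s. f (s + c))"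
proof -
  assume "quasiperiodic \<kappa> W f"
  then have "f ((s + c) + W) = \<kappa> * f (s + c)" for s by (simp only: quasiperiodic_def)
  then show ?thesis by (simp add: quasiperiodic_def algebra_simps)
qed

lemma quasiperiodic_cmult: "quasiperiodic \<kappa> W f \<Longrightarrow> quasiperiodic \<kappa> W (\<lambda>s. c * f s)"
  by (simp add: quasiperiodic_def)

lemma quasiperiodic_diff: "quasiperiodic \<kappa> W f \<Longrightarrow> quasiperiodic \<kappa> W g \<Longrightarrow> quasiperiodic \<kappa> W (\<lambda>s. f s - g s)"
  by (simp add: quasiperiodic_def right_diff_distrib)

lemma quasiperiodic_sum: "(\<And>i. i \<in> I \<Longrightarrow> quasiperiodic \<kappa> W (f i)) \<Longrightarrow> quasiperiodic \<kappa> W (\<lambda>s. \<Sum>i\<in>I. f i s)"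
  by (simp add: quasiperiodic_def sum_distrib_left)

text \<open>The symbol of the shift term has the modulus \<alpha> * exp (- \<sigma> * c) at every
  frequency. Below 1 the Neumann series applies directly; above 1 the equation is translated by
  \<open>c\<close> and divided by - \<alpha>, which inverts the modulus. The value 1 is the
  resonance.\<close>

lemma quasiperiodic_difference_equation:
  assumes W: "W > 0" and \<kappa>: "\<kappa> = exp (\<sigma> * W)" and \<alpha>: "\<alpha> > 0" "\<alpha> * exp (- \<sigma> * c) \<noteq> 1"
    and g: "quasiperiodic \<kappa> W g" "locint g"
  shows "\<exists>f. quasiperiodic \<kappa> W f \<and> locint f \<and> (AE s in lborel. f s - \<alpha> * f (s - c) = g s)"
proof (cases "\<alpha> * exp (- \<sigma> * c) < 1")
  case True
  \<comment> \<open>The sum over the one element of the unit type brings the single shift into the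
    form of the general lemma.\<close>
  have "\<exists>f. quasiperiodic \<kappa> W f \<and> locint f \<and> (AE s in lborel. f s - (\<Sum>r\<in>{()}. \<alpha> * f (s + - c)) = g s)"
    by (rule quasiperiodic_translate_combination[OF W \<kappa> _ True _ g])
      (use \<alpha>(1) in \<open>auto simp: norm_mult\<close>)
  then show ?thesis by simp
next
  case False
  with \<alpha> have *: "1 < \<alpha> * exp (- \<sigma> * c)" by simp
  have inv: "inverse \<alpha> * exp (\<sigma> * c) = inverse (\<alpha> * exp (- \<sigma> * c))"
    using \<alpha>(1) by (simp add: exp_minus)
  have lt: "inverse \<alpha> * exp (\<sigma> * c) < 1" unfolding inv using * unfolding inverse_less_1_iff by blast
  have g': "quasiperiodic \<kappa> W (\<lambda>s. (- inverse \<alpha>) * g (s + c))" "locint (\<lambda>s. (- inverse \<alpha>) * g (s + c))"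
    by (intro quasiperiodic_cmult quasiperiodic_shift g locint_cmult locint_shift)+
  have "\<exists>f. quasiperiodic \<kappa> W f \<and> locint f \<and> (AE s in lborel. f s - (\<Sum>r\<in>{()}. inverse \<alpha> * f (s + c)) = - inverse \<alpha> * g (s + c))"
    by (rule quasiperiodic_translate_combination[OF W \<kappa> _ lt _ g'])
      (use \<alpha>(1) in \<open>auto simp: norm_mult\<close>)
  then obtain f where f: "quasiperiodic \<kappa> W f" "locint f"
      "AE s in lborel. f s - inverse \<alpha> * f (s + c) = - inverse \<alpha> * g (s + c)" by auto
  have "AE s in lborel. f s - \<alpha> * f (s - c) = g s"
    using AE_lborel_shift[OF f(3), of "- c"]
  proof eventually_elim
    case (elim s)
    have "\<alpha> * (f (s - c) - inverse \<alpha> * f s) = \<alpha> * (- inverse \<alpha> * g s)" using elim by simp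
    moreover have "\<alpha> * inverse \<alpha> = 1" using \<alpha>(1) by simp
    ultimately show ?case by (simp add: right_diff_distrib mult.assoc[symmetric])
  qed
  with f show ?thesis by blast
qed

text \<open>The operator \<open>u \<mapsto> u - \<kappa> L * u (\<cdot> - W L)\<close> annihilates the periodization with respect to \<open>W L\<close>, and it is
  invertible on the functions that are quasiperiodic with respect to the other periods.\<close>

theorem simultaneous_interpolation:
  fixes W \<sigma> :: "nat \<Rightarrow> real" and v :: "nat \<Rightarrow> real \<Rightarrow> real"
  assumes W: "\<And>l. l < L \<Longrightarrow> W l > 0"
    and \<sigma>: "\<And>i j. i < L \<Longrightarrow> j < L \<Longrightarrow> i \<noteq> j \<Longrightarrow> \<sigma> i \<noteq> \<sigma> j"
    and v: "\<And>l. l < L \<Longrightarrow> quasiperiodic (exp (\<sigma> l * W l)) (W l) (v l)" "\<And>l. l < L \<Longrightarrow> locint (v l)"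
  shows "\<exists>u. locint u \<and> supported 0 (\<Sum>l<L. W l) u \<and>
     (\<forall>l<L. AE s in lborel. periodize (exp (\<sigma> l * W l)) (W l) u s = v l s)"
  using assms
proof (induction L arbitrary: v)
  case 0
  then show ?case by (intro exI[of _ "\<lambda>_. 0"]) (simp add: locint_0 supported_def)
next
  case (Suc L)
  define \<kappa> where "\<kappa> l = exp (\<sigma> l * W l)" for l
  have \<kappa>0: "\<kappa> l \<noteq> 0" for l by (simp add: \<kappa>_def)
  \<comment> \<open>Alone, \<open>w\<close> settles the last period. Its periodizations for the
    other periods are errors that the remaining part of the control has to compensate.\<close>
  define w where "w s = indicator {0..<0 + W L} s * v L s" for s
  have w: "supported 0 (0 + W L) w" "locint w"
    unfolding w_def[abs_def] using Suc.prems(4)[of L] by (simp_all only: locint_indicator supported_indicator lessI)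
  have Pw: "periodize (\<kappa> L) (W L) w s = v L s" for s
    unfolding w_def[abs_def]
    by (rule periodize_restrict[OF Suc.prems(1)[OF lessI] \<kappa>0]) (unfold \<kappa>_def, rule Suc.prems(3)[OF lessI])
  have "\<exists>t. quasiperiodic (\<kappa> l) (W l) t \<and> locint t \<and>
      (AE s in lborel. t s - \<kappa> L * t (s - W L) = v l s - periodize (\<kappa> l) (W l) w s)" if "l \<in> {..<L}" for l
  proof (rule quasiperiodic_difference_equation[of "W l" "\<kappa> l" "\<sigma> l"])
    \<comment> \<open>The modulus that has to differ from 1 is exp ((\<sigma> L - \<sigma> l) * W
      L); here the distinctness of the lines excludes resonance.\<close>
    have "\<sigma> L \<noteq> \<sigma> l" using Suc.prems(2) that by simp
    then have "(\<sigma> L - \<sigma> l) * W L \<noteq> 0" using Suc.prems(1)[of L] by auto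
    then show "\<kappa> L * exp (- \<sigma> l * W L) \<noteq> 1"
      by (simp add: \<kappa>_def exp_add[symmetric] left_diff_distrib)
    show "quasiperiodic (\<kappa> l) (W l) (\<lambda>s. v l s - periodize (\<kappa> l) (W l) w s)"
      using Suc.prems(3)[of l] that by (intro quasiperiodic_diff periodize_quasiperiodic \<kappa>0) (simp add: \<kappa>_def)
    show "locint (\<lambda>s. v l s - periodize (\<kappa> l) (W l) w s)"
      using Suc.prems(1)[of l] Suc.prems(4)[of l] that by (intro locint_diff locint_periodize[OF _ w]) simp_all
    show "W l > 0" using Suc.prems(1)[of l] that by simp
  qed (simp_all add: \<kappa>_def)
  then have "\<forall>l\<in>{..<L}. \<exists>t. quasiperiodic (\<kappa> l) (W l) t \<and> locint t \<and>
      (AE s in lborel. t s - \<kappa> L * t (s - W L) = v l s - periodize (\<kappa> l) (W l) w s)" by (rule ballI)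
  from bchoice[OF this] obtain t where t': "\<forall>l\<in>{..<L}. quasiperiodic (\<kappa> l) (W l) (t l) \<and> locint (t l) \<and>
      (AE s in lborel. t l s - \<kappa> L * t l (s - W L) = v l s - periodize (\<kappa> l) (W l) w s)" ..
  have t: "quasiperiodic (\<kappa> l) (W l) (t l)" "locint (t l)"
      "AE s in lborel. t l s - \<kappa> L * t l (s - W L) = v l s - periodize (\<kappa> l) (W l) w s" if "l < L" for l
    using bspec[OF t', of l] that by (simp_all only: lessThan_iff)
  have "\<exists>u. locint u \<and> supported 0 (\<Sum>l<L. W l) u \<and>
     (\<forall>l<L. AE s in lborel. periodize (exp (\<sigma> l * W l)) (W l) u s = t l s)"
  proof (rule Suc.IH)
    fix l assume l: "l < L"
    show "0 < W l" using Suc.prems(1)[of l] l by simp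
    show "quasiperiodic (exp (\<sigma> l * W l)) (W l) (t l)" using t(1)[OF l] by (simp only: \<kappa>_def)
    show "locint (t l)" by (rule t(2)[OF l])
  next
    fix i j assume "i < L" "j < L" "i \<noteq> j"
    then show "\<sigma> i \<noteq> \<sigma> j" using Suc.prems(2)[of i j] by simp
  qed
  then obtain u where u': "locint u \<and> supported 0 (\<Sum>l<L. W l) u \<and>
     (\<forall>l<L. AE s in lborel. periodize (exp (\<sigma> l * W l)) (W l) u s = t l s)" ..
  have u: "locint u" "supported 0 (\<Sum>l<L. W l) u"
      "\<And>l. l < L \<Longrightarrow> AE s in lborel. periodize (\<kappa> l) (W l) u s = t l s"
    using u' by (simp_all only: \<kappa>_def)
  define S where "S = (\<Sum>l<L. W l)"
  have S0: "0 \<le> S" unfolding S_def using Suc.prems(1) by (intro sum_nonneg) (simp add: less_imp_le)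
  have WL: "W L > 0" using Suc.prems(1) by simp
  \<comment> \<open>The part added to \<open>w\<close> has zero periodization for
    \<open>W L\<close>. For \<open>l < L\<close> it contributes t l s - \<kappa> L * t l (s - W L),
    which is \<open>v l\<close> minus the error of \<open>w\<close>. Its support ends at S + W
    L.\<close>
  define u' where "u' s = w s + (u s + (- \<kappa> L) * u (s + - W L))" for s
  have us: "supported 0 S u" using u(2) by (simp add: S_def)
  have us1: "supported (0 - - W L) (S - - W L) (\<lambda>s. u (s + - W L))" by (rule supported_shift[OF us])
  have us1': "supported (0 - - W L) (S - - W L) (\<lambda>s. (- \<kappa> L) * u (s + - W L))" by (rule supported_cmult[OF us1])
  have us2: "supported 0 (S + W L) (\<lambda>s. u s + (- \<kappa> L) * u (s + - W L))"
    by (intro supported_add supported_mono[OF us] supported_mono[OF us1']) (use WL in auto)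
  have P: "periodize (\<kappa> l) (W l) u' s = periodize (\<kappa> l) (W l) w s
     + (periodize (\<kappa> l) (W l) u s - \<kappa> L * periodize (\<kappa> l) (W l) u (s - W L))" if "l < Suc L" for l s
  proof -
    have Wl: "W l > 0" using Suc.prems(1) that by simp
    show ?thesis unfolding u'_def[abs_def]
      by (simp only: periodize_add[OF Wl w(1) us2] periodize_add[OF Wl us us1'] periodize_cmult[OF Wl us1] periodize_shift) simp
  qed
  have "AE s in lborel. periodize (\<kappa> l) (W l) u' s = v l s" if l: "l < Suc L" for l
  proof (cases "l = L")
    case True
    have "quasiperiodic (\<kappa> L) (W L) (periodize (\<kappa> L) (W L) u)" by (rule periodize_quasiperiodic[OF \<kappa>0])
    then have "periodize (\<kappa> L) (W L) u (s - W L + W L) = \<kappa> L * periodize (\<kappa> L) (W L) u (s - W L)" for s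
      by (simp only: quasiperiodic_def)
    then have "periodize (\<kappa> L) (W L) u s - \<kappa> L * periodize (\<kappa> L) (W L) u (s - W L) = 0" for s
      unfolding diff_add_cancel right_minus_eq .
    then have "periodize (\<kappa> L) (W L) u' s = v L s" for s
      by (simp only: P[OF lessI] Pw add_0_right)
    then show ?thesis unfolding True by (intro AE_I2)
  next
    case False
    then have l: "l < L" using l by simp
    show ?thesis using u(3)[OF l] AE_lborel_shift[OF u(3)[OF l], of "- W L"] t(3)[OF l]
      by eventually_elim (use l in \<open>simp add: P\<close>)
  qed
  moreover have "locint u'" unfolding u'_def[abs_def]
    by (intro locint_add locint_cmult locint_shift w u)
  moreover have "supported 0 (S + W L) u'" unfolding u'_def[abs_def]
    by (intro supported_add us2 supported_mono[OF w(1)]) (use S0 in auto)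
  ultimately show ?case by (intro exI[of _ u']) (simp add: S_def \<kappa>_def)
qed

text \<open>This is the symbol of a convolution times its adjoint: the shifts of the product are the
  differences a i - a j.\<close>

lemma sum_cis_abs_square:
  fixes \<gamma> :: "'i \<Rightarrow> real"
  shows "(\<Sum>i\<in>I. \<Sum>j\<in>I. (\<gamma> i * \<gamma> j) *\<^sub>R cis (\<theta> * (a i - a j))) = of_real ((cmod (\<Sum>i\<in>I. \<gamma> i *\<^sub>R cis (\<theta> * a i)))\<^sup>2)"
proof -
  have "(\<gamma> i * \<gamma> j) *\<^sub>R cis (\<theta> * (a i - a j)) = (\<gamma> i *\<^sub>R cis (\<theta> * a i)) * cnj (\<gamma> j *\<^sub>R cis (\<theta> * a j))" for i j
    by (simp add: cis_cnj cis_mult right_diff_distrib)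
  then have "(\<Sum>i\<in>I. \<Sum>j\<in>I. (\<gamma> i * \<gamma> j) *\<^sub>R cis (\<theta> * (a i - a j)))
     = (\<Sum>i\<in>I. \<gamma> i *\<^sub>R cis (\<theta> * a i)) * cnj (\<Sum>i\<in>I. \<gamma> i *\<^sub>R cis (\<theta> * a i))"
    by (simp only: cnj_sum sum_product)
  then show ?thesis by (simp only: complex_norm_square)
qed

text \<open>A row of convolutions is inverted from the right through its adjoint: if row times
  adjoint maps \<open>f\<close> to \<open>g\<close>, the adjoint of \<open>f\<close> solves the
  system. Row times adjoint has the sum of the squared moduli as its symbol, so the lower bound
  makes it invertible although no single entry need be.\<close>

theorem quasiperiodic_convolution_system:
  fixes \<beta> :: "'c::finite \<Rightarrow> 'i \<Rightarrow> real"
  assumes W: "W > 0" and \<kappa>: "\<kappa> = exp (\<sigma> * W)" and I: "finite I" and \<delta>: "\<delta> > 0"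
    and lower: "\<And>k::nat. \<delta> \<le> (\<Sum>c\<in>UNIV. (cmod (\<Sum>i\<in>I. (\<beta> c i * exp (\<sigma> * a i)) *\<^sub>R cis (2 * pi * of_nat k / W * a i)))\<^sup>2)"
    and g: "quasiperiodic \<kappa> W g" "locint g"
  shows "\<exists>v. (\<forall>c. quasiperiodic \<kappa> W (v c) \<and> locint (v c)) \<and>
     (AE s in lborel. (\<Sum>c\<in>UNIV. \<Sum>i\<in>I. \<beta> c i * v c (s + a i)) = g s)"
proof -
  define \<gamma> where "\<gamma> c i = \<beta> c i * exp (\<sigma> * a i)" for c i
  define A where "A k = (\<Sum>c\<in>UNIV. (cmod (\<Sum>i\<in>I. \<gamma> c i *\<^sub>R cis (2 * pi * of_nat k / W * a i)))\<^sup>2)" for k :: nat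
  \<comment> \<open>The triangle inequality bounds the symbol of row times adjoint by
    \<open>M\<close> at all frequencies; dividing by \<open>M\<close> puts it into
    [\<delta> / M, 1].\<close>
  define M where "M = \<delta> + (\<Sum>c\<in>UNIV. (\<Sum>i\<in>I. \<bar>\<gamma> c i\<bar>)\<^sup>2)"
  have A1: "\<delta> \<le> A k" for k using lower[of k] by (simp add: A_def \<gamma>_def)
  have A2: "A k \<le> M" for k
  proof -
    have "A k \<le> (\<Sum>c\<in>UNIV. (\<Sum>i\<in>I. \<bar>\<gamma> c i\<bar>)\<^sup>2)"
      unfolding A_def by (intro sum_mono power_mono sum_norm_le) auto
    then show ?thesis using \<delta> by (simp add: M_def)
  qed
  have M: "M > 0" using \<delta> A1[of 0] A2[of 0] by linarith
  \<comment> \<open>The index \<open>None\<close> stands for the identity and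
    \<open>Some (i, j)\<close> for the translation by a i - a j, so the combination over
    \<open>R\<close> is the identity minus row times adjoint divided by \<open>M\<close>.\<close>
  define R where "R = insert None (Some ` (I \<times> I))"
  define e where "e r = (case r of None \<Rightarrow> 1 | Some (i, j) \<Rightarrow> - (\<Sum>c\<in>UNIV. \<beta> c i * \<beta> c j * exp (2 * \<sigma> * a j)) / M)" for r
  define \<omega> where "\<omega> r = (case r of None \<Rightarrow> 0 | Some (i, j) \<Rightarrow> a i - a j)" for r
  have sumR: "(\<Sum>r\<in>R. f r) = f None + (\<Sum>i\<in>I. \<Sum>j\<in>I. f (Some (i, j)))" for f :: "('i \<times> 'i) option \<Rightarrow> 'x::real_vector"
    using I by (simp add: R_def sum.reindex sum.cartesian_product inj_on_def case_prod_unfold)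
  have eexp: "e (Some (i, j)) * exp (\<sigma> * \<omega> (Some (i, j))) = - (\<Sum>c\<in>UNIV. \<gamma> c i * \<gamma> c j) / M" for i j
  proof -
    have "exp (2 * \<sigma> * a j) * exp (\<sigma> * (a i - a j)) = exp (\<sigma> * a i) * exp (\<sigma> * a j)"
      by (simp add: exp_add[symmetric] algebra_simps)
    then have "\<beta> c i * \<beta> c j * exp (2 * \<sigma> * a j) * exp (\<sigma> * (a i - a j)) = \<gamma> c i * \<gamma> c j" for c
      by (simp add: \<gamma>_def mult_ac)
    then show ?thesis by (simp add: e_def \<omega>_def sum_distrib_right)
  qed
  have symbol: "(\<Sum>r\<in>R. (e r * exp (\<sigma> * \<omega> r)) *\<^sub>R cis (2 * pi * of_nat k / W * \<omega> r)) = of_real (1 - A k / M)" for k :: nat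
  proof -
    define \<theta> where "\<theta> = 2 * pi * of_nat k / W"
    have "(\<Sum>r\<in>R. (e r * exp (\<sigma> * \<omega> r)) *\<^sub>R cis (\<theta> * \<omega> r))
      = 1 - (\<Sum>i\<in>I. \<Sum>j\<in>I. ((\<Sum>c\<in>UNIV. \<gamma> c i * \<gamma> c j) / M) *\<^sub>R cis (\<theta> * (a i - a j)))"
      unfolding sumR eexp by (simp add: e_def \<omega>_def sum_negf)
    also have "(\<Sum>i\<in>I. \<Sum>j\<in>I. ((\<Sum>c\<in>UNIV. \<gamma> c i * \<gamma> c j) / M) *\<^sub>R cis (\<theta> * (a i - a j)))
      = (1 / M) *\<^sub>R (\<Sum>i\<in>I. \<Sum>j\<in>I. \<Sum>c\<in>UNIV. (\<gamma> c i * \<gamma> c j) *\<^sub>R cis (\<theta> * (a i - a j)))"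
      by (simp add: scaleR_sum_right scaleR_sum_left[symmetric] mult.commute)
    also have "(\<Sum>i\<in>I. \<Sum>j\<in>I. \<Sum>c\<in>UNIV. (\<gamma> c i * \<gamma> c j) *\<^sub>R cis (\<theta> * (a i - a j)))
      = (\<Sum>c\<in>UNIV. \<Sum>i\<in>I. \<Sum>j\<in>I. (\<gamma> c i * \<gamma> c j) *\<^sub>R cis (\<theta> * (a i - a j)))"
      by (subst sum.swap[of _ UNIV]) (rule sum.swap)
    also have "\<dots> = of_real (A k)"
      by (simp only: sum_cis_abs_square A_def of_real_sum \<theta>_def)
    finally show ?thesis by (simp add: \<theta>_def scaleR_conv_of_real)
  qed
  have q: "norm (\<Sum>r\<in>R. (e r * exp (\<sigma> * \<omega> r)) *\<^sub>R cis (2 * pi * of_nat k / W * \<omega> r)) \<le> 1 - \<delta> / M" for k :: nat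
  proof -
    have "\<delta> / M \<le> A k / M" "A k / M \<le> 1" using A1[of k] A2[of k] M by (simp_all add: divide_right_mono)
    then show ?thesis unfolding symbol norm_of_real by simp
  qed
  have q1: "1 - \<delta> / M < 1" using \<delta> M by simp
  have R: "finite R" using I by (simp add: R_def)
  have g': "quasiperiodic \<kappa> W (\<lambda>s. (1 / M) * g s)" "locint (\<lambda>s. (1 / M) * g s)"
    by (intro quasiperiodic_cmult locint_cmult g)+
  obtain f where f: "quasiperiodic \<kappa> W f" "locint f"
      "AE s in lborel. f s - (\<Sum>r\<in>R. e r * f (s + \<omega> r)) = (1 / M) * g s"
    using quasiperiodic_translate_combination[OF W \<kappa> R q1 q g'] by (elim exE conjE)
  \<comment> \<open>This is the adjoint applied to \<open>f\<close>. Moving a translation by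
    \<open>a j\<close> to the other side of the pairing with weight exp (- 2 * \<sigma> * s)
    produces the factor exp (2 * \<sigma> * a j).\<close>
  define v where "v c s = (\<Sum>j\<in>I. (\<beta> c j * exp (2 * \<sigma> * a j)) * f (s + - a j))" for c s
  have "quasiperiodic \<kappa> W (v c) \<and> locint (v c)" for c
    unfolding v_def[abs_def]
    by (intro conjI quasiperiodic_sum quasiperiodic_cmult quasiperiodic_shift f locint_sum locint_cmult locint_shift)
  moreover have "AE s in lborel. (\<Sum>c\<in>UNIV. \<Sum>i\<in>I. \<beta> c i * v c (s + a i)) = g s"
    using f(3)
  proof eventually_elim
    case (elim s)
    have "(\<Sum>r\<in>R. e r * f (s + \<omega> r)) = f s + (\<Sum>i\<in>I. \<Sum>j\<in>I. - (\<Sum>c\<in>UNIV. \<beta> c i * \<beta> c j * exp (2 * \<sigma> * a j)) / M * f (s + (a i - a j)))"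
      unfolding sumR by (simp add: e_def \<omega>_def)
    also have "\<dots> = f s - (1 / M) * (\<Sum>i\<in>I. \<Sum>j\<in>I. \<Sum>c\<in>UNIV. \<beta> c i * \<beta> c j * exp (2 * \<sigma> * a j) * f (s + (a i - a j)))"
      by (simp add: sum_negf sum_distrib_left sum_distrib_right sum_divide_distrib)
    also have "(\<Sum>i\<in>I. \<Sum>j\<in>I. \<Sum>c\<in>UNIV. \<beta> c i * \<beta> c j * exp (2 * \<sigma> * a j) * f (s + (a i - a j)))
       = (\<Sum>c\<in>UNIV. \<Sum>i\<in>I. \<Sum>j\<in>I. \<beta> c i * \<beta> c j * exp (2 * \<sigma> * a j) * f (s + (a i - a j)))"
      by (subst sum.swap[of _ UNIV]) (rule sum.swap)
    also have "\<dots> = (\<Sum>c\<in>UNIV. \<Sum>i\<in>I. \<beta> c i * v c (s + a i))"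
      by (simp add: v_def sum_distrib_left mult_ac algebra_simps)
    finally have "(1 / M) * (\<Sum>c\<in>UNIV. \<Sum>i\<in>I. \<beta> c i * v c (s + a i)) = (1 / M) * g s" using elim by linarith
    then show ?case using M by simp
  qed
  ultimately show ?thesis by blast
qed

section \<open>Necessity of the lower bound on the symbol\<close>

lemma integral_periodic_shift:
  fixes H :: "real \<Rightarrow> complex"
  assumes W: "W > 0" and H: "periodic W H" and int: "\<And>a b. integrable lborel (\<lambda>s. indicat_real {a..<b} s *\<^sub>R H s)"
  shows "(\<integral>s. indicat_real {0..<W} s *\<^sub>R H (s + c) \<partial>lborel) = (\<integral>s. indicat_real {0..<W} s *\<^sub>R H s \<partial>lborel)"
proof -
  define r where "r = mod_period W c"
  have r: "0 \<le> r" "r < W" unfolding r_def using mod_period_bounds[OF W] by auto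
  have shift: "(\<integral>s. f (s + t) \<partial>lborel) = (\<integral>s. f s \<partial>lborel)" for f :: "real \<Rightarrow> complex" and t
    using lborel_integral_real_affine[of 1 f t] by (simp add: add.commute)
  have "(\<integral>s. indicat_real {0..<W} s *\<^sub>R H (s + c) \<partial>lborel) = (\<integral>s. indicat_real {r..<W + r} (s + r) *\<^sub>R H (s + r) \<partial>lborel)"
    using periodic_mod_period[OF H, of _ c] by (intro Bochner_Integration.integral_cong) (auto simp: indicator_def r_def)
  also have "\<dots> = (\<integral>s. indicat_real {r..<W + r} s *\<^sub>R H s \<partial>lborel)" by (rule shift)
  also have "\<dots> = (\<integral>s. indicat_real {r..<W} s *\<^sub>R H s + indicat_real {W..<W + r} s *\<^sub>R H s \<partial>lborel)"
    using r by (intro Bochner_Integration.integral_cong) (auto simp: indicator_def)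
  also have "\<dots> = (\<integral>s. indicat_real {r..<W} s *\<^sub>R H s \<partial>lborel) + (\<integral>s. indicat_real {W..<W + r} s *\<^sub>R H s \<partial>lborel)"
    by (rule Bochner_Integration.integral_add[OF int int])
  also have "(\<integral>s. indicat_real {W..<W + r} s *\<^sub>R H s \<partial>lborel) = (\<integral>s. indicat_real {W..<W + r} (s + W) *\<^sub>R H (s + W) \<partial>lborel)"
    by (rule shift[symmetric])
  also have "\<dots> = (\<integral>s. indicat_real {0..<r} s *\<^sub>R H s \<partial>lborel)"
    using H by (intro Bochner_Integration.integral_cong) (auto simp: indicator_def periodic_def)
  also have "(\<integral>s. indicat_real {r..<W} s *\<^sub>R H s \<partial>lborel) + \<dots> = (\<integral>s. indicat_real {r..<W} s *\<^sub>R H s + indicat_real {0..<r} s *\<^sub>R H s \<partial>lborel)"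
    by (rule Bochner_Integration.integral_add[OF int int, symmetric])
  also have "\<dots> = (\<integral>s. indicat_real {0..<W} s *\<^sub>R H s \<partial>lborel)"
    using r by (intro Bochner_Integration.integral_cong) (auto simp: indicator_def)
  finally show ?thesis .
qed

section \<open>Fourier coefficients over one period\<close>

definition fourier_coeff :: "real \<Rightarrow> real \<Rightarrow> (real \<Rightarrow> real) \<Rightarrow> complex" where
  "fourier_coeff W \<theta> g = (\<integral>s. indicat_real {0..<W} s *\<^sub>R (of_real (g s) * cis (- (\<theta> * s))) \<partial>lborel)"

lemma integrable_locint:
  assumes "locint g" shows "integrable lborel (\<lambda>s. indicat_real {a..<b} s *\<^sub>R g s)"
proof -
  have "set_integrable lborel {a..b} g" using assms by (simp add: locint_def)
  then have "set_integrable lborel {a..<b} g" by (rule set_integrable_subset) auto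
  then show ?thesis by (simp add: set_integrable_def)
qed

lemma integrable_fourier:
  assumes g: "locint g"
  shows "integrable lborel (\<lambda>s. indicat_real {a..<b} s *\<^sub>R (complex_of_real (g s) * cis (- (\<theta> * s))))"
proof (rule Bochner_Integration.integrable_bound[OF integrable_locint[OF g, of a b]])
  have "continuous_on UNIV (\<lambda>s. cis (- (\<theta> * s)))" by (intro continuous_intros)
  then have [measurable]: "(\<lambda>s. cis (- (\<theta> * s))) \<in> borel_measurable borel" by (rule borel_measurable_continuous_onI)
  have [measurable]: "g \<in> borel_measurable borel" using g by (rule locint_measurable)
  show "(\<lambda>s. indicat_real {a..<b} s *\<^sub>R (complex_of_real (g s) * cis (- (\<theta> * s)))) \<in> borel_measurable lborel" by measurable
  show "AE s in lborel. norm (indicat_real {a..<b} s *\<^sub>R (complex_of_real (g s) * cis (- (\<theta> * s)))) \<le> norm (indicat_real {a..<b} s *\<^sub>R g s)"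
    by (rule AE_I2) (simp add: norm_mult)
qed

text \<open>The condition on \<theta> makes the whole integrand periodic, so the window of
  integration may be translated.\<close>

lemma fourier_coeff_shift:
  assumes W: "W > 0" and \<theta>: "cis (\<theta> * W) = 1" and g: "periodic W g" "locint g"
  shows "fourier_coeff W \<theta> (\<lambda>s. g (s + a)) = cis (\<theta> * a) * fourier_coeff W \<theta> g"
proof -
  let ?H = "\<lambda>s. complex_of_real (g s) * cis (- (\<theta> * s))"
  have "cis (- (\<theta> * (s + W))) = cis (- (\<theta> * s))" for s
  proof -
    have "cis (- (\<theta> * (s + W))) = cis (- (\<theta> * s)) * inverse (cis (\<theta> * W))"
      by (simp add: cis_inverse cis_mult algebra_simps)
    then show ?thesis by (simp add: \<theta>)
  qed
  then have per: "periodic W ?H" using g(1) by (simp add: periodic_def)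
  have "complex_of_real (g (s + a)) * cis (- (\<theta> * s)) = cis (\<theta> * a) * ?H (s + a)" for s
    by (simp add: cis_mult mult.left_commute algebra_simps)
  then have "fourier_coeff W \<theta> (\<lambda>s. g (s + a)) = (\<integral>s. cis (\<theta> * a) * (indicat_real {0..<W} s *\<^sub>R ?H (s + a)) \<partial>lborel)"
    unfolding fourier_coeff_def mult_scaleR_right by (simp only:)
  also have "\<dots> = cis (\<theta> * a) * (\<integral>s. indicat_real {0..<W} s *\<^sub>R ?H (s + a) \<partial>lborel)"
    by (rule integral_mult_right_zero)
  also have "\<dots> = cis (\<theta> * a) * fourier_coeff W \<theta> g"
    unfolding fourier_coeff_def by (subst integral_periodic_shift[OF W per]) (auto intro: integrable_fourier g)
  finally show ?thesis .
qed

lemma fourier_coeff_cmult: "fourier_coeff W \<theta> (\<lambda>s. c * g s) = of_real c * fourier_coeff W \<theta> g"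
proof -
  have "fourier_coeff W \<theta> (\<lambda>s. c * g s) = (\<integral>s. of_real c * (indicat_real {0..<W} s *\<^sub>R (of_real (g s) * cis (- (\<theta> * s)))) \<partial>lborel)"
    by (simp add: fourier_coeff_def mult_scaleR_right mult.assoc)
  then show ?thesis by (simp only: integral_mult_right_zero fourier_coeff_def)
qed

lemma fourier_coeff_add:
  assumes "locint f" "locint g"
  shows "fourier_coeff W \<theta> (\<lambda>s. f s + g s) = fourier_coeff W \<theta> f + fourier_coeff W \<theta> g"
  unfolding fourier_coeff_def
  by (subst Bochner_Integration.integral_add[symmetric]) (auto intro: integrable_fourier assms simp: distrib_right scaleR_add_right)

lemma fourier_coeff_sum:
  assumes "\<And>i. i \<in> I \<Longrightarrow> locint (f i)"
  shows "fourier_coeff W \<theta> (\<lambda>s. \<Sum>i\<in>I. f i s) = (\<Sum>i\<in>I. fourier_coeff W \<theta> (f i))"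
  using assms
proof (induction I rule: infinite_finite_induct)
  case (insert i I)
  then show ?case by (simp add: fourier_coeff_add locint_sum)
qed (simp_all add: fourier_coeff_def)

lemma fourier_coeff_bound:
  assumes "locint g"
  shows "norm (fourier_coeff W \<theta> g) \<le> (\<integral>s. norm (indicat_real {0..<W} s *\<^sub>R g s) \<partial>lborel)"
proof -
  have "norm (fourier_coeff W \<theta> g) \<le> (\<integral>s. norm (indicat_real {0..<W} s *\<^sub>R (complex_of_real (g s) * cis (- (\<theta> * s)))) \<partial>lborel)"
    unfolding fourier_coeff_def by (rule integral_norm_bound)
  then show ?thesis by (simp add: norm_mult abs_mult)
qed

lemma fourier_coeff_cong_AE:
  assumes "AE s in lborel. f s = g s" "locint f" "locint g"
  shows "fourier_coeff W \<theta> f = fourier_coeff W \<theta> g"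
  unfolding fourier_coeff_def
proof (rule integral_cong_AE)
  show "AE s in lborel. indicat_real {0..<W} s *\<^sub>R (complex_of_real (f s) * cis (- (\<theta> * s))) = indicat_real {0..<W} s *\<^sub>R (complex_of_real (g s) * cis (- (\<theta> * s)))"
    using assms(1) by eventually_elim simp
qed (use integrable_fourier assms in \<open>blast dest: borel_measurable_integrable\<close>)+

lemma integral_cos_period:
  assumes W: "W > 0"
  shows "(\<integral>s. indicat_real {0..<W} s *\<^sub>R cos (2 * pi * of_int j / W * s) \<partial>lborel) = (if j = 0 then W else 0)"
proof (cases "j = 0")
  case True
  have "(\<integral>s. indicat_real {0..<W} s *\<^sub>R cos (2 * pi * of_int j / W * s) \<partial>lborel) = measure lborel {0..<W}"
    using True by simp
  then show ?thesis using True W by simp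
next
  case False
  define a where "a = 2 * pi * of_int j / W"
  have a: "a \<noteq> 0" using False W by (simp add: a_def)
  have "(\<integral>s. indicat_real {0..<W} s *\<^sub>R cos (a * s) \<partial>lborel) = (\<integral>s. indicat_real {0..W} s *\<^sub>R cos (a * s) \<partial>lborel)"
  proof (rule integral_cong_AE)
    show "AE s in lborel. indicat_real {0..<W} s *\<^sub>R cos (a * s) = indicat_real {0..W} s *\<^sub>R cos (a * s)"
      using AE_lborel_singleton[of W] by eventually_elim (auto simp: indicator_def)
  qed measurable
  also have "\<dots> = sin (a * W) / a - sin (a * 0) / a"
  proof (rule integral_FTC_Icc[of 0 W])
    show "0 \<le> W" using W by simp
    show "((\<lambda>s. sin (a * s) / a) has_vector_derivative cos (a * s)) (at s within {0..W})" for s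
      using a by (auto intro!: derivative_eq_intros simp: has_real_derivative_iff_has_vector_derivative[symmetric])
    show "continuous_on {0..W} (\<lambda>s. cos (a * s))" by (intro continuous_intros)
  qed
  also have "sin (a * W) = 0"
  proof -
    have "a * W = of_int (2 * j) * pi" using W by (simp add: a_def)
    then show ?thesis unfolding sin_zero_iff_int2 ..
  qed
  finally show ?thesis using False by (simp add: a_def)
qed

lemma integral_cos_cos_period:
  assumes W: "W > 0"
  shows "(\<integral>s. indicat_real {0..<W} s *\<^sub>R (cos (2 * pi * of_nat i / W * s) * cos (2 * pi * of_nat j / W * s)) \<partial>lborel)
     = ((if i = j then W else 0) + (if i + j = 0 then W else 0)) / 2"
proof -
  have int: "integrable lborel (\<lambda>s. indicat_real {0..<W} s *\<^sub>R cos (a * s))" for a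
  proof -
    have "set_integrable lborel {0..W} (\<lambda>s. cos (a * s))"
      unfolding set_integrable_def by (rule borel_integrable_compact) (auto intro!: continuous_intros)
    then have "set_integrable lborel {0..<W} (\<lambda>s. cos (a * s))" by (rule set_integrable_subset) auto
    then show ?thesis by (simp add: set_integrable_def)
  qed
  have "indicat_real {0..<W} s *\<^sub>R (cos (2 * pi * of_nat i / W * s) * cos (2 * pi * of_nat j / W * s))
    = (indicat_real {0..<W} s *\<^sub>R cos (2 * pi * of_int (int i - int j) / W * s)
      + indicat_real {0..<W} s *\<^sub>R cos (2 * pi * of_int (int i + int j) / W * s)) / 2" for s
    by (simp add: cos_times_cos left_diff_distrib right_diff_distrib diff_divide_distrib add_divide_distrib distrib_left distrib_right)
  then have "(\<integral>s. indicat_real {0..<W} s *\<^sub>R (cos (2 * pi * of_nat i / W * s) * cos (2 * pi * of_nat j / W * s)) \<partial>lborel)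
    = (\<integral>s. (indicat_real {0..<W} s *\<^sub>R cos (2 * pi * of_int (int i - int j) / W * s)
      + indicat_real {0..<W} s *\<^sub>R cos (2 * pi * of_int (int i + int j) / W * s)) / 2 \<partial>lborel)"
    by (simp only:)
  also have "\<dots> = ((if int i - int j = 0 then W else 0) + (if int i + int j = 0 then W else 0)) / 2"
    unfolding integral_divide_zero Bochner_Integration.integral_add[OF int int] integral_cos_period[OF W] ..
  finally show ?thesis by simp
qed

lemma locint_continuous:
  fixes f :: "real \<Rightarrow> real"
  assumes "continuous_on UNIV f" shows "locint f"
proof -
  have "integrable lborel (indicat_real {a..b})" for a b :: real
    by (rule integrable_real_indicator) (simp_all add: emeasure_lborel_Icc_eq)
  then have "locint (\<lambda>_. 1)" unfolding locint_def set_integrable_def by simp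
  from locint_mult_continuous[OF this assms] show ?thesis by simp
qed

text \<open>A gliding hump: if the symbols of a convolution system come arbitrarily close to zero at the
  frequencies \<open>k 0, k 1, \<dots>\<close>, the lacunary series below is not in its range.\<close>

lemma lacunary_cosine_series:
  fixes k :: "nat \<Rightarrow> nat"
  assumes W: "W > 0"
  defines "f \<equiv> \<lambda>s. \<Sum>n. (1 / 2) ^ n * cos (2 * pi * of_nat (k n) / W * s)"
  shows "continuous_on UNIV f" "periodic W f"
    "\<And>m. (1 / 2) ^ m * (W / 2) \<le> norm (fourier_coeff W (2 * pi * of_nat (k m) / W) f)"
proof -
  define g where "g n s = (1 / 2) ^ n * cos (2 * pi * of_nat (k n) / W * s)" for n s
  have geo: "summable (\<lambda>n. (1 / 2 :: real) ^ n)" by (rule summable_geometric) simp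
  have gb: "norm (g n s) \<le> (1 / 2) ^ n" for n s by (simp add: g_def abs_mult)
  have "uniform_limit UNIV (\<lambda>N s. \<Sum>n<N. g n s) (\<lambda>s. \<Sum>n. g n s) sequentially"
    by (rule Weierstrass_m_test[OF gb geo])
  then show cont: "continuous_on UNIV f" unfolding f_def g_def
    by (rule uniform_limit_theorem[rotated]) (use W in \<open>auto intro!: always_eventually continuous_intros\<close>)
  show "periodic W f"
  proof -
    have "2 * pi * of_nat (k n) / W * (s + W) = 2 * pi * of_nat (k n) / W * s + 2 * of_nat (k n) * pi" for n s
      using W by (simp add: distrib_left)
    then have "cos (2 * pi * of_nat (k n) / W * (s + W)) = cos (2 * pi * of_nat (k n) / W * s)" for n s
      by (simp only: cos_add cos_2npi sin_2npi mult_1_right mult_zero_right diff_zero)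
    then show ?thesis by (simp add: periodic_def f_def)
  qed
  fix m
  define \<theta> where "\<theta> = 2 * pi * of_nat (k m) / W"
  define F where "F n s = indicat_real {0..<W} s *\<^sub>R (g n s * cos (\<theta> * s))" for n s
  have [measurable]: "g n \<in> borel_measurable borel" for n unfolding g_def[abs_def] by measurable
  have Fm: "F n \<in> borel_measurable lborel" for n unfolding F_def[abs_def] by measurable
  have Fb: "norm (F n s) \<le> (1 / 2) ^ n * indicat_real {0..<W} s" for n s
  proof -
    have "\<bar>g n s\<bar> * \<bar>cos (\<theta> * s)\<bar> \<le> (1 / 2) ^ n * 1"
      using gb[of n s] by (intro mult_mono) auto
    then show ?thesis by (simp add: F_def abs_mult indicator_def)
  qed
  have indi: "integrable lborel (\<lambda>s. (1 / 2) ^ n * indicat_real {0..<W} s)" for n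
    using W by (intro integrable_mult_right integrable_real_indicator) simp_all
  have Fi: "integrable lborel (F n)" for n
  proof (rule Bochner_Integration.integrable_bound[OF indi Fm])
    show "AE s in lborel. norm (F n s) \<le> norm ((1 / 2) ^ n * indicat_real {0..<W} s)"
      using Fb by (intro AE_I2) (simp add: abs_mult)
  qed
  have IF: "(\<integral>s. F n s \<partial>lborel) = (1 / 2) ^ n * (((if k n = k m then W else 0) + (if k n + k m = 0 then W else 0)) / 2)" for n
  proof -
    have "(\<integral>s. F n s \<partial>lborel) = (\<integral>s. (1 / 2) ^ n * (indicat_real {0..<W} s *\<^sub>R (cos (2 * pi * of_nat (k n) / W * s) * cos (2 * pi * of_nat (k m) / W * s))) \<partial>lborel)"
      by (simp add: F_def g_def \<theta>_def mult_ac)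
    then show ?thesis by (simp only: integral_mult_right_zero integral_cos_cos_period[OF W])
  qed
  have s1: "AE s in lborel. summable (\<lambda>n. norm (F n s))"
  proof (rule AE_I2)
    fix s show "summable (\<lambda>n. norm (F n s))"
      by (rule summable_comparison_test'[OF summable_mult2[OF geo, of "indicat_real {0..<W} s"], of 0]) (use Fb in simp)
  qed
  have s2: "summable (\<lambda>n. \<integral>s. norm (F n s) \<partial>lborel)"
  proof (rule summable_comparison_test'[OF summable_mult2[OF geo, of W], of 0])
    fix n
    have "(\<integral>s. norm (F n s) \<partial>lborel) \<le> (\<integral>s. (1 / 2) ^ n * indicat_real {0..<W} s \<partial>lborel)"
      by (rule integral_mono[OF integrable_norm[OF Fi] indi Fb])
    then show "norm (\<integral>s. norm (F n s) \<partial>lborel) \<le> (1 / 2) ^ n * W" using W by simp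
  qed
  have sums: "(\<lambda>n. \<integral>s. F n s \<partial>lborel) sums (\<integral>s. (\<Sum>n. F n s) \<partial>lborel)"
    by (rule sums_integral[OF Fi s1 s2])
  have "Re (fourier_coeff W \<theta> f) = (\<integral>s. Re (indicat_real {0..<W} s *\<^sub>R (of_real (f s) * cis (- (\<theta> * s)))) \<partial>lborel)"
    unfolding fourier_coeff_def by (rule integral_Re[symmetric]) (rule integrable_fourier[OF locint_continuous[OF cont]])
  also have "\<dots> = (\<integral>s. (\<Sum>n. F n s) \<partial>lborel)"
  proof (rule Bochner_Integration.integral_cong[OF refl])
    fix s
    have "summable (\<lambda>n. g n s)" by (rule summable_comparison_test'[OF geo, of 0]) (use gb in auto)
    then have "(\<Sum>n. F n s) = indicat_real {0..<W} s * (f s * cos (\<theta> * s))"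
      unfolding F_def real_scaleR_def f_def g_def by (subst suminf_mult[symmetric] suminf_mult2, auto intro: summable_mult2)+
    then show "Re (indicat_real {0..<W} s *\<^sub>R (of_real (f s) * cis (- (\<theta> * s)))) = (\<Sum>n. F n s)" by simp
  qed
  finally have Re: "Re (fourier_coeff W \<theta> f) = (\<integral>s. (\<Sum>n. F n s) \<partial>lborel)" .
  \<comment> \<open>The frequencies may repeat. Since all the integrals are nonnegative, repetitions
    only enlarge the coefficient, and the \<open>m\<close>-th term alone gives the bound.\<close>
  have "(1 / 2) ^ m * (W / 2) \<le> (\<integral>s. F m s \<partial>lborel)"
    using W by (simp add: IF)
  also have "\<dots> = (\<Sum>n\<in>{m}. \<integral>s. F n s \<partial>lborel)" by simp
  also have "\<dots> \<le> (\<Sum>n. \<integral>s. F n s \<partial>lborel)"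
    by (rule sum_le_suminf[OF sums_summable[OF sums]]) (use W in \<open>auto simp: IF\<close>)
  also have "\<dots> = Re (fourier_coeff W \<theta> f)" using sums Re by (simp add: sums_iff)
  also have "\<dots> \<le> norm (fourier_coeff W \<theta> f)" by (rule complex_Re_le_cmod)
  finally show "(1 / 2) ^ m * (W / 2) \<le> norm (fourier_coeff W (2 * pi * of_nat (k m) / W) f)" by (simp only: \<theta>_def)
qed

text \<open>A solution \<open>v\<close> would make the coefficient of the lacunary series at its
  \<open>m\<close>-th frequency at most 4^(-m) times a fixed sum of \<open>L1\<close> norms, whereas
  this coefficient is at least 2^(-m) * W / 2.\<close>

theorem convolution_system_lower_bound:
  fixes \<beta> :: "'c::finite \<Rightarrow> 'i \<Rightarrow> real"
  assumes W: "W > 0" and \<kappa>: "\<kappa> = exp (\<sigma> * W)" and I: "finite I"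
    and solve: "\<And>f. continuous_on UNIV f \<Longrightarrow> quasiperiodic \<kappa> W f \<Longrightarrow>
      \<exists>v. (\<forall>c. quasiperiodic \<kappa> W (v c) \<and> locint (v c)) \<and>
     (AE s in lborel. (\<Sum>c\<in>UNIV. \<Sum>i\<in>I. \<beta> c i * v c (s + a i)) = f s)"
  shows "\<exists>\<delta>>0. \<forall>k::nat. \<delta> \<le> (\<Sum>c\<in>UNIV. (cmod (\<Sum>i\<in>I. (\<beta> c i * exp (\<sigma> * a i)) *\<^sub>R cis (2 * pi * of_nat k / W * a i)))\<^sup>2)"
    (is ?lower)
proof (rule ccontr)
  define \<gamma> where "\<gamma> c i = \<beta> c i * exp (\<sigma> * a i)" for c i
  define A where "A c k = (\<Sum>i\<in>I. \<gamma> c i *\<^sub>R cis (2 * pi * of_nat k / W * a i))" for c and k :: nat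
  assume neg: "\<not> ?lower"
  \<comment> \<open>The bound 16^(-n) on the sum of squares makes each symbol at most 4^(-n), which
    decays faster than the coefficients 2^(-n) of the series.\<close>
  have "\<exists>k. (\<Sum>c\<in>UNIV. (cmod (A c k))\<^sup>2) < (1 / 16) ^ n" for n :: nat
  proof (rule ccontr)
    assume "\<nexists>k. (\<Sum>c\<in>UNIV. (cmod (A c k))\<^sup>2) < (1 / 16) ^ n"
    then have "\<forall>k. (1 / 16) ^ n \<le> (\<Sum>c\<in>UNIV. (cmod (A c k))\<^sup>2)" by (simp add: not_less)
    then have ?lower unfolding A_def \<gamma>_def by (intro exI[of _ "(1 / 16) ^ n"]) simp
    with neg show False ..
  qed
  then have "\<forall>n. \<exists>k. (\<Sum>c\<in>UNIV. (cmod (A c k))\<^sup>2) < (1 / 16) ^ n" by (rule allI)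
  from choice[OF this] obtain k where k: "\<forall>n. (\<Sum>c\<in>UNIV. (cmod (A c (k n)))\<^sup>2) < (1 / 16) ^ n" ..
  have Ak: "cmod (A c (k n)) \<le> (1 / 4) ^ n" for c n
  proof -
    have "(cmod (A c (k n)))\<^sup>2 \<le> (\<Sum>c\<in>UNIV. (cmod (A c (k n)))\<^sup>2)"
      by (rule member_le_sum) auto
    also have "\<dots> \<le> (1 / 16) ^ n" using k by (simp add: less_imp_le)
    also have "\<dots> = ((1 / 4) ^ n)\<^sup>2" by (simp add: power_mult[symmetric] power2_eq_square power_mult_distrib[symmetric])
    finally show ?thesis by (rule power2_le_imp_le) simp
  qed
  define f where "f s = (\<Sum>n. (1 / 2) ^ n * cos (2 * pi * of_nat (k n) / W * s))" for s
  note f = lacunary_cosine_series[OF W, where k = k, folded f_def[abs_def]]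
  have fc: "continuous_on UNIV (\<lambda>s. exp (\<sigma> * s) * f s)" by (intro continuous_intros f(1))
  have fq: "quasiperiodic \<kappa> W (\<lambda>s. exp (\<sigma> * s) * f s)" by (rule periodic_weight[OF \<kappa> f(2)])
  from solve[OF fc fq] obtain v where v: "\<forall>c. quasiperiodic \<kappa> W (v c) \<and> locint (v c)"
     "AE s in lborel. (\<Sum>c\<in>UNIV. \<Sum>i\<in>I. \<beta> c i * v c (s + a i)) = exp (\<sigma> * s) * f s" by (elim exE conjE)
  define w where "w c s = exp (- \<sigma> * s) * v c s" for c s
  have wp: "periodic W (w c)" for c
    using v(1) quasiperiodic_weight[OF \<kappa>, of "v c"] by (simp add: w_def[abs_def])
  have wl: "locint (w c)" for c unfolding w_def[abs_def]
    using v(1) by (intro locint_mult_continuous) (auto intro!: continuous_intros)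
  have eq: "AE s in lborel. (\<Sum>c\<in>UNIV. \<Sum>i\<in>I. \<gamma> c i * w c (s + a i)) = f s"
    using v(2)
  proof eventually_elim
    case (elim s)
    have "\<gamma> c i * w c (s + a i) = exp (- \<sigma> * s) * (\<beta> c i * v c (s + a i))" for c i
    proof -
      have "exp (\<sigma> * a i) * exp (- \<sigma> * (s + a i)) = exp (- \<sigma> * s)"
        by (simp add: exp_add[symmetric] algebra_simps)
      then show ?thesis by (simp add: \<gamma>_def w_def)
    qed
    then have "(\<Sum>c\<in>UNIV. \<Sum>i\<in>I. \<gamma> c i * w c (s + a i)) = exp (- \<sigma> * s) * (\<Sum>c\<in>UNIV. \<Sum>i\<in>I. \<beta> c i * v c (s + a i))"
      by (simp add: sum_distrib_left)
    also have "\<dots> = f s" unfolding elim by (simp add: mult.assoc[symmetric] exp_add[symmetric])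
    finally show ?case .
  qed
  define B where "B = (\<Sum>c\<in>UNIV. \<integral>s. norm (indicat_real {0..<W} s *\<^sub>R w c s) \<partial>lborel)"
  have "(1 / 2) ^ m * (W / 2) \<le> (1 / 4) ^ m * B" for m
  proof -
    define \<theta> where "\<theta> = 2 * pi * of_nat (k m) / W"
    have \<theta>: "cis (\<theta> * W) = 1"
    proof -
      have "\<theta> * W = 2 * pi * of_nat (k m)" using W by (simp add: \<theta>_def)
      moreover have "cis (2 * pi * of_nat (k m)) = 1" by (rule cis_multiple_2pi) simp
      ultimately show ?thesis by simp
    qed
    have "fourier_coeff W \<theta> f = fourier_coeff W \<theta> (\<lambda>s. \<Sum>c\<in>UNIV. \<Sum>i\<in>I. \<gamma> c i * w c (s + a i))"
      by (rule fourier_coeff_cong_AE[symmetric, OF eq])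
        (intro locint_sum locint_cmult locint_shift wl locint_continuous f(1))+
    also have "\<dots> = (\<Sum>c\<in>UNIV. \<Sum>i\<in>I. of_real (\<gamma> c i) * (cis (\<theta> * a i) * fourier_coeff W \<theta> (w c)))"
    proof (subst fourier_coeff_sum)
      show "locint (\<lambda>s. \<Sum>i\<in>I. \<gamma> c i * w c (s + a i))" for c
        by (intro locint_sum locint_cmult locint_shift wl)
      show "(\<Sum>c\<in>UNIV. fourier_coeff W \<theta> (\<lambda>s. \<Sum>i\<in>I. \<gamma> c i * w c (s + a i))) = (\<Sum>c\<in>UNIV. \<Sum>i\<in>I. of_real (\<gamma> c i) * (cis (\<theta> * a i) * fourier_coeff W \<theta> (w c)))"
        by (intro sum.cong refl, subst fourier_coeff_sum)
          (auto simp: fourier_coeff_cmult fourier_coeff_shift[OF W \<theta> wp wl] intro!: locint_cmult locint_shift wl)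
    qed
    also have "\<dots> = (\<Sum>c\<in>UNIV. A c (k m) * fourier_coeff W \<theta> (w c))"
      by (simp add: A_def \<theta>_def sum_distrib_right scaleR_conv_of_real mult.assoc)
    also have "norm \<dots> \<le> (\<Sum>c\<in>UNIV. (1 / 4) ^ m * (\<integral>s. norm (indicat_real {0..<W} s *\<^sub>R w c s) \<partial>lborel))"
      unfolding norm_mult
      by (rule sum_norm_le) (simp only: norm_mult, intro mult_mono Ak fourier_coeff_bound[OF wl], simp_all)
    also have "\<dots> = (1 / 4) ^ m * B" by (simp add: B_def sum_distrib_left)
    finally show ?thesis using f(3)[of m] unfolding \<theta>_def by linarith
  qed
  then have "2 ^ m * (W / 2) \<le> B" for m :: nat
  proof -
    have "4 ^ m * ((1 / 2) ^ m * (W / 2)) \<le> 4 ^ m * ((1 / 4) ^ m * B)"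
      using \<open>\<And>m. (1 / 2) ^ m * (W / 2) \<le> (1 / 4) ^ m * B\<close> by (intro mult_left_mono) auto
    then show ?thesis by (simp only: mult.assoc[symmetric] power_mult_distrib[symmetric]) simp
  qed
  moreover obtain m :: nat where "B / (W / 2) < 2 ^ m" using real_arch_pow[of 2 "B / (W / 2)"] by auto
  ultimately show False using W by (simp add: pos_divide_less_eq not_less[symmetric])
qed

section \<open>Delay equations on a cycle\<close>

text \<open>This is the causal counterpart of \<open>periodize\<close>: the sum starts with turn
  \<open>m\<close>, which is 0 or 1 according to whether the control meets the edge before
  completing a turn.\<close>

definition periodize_from :: "int \<Rightarrow> real \<Rightarrow> real \<Rightarrow> (real \<Rightarrow> real) \<Rightarrow> real \<Rightarrow> real" where
  "periodize_from m \<kappa> W u s = (\<Sum>n | m \<le> n \<and> u (s - of_int n * W) \<noteq> 0. \<kappa> powi n * u (s - of_int n * W))"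

lemma finite_supported_index:
  assumes "W > 0" "supported a b u" shows "finite {n. u (s - of_int n * W) \<noteq> 0}"
  by (rule finite_subset[of _ "{\<lfloor>(s - b) / W\<rfloor>..\<lceil>(s - a) / W\<rceil>}"]) (use supported_index[OF assms _ order.refl order.refl] in blast)+

lemma periodize_from_step:
  assumes "W > 0" "supported a b u"
  shows "periodize_from m \<kappa> W u s = \<kappa> powi m * u (s - of_int m * W) + periodize_from (m + 1) \<kappa> W u s"
proof (cases "u (s - of_int m * W) = 0")
  case True
  have "m \<le> n \<and> u (s - of_int n * W) \<noteq> 0 \<longleftrightarrow> m + 1 \<le> n \<and> u (s - of_int n * W) \<noteq> 0" for n
    using True by (cases "n = m") auto
  then have "{n. m \<le> n \<and> u (s - of_int n * W) \<noteq> 0} = {n. m + 1 \<le> n \<and> u (s - of_int n * W) \<noteq> 0}"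
    by (simp only:)
  with True show ?thesis by (simp add: periodize_from_def)
next
  case False
  then have "{n. m \<le> n \<and> u (s - of_int n * W) \<noteq> 0} = insert m {n. m + 1 \<le> n \<and> u (s - of_int n * W) \<noteq> 0}"
    by auto
  moreover have "finite {n. m + 1 \<le> n \<and> u (s - of_int n * W) \<noteq> 0}"
    by (rule finite_subset[OF _ finite_supported_index[OF assms, of s]]) auto
  ultimately show ?thesis by (simp add: periodize_from_def)
qed

lemma periodize_from_shift:
  assumes "\<kappa> \<noteq> 0"
  shows "periodize_from (m + 1) \<kappa> W u (s + W) = \<kappa> * periodize_from m \<kappa> W u s"
proof -
  have "(\<Sum>n | m + 1 \<le> n \<and> u (s + W - of_int n * W) \<noteq> 0. \<kappa> powi n * u (s + W - of_int n * W))
     = (\<Sum>n | m \<le> n \<and> u (s - of_int n * W) \<noteq> 0. \<kappa> powi (n + 1) * u (s - of_int n * W))"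
    by (rule sum.reindex_bij_witness[where i = "\<lambda>n. n + 1" and j = "\<lambda>n. n - 1"]) (auto simp: algebra_simps)
  also have "\<dots> = \<kappa> * (\<Sum>n | m \<le> n \<and> u (s - of_int n * W) \<noteq> 0. \<kappa> powi n * u (s - of_int n * W))"
    using assms by (simp add: power_int_add sum_distrib_left mult_ac)
  finally show ?thesis by (simp add: periodize_from_def)
qed

lemma periodize_from_before:
  assumes W: "W > 0" and u: "supported a b u" and s: "s - of_int m * W < a"
  shows "periodize_from m \<kappa> W u s = 0"
proof -
  have "u (s - of_int n * W) = 0" if "m \<le> n" for n
  proof -
    have "of_int m * W \<le> of_int n * W" using that W by simp
    then show ?thesis using u s by (auto simp: supported_def)
  qed
  then have "{n. m \<le> n \<and> u (s - of_int n * W) \<noteq> 0} = {}" by blast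
  then show ?thesis by (simp only: periodize_from_def sum.empty)
qed

text \<open>At such points all omitted images n < m are evaluated at or beyond \<open>b\<close>,
  where \<open>u\<close> vanishes.\<close>

lemma periodize_from_after:
  assumes W: "W > 0" and u: "supported a b u" and s: "b \<le> s - of_int (m - 1) * W"
  shows "periodize_from m \<kappa> W u s = periodize \<kappa> W u s"
proof -
  have "m \<le> n" if "u (s - of_int n * W) \<noteq> 0" for n
  proof (rule ccontr)
    assume "\<not> m \<le> n"
    then have "of_int n * W \<le> of_int (m - 1) * W" using W by (intro mult_right_mono) auto
    then have "u (s - of_int n * W) = 0" using u s by (auto simp: supported_def)
    with that show False by simp
  qed
  then have "{n. m \<le> n \<and> u (s - of_int n * W) \<noteq> 0} = {n. u (s - of_int n * W) \<noteq> 0}" by blast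
  then show ?thesis by (simp only: periodize_from_def periodize_def)
qed

text \<open>This is the position of the edge from which waves enter edge \<open>i\<close>.\<close>

definition cycle_prev :: "nat \<Rightarrow> nat \<Rightarrow> nat" where
  "cycle_prev h i = (if i = 0 then h - 1 else i - 1)"

lemma cycle_prev_less: "1 \<le> h \<Longrightarrow> i < h \<Longrightarrow> cycle_prev h i < h"
  by (auto simp: cycle_prev_def)

text \<open>In the coordinate \<open>s = t - a i\<close> a wave travelling along the cycle keeps its position and
  its normalised amplitude \<open>exp (b i) * X i t\<close>; a control enters at vertex \<open>j\<close> and reaches edge \<open>i\<close> in the
  same turn only if \<open>j \<le> i\<close>.\<close>

theorem cycle_delay_system:
  fixes h :: nat and \<tau> \<zeta> :: "nat \<Rightarrow> real" and G :: "nat \<Rightarrow> real \<Rightarrow> real"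
  defines "a \<equiv> \<lambda>i. \<Sum>t<i. \<tau> t" and "b \<equiv> \<lambda>i. \<Sum>t<i. \<zeta> t"
  defines "W \<equiv> a h" and "\<kappa> \<equiv> exp (- b h)"
  assumes h: "1 \<le> h" and \<tau>: "\<And>i. i < h \<Longrightarrow> \<tau> i > 0"
    and \<Phi>: "supported (- W) 0 \<Phi>" and G: "\<And>j. j < h \<Longrightarrow> supported 0 T (G j)"
  shows "\<exists>X. (\<forall>i<h. \<forall>t. X i t = exp (- \<zeta> (cycle_prev h i)) * X (cycle_prev h i) (t - \<tau> (cycle_prev h i)) + G i t) \<and>
     (\<forall>i<h. \<forall>t\<in>{- \<tau> i..<0}. X i t = exp (- b i) * \<Phi> (t - a i)) \<and>
     (\<forall>i<h. \<forall>t\<in>{T - \<tau> i..<T}. X i t = exp (- b i) *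
        (periodize \<kappa> W \<Phi> (t - a i) + (\<Sum>j<h. exp (b j) * periodize \<kappa> W (G j) (t - a i + a j))))"
proof -
  have a_mono: "a i \<le> a j" if "i \<le> j" "j \<le> h" for i j
    unfolding a_def using that \<tau> by (intro sum_mono2) (auto simp: less_imp_le)
  have a_Suc: "a (Suc i) = a i + \<tau> i" and b_Suc: "b (Suc i) = b i + \<zeta> i" for i by (simp_all add: a_def b_def)
  have a0: "a 0 = 0" and b0: "b 0 = 0" by (simp_all add: a_def b_def)
  have "a 0 < a (Suc 0)" using \<tau>[of 0] h by (simp add: a_Suc a0)
  also have "\<dots> \<le> W" unfolding W_def using h by (intro a_mono) auto
  finally have W: "W > 0" by (simp add: a0)
  have hS: "Suc (h - 1) = h" using h by simp
  have \<kappa>: "\<kappa> \<noteq> 0" by (simp add: \<kappa>_def)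
  define m where "m i j = (if j \<le> i then 0 else 1 :: int)" for i j :: nat
  \<comment> \<open>In the moving frame, \<xi> i consists of the free evolution of the initial state
    and of the images of each control \<open>G j\<close> from turn \<open>m i j\<close> on.\<close>
  define \<xi> where "\<xi> i s = periodize \<kappa> W \<Phi> s + (\<Sum>j<h. exp (b j) * periodize_from (m i j) \<kappa> W (G j) (s + a j))" for i s
  define X where "X i t = exp (- b i) * \<xi> i (t - a i)" for i t
  have \<xi>_Suc: "\<xi> (Suc i) s = \<xi> i s + exp (b (Suc i)) * G (Suc i) (s + a (Suc i))" if i: "Suc i < h" for i s
  proof -
    have "exp (b j) * periodize_from (m (Suc i) j) \<kappa> W (G j) (s + a j)
       = exp (b j) * periodize_from (m i j) \<kappa> W (G j) (s + a j)
        + (if j = Suc i then exp (b (Suc i)) * G (Suc i) (s + a (Suc i)) else 0)" if "j < h" for j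
      using periodize_from_step[OF W G[OF that], of 0 \<kappa> "s + a j"] by (auto simp: m_def algebra_simps)
    then have "(\<Sum>j<h. exp (b j) * periodize_from (m (Suc i) j) \<kappa> W (G j) (s + a j))
      = (\<Sum>j<h. exp (b j) * periodize_from (m i j) \<kappa> W (G j) (s + a j)
        + (if j = Suc i then exp (b (Suc i)) * G (Suc i) (s + a (Suc i)) else 0))"
      by (intro sum.cong) auto
    also have "\<dots> = (\<Sum>j<h. exp (b j) * periodize_from (m i j) \<kappa> W (G j) (s + a j)) + exp (b (Suc i)) * G (Suc i) (s + a (Suc i))"
      using i by (simp add: sum.distrib)
    finally show ?thesis by (simp add: \<xi>_def)
  qed
  \<comment> \<open>Closing the cycle advances every image by one turn, from 0 to 1, which costs the
    factor \<kappa> and the shift \<open>W\<close>; the control at vertex 0 enters as the new image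
    of turn 0.\<close>
  have \<xi>_0: "\<xi> 0 s = \<kappa> * \<xi> (h - 1) (s - W) + G 0 s" for s
  proof -
    have "exp (b j) * periodize_from (m 0 j) \<kappa> W (G j) (s + a j)
       = \<kappa> * (exp (b j) * periodize_from (m (h - 1) j) \<kappa> W (G j) (s - W + a j))
        + (if j = 0 then G 0 s else 0)" if "j < h" for j
      using periodize_from_step[OF W G[OF that], of 0 \<kappa> "s + a j"] that
        periodize_from_shift[OF \<kappa>, of 0 W "G j" "s - W + a j"]
      by (auto simp: m_def a0 b0 algebra_simps)
    then have "(\<Sum>j<h. exp (b j) * periodize_from (m 0 j) \<kappa> W (G j) (s + a j))
      = (\<Sum>j<h. \<kappa> * (exp (b j) * periodize_from (m (h - 1) j) \<kappa> W (G j) (s - W + a j)) + (if j = 0 then G 0 s else 0))"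
      by (intro sum.cong) auto
    also have "\<dots> = \<kappa> * (\<Sum>j<h. exp (b j) * periodize_from (m (h - 1) j) \<kappa> W (G j) (s - W + a j)) + G 0 s"
      using h by (simp add: sum.distrib sum_distrib_left)
    moreover have "periodize \<kappa> W \<Phi> s = \<kappa> * periodize \<kappa> W \<Phi> (s - W)"
      using periodize_quasiperiodic[OF \<kappa>, of W \<Phi>] unfolding quasiperiodic_def by (metis diff_add_cancel)
    ultimately show ?thesis by (simp add: \<xi>_def algebra_simps)
  qed
  have 1: "X (Suc i) t = exp (- \<zeta> i) * X i (t - \<tau> i) + G (Suc i) t" if "Suc i < h" for i t
  proof -
    have eb: "exp (- b (Suc i)) = exp (- \<zeta> i) * exp (- b i)" by (simp add: b_Suc exp_add[symmetric])
    have t: "t - a (Suc i) = t - \<tau> i - a i" by (simp add: a_Suc)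
    have "X (Suc i) t = exp (- b (Suc i)) * \<xi> i (t - a (Suc i)) + exp (- b (Suc i)) * exp (b (Suc i)) * G (Suc i) t"
      unfolding X_def \<xi>_Suc[OF that] by (simp only: distrib_left mult.assoc diff_add_cancel)
    also have "exp (- b (Suc i)) * exp (b (Suc i)) = 1" by (simp only: exp_add[symmetric]) simp
    finally show ?thesis unfolding X_def t eb by (simp only: mult.assoc mult_1_left)
  qed
  have 2: "X 0 t = exp (- \<zeta> (h - 1)) * X (h - 1) (t - \<tau> (h - 1)) + G 0 t" for t
  proof -
    have \<kappa>': "\<kappa> = exp (- \<zeta> (h - 1)) * exp (- b (h - 1))"
      using b_Suc[of "h - 1"] unfolding \<kappa>_def hS by (simp only: exp_add[symmetric]) simp
    have "W = a (h - 1) + \<tau> (h - 1)" using a_Suc[of "h - 1"] unfolding W_def hS .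
    then have t: "t - \<tau> (h - 1) - a (h - 1) = t - W" by simp
    have "X 0 t = \<xi> 0 t" by (simp add: X_def a0 b0)
    also have "\<dots> = exp (- \<zeta> (h - 1)) * X (h - 1) (t - \<tau> (h - 1)) + G 0 t"
      unfolding \<xi>_0 X_def t \<kappa>' mult.assoc ..
    finally show ?thesis .
  qed
  have 3: "X i t = exp (- b i) * \<Phi> (t - a i)" if i: "i < h" and t: "t \<in> {- \<tau> i..<0}" for i t
  proof -
    have "a (Suc i) \<le> W" "0 \<le> a i" using a_mono[of "Suc i" h] a_mono[of 0 i] i by (simp_all add: W_def a0)
    then have s: "t - a i \<in> {- W..<- W + W}" "t - a i < - a i" using t a_Suc[of i] by auto
    have "periodize_from (m i j) \<kappa> W (G j) (t - a i + a j) = 0" if j: "j < h" for j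
    proof (rule periodize_from_before[OF W G[OF j]])
      show "t - a i + a j - of_int (m i j) * W < 0"
      proof (cases "j \<le> i")
        case True
        then show ?thesis using a_mono[of j i] i s(2) by (simp add: m_def)
      next
        case False
        then show ?thesis using a_mono[of j h] j s(2) \<open>0 \<le> a i\<close> by (simp add: m_def W_def)
      qed
    qed
    then have "\<xi> i (t - a i) = periodize \<kappa> W \<Phi> (t - a i)" by (simp add: \<xi>_def)
    also have "\<dots> = \<Phi> (t - a i)" by (rule periodize_fundamental[OF W _ s(1)]) (use \<Phi> in simp)
    finally show ?thesis by (simp add: X_def)
  qed
  \<comment> \<open>On the last stretch before \<open>T\<close> every omitted image would come from
    time \<open>T\<close> or later, so the one-sided sums are full periodizations.\<close>
  have 4: "X i t = exp (- b i) * (periodize \<kappa> W \<Phi> (t - a i) + (\<Sum>j<h. exp (b j) * periodize \<kappa> W (G j) (t - a i + a j)))"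
    if i: "i < h" and t: "t \<in> {T - \<tau> i..<T}" for i t
  proof -
    have "a (Suc i) \<le> W" using a_mono[of "Suc i" h] i by (simp add: W_def)
    have s: "T \<le> t - a i + a (Suc i)" using t by (simp add: a_Suc)
    have "periodize_from (m i j) \<kappa> W (G j) (t - a i + a j) = periodize \<kappa> W (G j) (t - a i + a j)" if j: "j < h" for j
    proof (rule periodize_from_after[OF W G[OF j]])
      show "T \<le> t - a i + a j - of_int (m i j - 1) * W"
      proof (cases "j \<le> i")
        case True
        then show ?thesis using a_mono[of 0 j] j s \<open>a (Suc i) \<le> W\<close> by (simp add: m_def a0)
      next
        case False
        then show ?thesis using a_mono[of "Suc i" j] j s by (simp add: m_def)
      qed
    qed
    then show ?thesis by (simp add: X_def \<xi>_def)
  qed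
  have "X i t = exp (- \<zeta> (cycle_prev h i)) * X (cycle_prev h i) (t - \<tau> (cycle_prev h i)) + G i t" if "i < h" for i t
  proof (cases i)
    case 0
    show ?thesis unfolding 0 cycle_prev_def if_P[OF refl] by (rule 2)
  next
    case (Suc j)
    with that show ?thesis unfolding Suc cycle_prev_def by (simp add: 1)
  qed
  then show ?thesis by (intro exI[of _ X] conjI allI impI ballI 3 4)
qed

lemma AE_shift_interval:
  fixes P :: "real \<Rightarrow> bool"
  assumes "AE t in lborel. t \<in> {p..<q} \<longrightarrow> P t"
  shows "AE s in lborel. s \<in> {p - c..<q - c} \<longrightarrow> P (s + c)"
  using AE_lborel_shift[OF assms, of c] by eventually_elim (auto simp: algebra_simps)

text \<open>The method of steps: if \<open>m\<close> is the smallest delay, agreement up to time n *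
  m determines the right-hand sides up to (n + 1) * m. Only null sets are transported, so neither
  \<open>X\<close> nor \<open>Y\<close> has to be measurable.\<close>

lemma cycle_delay_unique:
  fixes X Y :: "nat \<Rightarrow> real \<Rightarrow> real"
  assumes h: "1 \<le> h" and \<tau>: "\<And>i. i < h \<Longrightarrow> \<tau> i > 0"
    and X: "\<And>i t. i < h \<Longrightarrow> t \<in> {0..T} \<Longrightarrow> X i t = c i * X (cycle_prev h i) (t - \<tau> (cycle_prev h i)) + G i t"
    and Y: "\<And>i t. i < h \<Longrightarrow> t \<in> {0..T} \<Longrightarrow> Y i t = c i * Y (cycle_prev h i) (t - \<tau> (cycle_prev h i)) + G' i t"
    and G: "\<And>i. i < h \<Longrightarrow> AE t in lborel. t \<in> {0..T} \<longrightarrow> G i t = G' i t"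
    and init: "\<And>i. i < h \<Longrightarrow> AE t in lborel. t \<in> {- \<tau> i..<0} \<longrightarrow> X i t = Y i t"
    and i: "i < h"
  shows "AE t in lborel. t \<in> {- \<tau> i..T} \<longrightarrow> X i t = Y i t"
proof -
  define m where "m = Min (\<tau> ` {..<h})"
  have m_le: "m \<le> \<tau> i" if "i < h" for i unfolding m_def using that by (intro Min_le) auto
  have "m \<in> \<tau> ` {..<h}" unfolding m_def by (rule Min_in) (use h in \<open>auto simp: lessThan_empty_iff\<close>)
  then have m: "m > 0" using \<tau> by auto
  have step: "\<forall>i<h. AE t in lborel. t \<in> {- \<tau> i..T} \<and> t \<le> of_nat n * m \<longrightarrow> X i t = Y i t" for n
  proof (induction n)
    case 0
    show ?case
    proof (intro allI impI)
      fix i assume "i < h"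
      from init[OF this] AE_lborel_singleton[of 0]
      show "AE t in lborel. t \<in> {- \<tau> i..T} \<and> t \<le> of_nat 0 * m \<longrightarrow> X i t = Y i t"
        by eventually_elim auto
    qed
  next
    case (Suc n)
    show ?case
    proof (intro allI impI)
      fix i assume i: "i < h"
      let ?p = "cycle_prev h i"
      have p: "?p < h" using cycle_prev_less[OF h i] .
      have "AE t in lborel. t \<in> {- \<tau> ?p..T} \<and> t \<le> of_nat n * m \<longrightarrow> X ?p t = Y ?p t" using Suc p by simp
      from AE_lborel_shift[OF this, of "- \<tau> ?p"] init[OF i] G[OF i]
      show "AE t in lborel. t \<in> {- \<tau> i..T} \<and> t \<le> of_nat (Suc n) * m \<longrightarrow> X i t = Y i t"
      proof eventually_elim
        case (elim t)
        show ?case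
        proof (intro impI)
          assume t: "t \<in> {- \<tau> i..T} \<and> t \<le> of_nat (Suc n) * m"
          show "X i t = Y i t"
          proof (cases "t < 0")
            case True
            then show ?thesis using t elim(2) by auto
          next
            case False
            then have t0: "t \<in> {0..T}" using t by auto
            have "t - \<tau> ?p \<le> of_nat n * m" using t m_le[OF p] by (simp add: algebra_simps)
            moreover have "t + - \<tau> ?p \<in> {- \<tau> ?p..T}" using t0 \<tau>[OF p] by auto
            ultimately have "X ?p (t - \<tau> ?p) = Y ?p (t - \<tau> ?p)" using elim(1) by simp
            then show ?thesis using X[OF i t0] Y[OF i t0] elim(3) t0 by simp
          qed
        qed
      qed
    qed
  qed
  obtain n :: nat where "T \<le> of_nat n * m" using reals_Archimedean3[OF m] by (meson less_imp_le)
  with step[of n] i have "AE t in lborel. t \<in> {- \<tau> i..T} \<and> t \<le> of_nat n * m \<longrightarrow> X i t = Y i t" by blast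
  then show ?thesis
  proof eventually_elim
    case (elim t)
    show ?case using elim order.trans[OF _ \<open>T \<le> of_nat n * m\<close>, of t] by simp
  qed
qed

text \<open>In the moving frame the final stretches of the edges tile one period ending at
  \<open>T\<close>.\<close>

lemma cycle_intervals:
  fixes \<tau> :: "nat \<Rightarrow> real"
  assumes "T - (\<Sum>t<h. \<tau> t) \<le> s" "s < T"
  shows "\<exists>i<h. s \<in> {T - (\<Sum>t<Suc i. \<tau> t)..<T - (\<Sum>t<i. \<tau> t)}"
  using assms
proof (induction h)
  case (Suc h)
  show ?case
  proof (cases "T - (\<Sum>t<h. \<tau> t) \<le> s")
    case True
    then show ?thesis using Suc by (meson less_SucI)
  next
    case False
    then show ?thesis using Suc.prems by (intro exI[of _ h]) auto
  qed
qed simp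

text \<open>For zero initial data the explicit solution ends in the convolution alone, and
  uniqueness carries this over to \<open>X\<close>. The identity obtained on the last period extends
  to the line because both sides have the multiplier \<kappa>.\<close>

theorem cycle_final_state_necessary:
  fixes h :: nat and \<tau> \<zeta> :: "nat \<Rightarrow> real" and \<Gamma> :: "nat \<Rightarrow> 'c::finite \<Rightarrow> real"
  defines "a \<equiv> \<lambda>i. \<Sum>t<i. \<tau> t" and "b \<equiv> \<lambda>i. \<Sum>t<i. \<zeta> t"
  defines "W \<equiv> a h" and "\<kappa> \<equiv> exp (- b h)"
  assumes h: "1 \<le> h" and \<tau>: "\<And>i. i < h \<Longrightarrow> \<tau> i > 0" and T: "W \<le> T"
    and X: "\<And>i t. i < h \<Longrightarrow> t \<in> {0..T} \<Longrightarrow> X i t = exp (- \<zeta> (cycle_prev h i)) * X (cycle_prev h i) (t - \<tau> (cycle_prev h i)) + (\<Sum>c\<in>UNIV. \<Gamma> i c * u c t)"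
    and u': "\<And>c. supported 0 T (u' c)" "\<And>c. AE t in lborel. t \<in> {0..T} \<longrightarrow> u c t = u' c t"
    and init: "\<And>i. i < h \<Longrightarrow> AE t in lborel. t \<in> {- \<tau> i..<0} \<longrightarrow> X i t = 0"
    and final: "\<And>i. i < h \<Longrightarrow> AE t in lborel. t \<in> {T - \<tau> i..<T} \<longrightarrow> X i t = exp (- b i) * f (t - a i)"
    and f: "quasiperiodic \<kappa> W f"
  shows "AE s in lborel. (\<Sum>c\<in>UNIV. \<Sum>j<h. exp (b j) * \<Gamma> j c * periodize \<kappa> W (u' c) (s + a j)) = f s"
proof -
  define G where "G j t = (\<Sum>c\<in>UNIV. \<Gamma> j c * u' c t)" for j t
  have a_Suc: "a (Suc i) = a i + \<tau> i" for i by (simp add: a_def)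
  have W: "W > 0" unfolding W_def a_def using \<tau> h by (intro sum_pos) (auto simp: lessThan_empty_iff)
  have \<kappa>: "\<kappa> \<noteq> 0" by (simp add: \<kappa>_def)
  have G: "supported 0 T (G j)" for j unfolding G_def[abs_def] by (intro supported_sum supported_cmult u'(1))
  have Z: "supported (- a h) 0 (\<lambda>s. 0)" by (simp add: supported_def)
  have Pz: "periodize \<kappa> W (\<lambda>s. 0) s = 0" for s by (simp add: periodize_def)
  have "\<exists>Y. (\<forall>i<h. \<forall>t. Y i t = exp (- \<zeta> (cycle_prev h i)) * Y (cycle_prev h i) (t - \<tau> (cycle_prev h i)) + G i t) \<and>
      (\<forall>i<h. \<forall>t\<in>{- \<tau> i..<0}. Y i t = exp (- b i) * 0) \<and>
      (\<forall>i<h. \<forall>t\<in>{T - \<tau> i..<T}. Y i t = exp (- b i) * (periodize \<kappa> W (\<lambda>s. 0) (t - a i) + (\<Sum>j<h. exp (b j) * periodize \<kappa> W (G j) (t - a i + a j))))"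
    unfolding W_def \<kappa>_def a_def b_def
    by (rule cycle_delay_system[OF h, where \<Phi> = "\<lambda>s. 0"]) (simp_all add: \<tau> G supported_def[of _ _ "\<lambda>s. 0"])
  then obtain Y where Y': "(\<forall>i<h. \<forall>t. Y i t = exp (- \<zeta> (cycle_prev h i)) * Y (cycle_prev h i) (t - \<tau> (cycle_prev h i)) + G i t) \<and>
      (\<forall>i<h. \<forall>t\<in>{- \<tau> i..<0}. Y i t = exp (- b i) * 0) \<and>
      (\<forall>i<h. \<forall>t\<in>{T - \<tau> i..<T}. Y i t = exp (- b i) * (periodize \<kappa> W (\<lambda>s. 0) (t - a i) + (\<Sum>j<h. exp (b j) * periodize \<kappa> W (G j) (t - a i + a j))))" ..
  note Y = conjunct1[OF Y'] conjunct1[OF conjunct2[OF Y']] conjunct2[OF conjunct2[OF Y']]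
  have XY: "AE t in lborel. t \<in> {- \<tau> i..T} \<longrightarrow> X i t = Y i t" if i: "i < h" for i
  proof (rule cycle_delay_unique[OF h \<tau>, where c = "\<lambda>i. exp (- \<zeta> (cycle_prev h i))" and G = "\<lambda>i t. \<Sum>c\<in>UNIV. \<Gamma> i c * u c t" and G' = G])
    fix i assume i: "i < h"
    have "AE t in lborel. \<forall>c\<in>UNIV. t \<in> {0..T} \<longrightarrow> u c t = u' c t" using u'(2) by (intro AE_finite_allI) auto
    then show "AE t in lborel. t \<in> {0..T} \<longrightarrow> (\<Sum>c\<in>UNIV. \<Gamma> i c * u c t) = G i t"
      by eventually_elim (simp add: G_def)
    show "AE t in lborel. t \<in> {- \<tau> i..<0} \<longrightarrow> X i t = Y i t"
      using init[OF i] by eventually_elim (use Y(2) i in auto)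
    next
    fix i t assume "i < h"
    then show "Y i t = exp (- \<zeta> (cycle_prev h i)) * Y (cycle_prev h i) (t - \<tau> (cycle_prev h i)) + G i t"
      using Y(1) by blast
  qed (rule X i | assumption)+
  define R where "R s = (\<Sum>j<h. exp (b j) * periodize \<kappa> W (G j) (s + a j))" for s
  have R_eq: "R s = (\<Sum>c\<in>UNIV. \<Sum>j<h. exp (b j) * \<Gamma> j c * periodize \<kappa> W (u' c) (s + a j))" for s
  proof -
    have "periodize \<kappa> W (G j) t = (\<Sum>c\<in>UNIV. \<Gamma> j c * periodize \<kappa> W (u' c) t)" for j t
      unfolding G_def[abs_def] by (subst periodize_sum[OF W supported_cmult[OF u'(1)]]) (simp_all add: periodize_cmult[OF W u'(1)])
    then show ?thesis unfolding R_def by (subst sum.swap) (simp add: sum_distrib_left mult.assoc)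
  qed
  have Rq: "quasiperiodic \<kappa> W R" unfolding R_def[abs_def]
    by (intro quasiperiodic_sum quasiperiodic_cmult quasiperiodic_shift periodize_quasiperiodic[OF \<kappa>])
  have Rf: "AE s in lborel. s \<in> {T - a (Suc i)..<T - a i} \<longrightarrow> R s = f s" if i: "i < h" for i
  proof -
    have "a 0 \<le> a i" "a (Suc i) \<le> W" unfolding W_def a_def using i \<tau> by (intro sum_mono2; auto simp: less_imp_le simp del: sum.lessThan_Suc)+
    then have "0 \<le> T - \<tau> i" using T by (simp add: a_Suc a_def)
    from XY[OF i] final[OF i] have "AE t in lborel. t \<in> {T - \<tau> i..<T} \<longrightarrow> R (t - a i) = f (t - a i)"
    proof eventually_elim
      case (elim t)
      show ?case
      proof
        assume t: "t \<in> {T - \<tau> i..<T}"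
        then have "t \<in> {- \<tau> i..T}" using \<open>0 \<le> T - \<tau> i\<close> \<tau>[OF i] by auto
        then have "Y i t = exp (- b i) * f (t - a i)" using elim t by auto
        moreover have "Y i t = exp (- b i) * R (t - a i)" using Y(3) i t by (simp add: R_def Pz)
        ultimately show "R (t - a i) = f (t - a i)" by simp
      qed
    qed
    from AE_shift_interval[OF this, of "a i"] show ?thesis by (simp add: a_Suc algebra_simps)
  qed
  have "AE s in lborel. \<forall>i\<in>{..<h}. s \<in> {T - a (Suc i)..<T - a i} \<longrightarrow> R s = f s"
    using Rf by (intro AE_finite_allI) auto
  then have "AE s in lborel. s \<in> {T - W..<T} \<longrightarrow> R s = f s"
  proof eventually_elim
    case (elim s)
    show ?case
    proof
      assume "s \<in> {T - W..<T}"
      then obtain i where "i < h" "s \<in> {T - a (Suc i)..<T - a i}"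
        using cycle_intervals[of T \<tau> h s] unfolding W_def a_def by auto
      then show "R s = f s" using elim by auto
    qed
  qed
  from AE_shift_interval[OF this, of "T - W"]
  have "AE s in lborel. s \<in> {0..<W} \<longrightarrow> R (s + (T - W)) = f (s + (T - W))" by simp
  moreover have "periodic W (\<lambda>s. R (s + (T - W)) = f (s + (T - W)))"
    using quasiperiodic_shift[OF Rq, of "T - W"] quasiperiodic_shift[OF f, of "T - W"] \<kappa>
    by (simp add: periodic_def quasiperiodic_def)
  ultimately have "AE s in lborel. R (s + (T - W)) = f (s + (T - W))" using AE_periodic[OF W] by blast
  from AE_lborel_shift[OF this, of "- (T - W)"] have "AE s in lborel. R s = f s" by simp
  then show ?thesis unfolding R_eq .
qed

text \<open>The function \<open>g\<close> is the desired final state minus the free evolution of the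
  initial one, both extended with multiplier \<kappa>. It does not depend on the control, so
  steering the cycle becomes one convolution equation for the periodizations.\<close>

theorem cycle_steering:
  fixes h :: nat and \<tau> \<zeta> :: "nat \<Rightarrow> real" and \<Gamma> :: "nat \<Rightarrow> 'c::finite \<Rightarrow> real"
  defines "a \<equiv> \<lambda>i. \<Sum>t<i. \<tau> t" and "b \<equiv> \<lambda>i. \<Sum>t<i. \<zeta> t"
  defines "W \<equiv> a h" and "\<kappa> \<equiv> exp (- b h)"
  assumes h: "1 \<le> h" and \<tau>: "\<And>i. i < h \<Longrightarrow> \<tau> i > 0"
    and F: "\<And>i. i < h \<Longrightarrow> locint (F i)" and \<Psi>: "\<And>i. i < h \<Longrightarrow> locint (\<Psi> i)"
  shows "\<exists>g. quasiperiodic \<kappa> W g \<and> locint g \<and>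
    (\<forall>u. (\<forall>c. supported 0 T (u c)) \<longrightarrow>
      (AE s in lborel. (\<Sum>c\<in>UNIV. \<Sum>j<h. exp (b j) * \<Gamma> j c * periodize \<kappa> W (u c) (s + a j)) = g s) \<longrightarrow>
      (\<exists>X. (\<forall>i<h. \<forall>t. X i t = exp (- \<zeta> (cycle_prev h i)) * X (cycle_prev h i) (t - \<tau> (cycle_prev h i)) + (\<Sum>c\<in>UNIV. \<Gamma> i c * u c t)) \<and>
        (\<forall>i<h. \<forall>t\<in>{- \<tau> i..<0}. X i t = F i t) \<and>
        (\<forall>i<h. AE t in lborel. t \<in> {T - \<tau> i..<T} \<longrightarrow> X i t = \<Psi> i t)))"
proof -
  have a_mono: "a i \<le> a j" if "i \<le> j" "j \<le> h" for i j
    unfolding a_def using that \<tau> by (intro sum_mono2) (auto simp: less_imp_le)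
  have a_Suc: "a (Suc i) = a i + \<tau> i" for i by (simp add: a_def)
  have a0: "a 0 = 0" by (simp add: a_def)
  have W: "W > 0" unfolding W_def a_def using \<tau> h by (intro sum_pos) (auto simp: lessThan_empty_iff)
  have \<kappa>: "\<kappa> \<noteq> 0" by (simp add: \<kappa>_def)
  \<comment> \<open>The profiles of all edges are normalised by exp (b i) and placed side by side in
    the moving frame, filling the period that ends at \<open>S\<close>; \<open>S\<close> is 0 for
    the initial and \<open>T\<close> for the final state.\<close>
  define glue where "glue S H s = (\<Sum>i<h. indicator {S - a (Suc i)..<S - a i} s * (exp (b i) * H i (s + a i)))" for S s :: real and H
  have glue_eq: "glue S H s = exp (b i) * H i (s + a i)" if i: "i < h" and s: "s \<in> {S - a (Suc i)..<S - a i}" for S H s i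
  proof -
    have "s \<notin> {S - a (Suc j)..<S - a j}" if j: "j < h" "j \<noteq> i" for j
    proof (cases "j < i")
      case True
      then show ?thesis using a_mono[of "Suc j" i] i s by auto
    next
      case False
      then show ?thesis using a_mono[of "Suc i" j] j s by auto
    qed
    then have "glue S H s = (\<Sum>j<h. if j = i then exp (b i) * H i (s + a i) else 0)"
      unfolding glue_def using s by (intro sum.cong) auto
    then show ?thesis using i by simp
  qed
  have glue_supp: "supported (S - W) S (glue S H)" for S H
    unfolding supported_def glue_def
  proof (intro allI impI sum.neutral ballI)
    fix s i assume s: "s \<notin> {S - W..<S}" and "i \<in> {..<h}"
    then have "s \<notin> {S - a (Suc i)..<S - a i}" using a_mono[of "Suc i" h] a_mono[of 0 i] by (auto simp: W_def a0)
    then show "indicator {S - a (Suc i)..<S - a i} s * (exp (b i) * H i (s + a i)) = 0" by simp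
  qed
  have glue_locint: "locint (glue S H)" if "\<And>i. i < h \<Longrightarrow> locint (H i)" for S H
    unfolding glue_def[abs_def] by (intro locint_sum locint_indicator locint_cmult locint_shift that) auto
  define \<Phi> where "\<Phi> = glue 0 F"
  define \<Psi>' where "\<Psi>' = glue T \<Psi>"
  have \<Phi>: "supported (- W) 0 \<Phi>" "locint \<Phi>" using glue_supp[where S = 0 and H = F] glue_locint[where S = 0 and H = F] F by (simp_all add: \<Phi>_def)
  have \<Psi>': "supported (T - W) (T - W + W) \<Psi>'" "locint \<Psi>'" using glue_supp[where S = T and H = \<Psi>] glue_locint[where S = T and H = \<Psi>] \<Psi> by (simp_all add: \<Psi>'_def)
  define g where "g s = periodize \<kappa> W \<Psi>' s - periodize \<kappa> W \<Phi> s" for s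
  have "quasiperiodic \<kappa> W g" unfolding g_def[abs_def] by (intro quasiperiodic_diff periodize_quasiperiodic \<kappa>)
  moreover have "locint g" unfolding g_def[abs_def]
    by (intro locint_diff locint_periodize[OF W \<Phi>] locint_periodize[OF W \<Psi>'])
  moreover have "\<exists>X. (\<forall>i<h. \<forall>t. X i t = exp (- \<zeta> (cycle_prev h i)) * X (cycle_prev h i) (t - \<tau> (cycle_prev h i)) + (\<Sum>c\<in>UNIV. \<Gamma> i c * u c t)) \<and>
        (\<forall>i<h. \<forall>t\<in>{- \<tau> i..<0}. X i t = F i t) \<and>
        (\<forall>i<h. AE t in lborel. t \<in> {T - \<tau> i..<T} \<longrightarrow> X i t = \<Psi> i t)"
    if u: "\<forall>c. supported 0 T (u c)" and ug: "AE s in lborel. (\<Sum>c\<in>UNIV. \<Sum>j<h. exp (b j) * \<Gamma> j c * periodize \<kappa> W (u c) (s + a j)) = g s" for u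
  proof -
    define G where "G j t = (\<Sum>c\<in>UNIV. \<Gamma> j c * u c t)" for j t
    have u: "supported 0 T (u c)" for c using u by simp
    have G: "supported 0 T (G j)" for j unfolding G_def[abs_def] by (intro supported_sum supported_cmult u)
    have "\<exists>X. (\<forall>i<h. \<forall>t. X i t = exp (- \<zeta> (cycle_prev h i)) * X (cycle_prev h i) (t - \<tau> (cycle_prev h i)) + G i t) \<and>
      (\<forall>i<h. \<forall>t\<in>{- \<tau> i..<0}. X i t = exp (- b i) * \<Phi> (t - a i)) \<and>
      (\<forall>i<h. \<forall>t\<in>{T - \<tau> i..<T}. X i t = exp (- b i) * (periodize \<kappa> W \<Phi> (t - a i) + (\<Sum>j<h. exp (b j) * periodize \<kappa> W (G j) (t - a i + a j))))"
      unfolding W_def \<kappa>_def a_def b_def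
      by (rule cycle_delay_system[OF h \<tau> \<Phi>(1)[unfolded W_def a_def] G])
    then obtain X where X': "(\<forall>i<h. \<forall>t. X i t = exp (- \<zeta> (cycle_prev h i)) * X (cycle_prev h i) (t - \<tau> (cycle_prev h i)) + G i t) \<and>
      (\<forall>i<h. \<forall>t\<in>{- \<tau> i..<0}. X i t = exp (- b i) * \<Phi> (t - a i)) \<and>
      (\<forall>i<h. \<forall>t\<in>{T - \<tau> i..<T}. X i t = exp (- b i) * (periodize \<kappa> W \<Phi> (t - a i) + (\<Sum>j<h. exp (b j) * periodize \<kappa> W (G j) (t - a i + a j))))" ..
    note X = conjunct1[OF X'] conjunct1[OF conjunct2[OF X']] conjunct2[OF conjunct2[OF X']]
    have eb: "exp (- b i) * (exp (b i) * y) = y" for i y by (simp add: mult.assoc[symmetric] exp_add[symmetric])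
    have "\<forall>i<h. \<forall>t. X i t = exp (- \<zeta> (cycle_prev h i)) * X (cycle_prev h i) (t - \<tau> (cycle_prev h i)) + (\<Sum>c\<in>UNIV. \<Gamma> i c * u c t)"
      using X(1) by (simp only: G_def)
    moreover have "X i t = F i t" if i: "i < h" and t: "t \<in> {- \<tau> i..<0}" for i t
    proof -
      have "\<Phi> (t - a i) = exp (b i) * F i (t - a i + a i)" unfolding \<Phi>_def
        by (rule glue_eq[OF i]) (use t in \<open>auto simp: a_Suc\<close>)
      then show ?thesis using X(2) i t by (simp add: eb)
    qed
    moreover have "AE t in lborel. t \<in> {T - \<tau> i..<T} \<longrightarrow> X i t = \<Psi> i t" if i: "i < h" for i
    proof -
      have P: "(\<Sum>j<h. exp (b j) * periodize \<kappa> W (G j) (s + a j)) = (\<Sum>c\<in>UNIV. \<Sum>j<h. exp (b j) * \<Gamma> j c * periodize \<kappa> W (u c) (s + a j))" for s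
      proof -
        have "periodize \<kappa> W (G j) t = (\<Sum>c\<in>UNIV. \<Gamma> j c * periodize \<kappa> W (u c) t)" for j t
          unfolding G_def[abs_def] by (subst periodize_sum[OF W supported_cmult[OF u]]) (simp_all add: periodize_cmult[OF W u])
        then show ?thesis by (subst sum.swap) (simp add: sum_distrib_left mult.assoc)
      qed
      from AE_lborel_shift[OF ug, of "- a i"] show ?thesis
      proof eventually_elim
        case (elim t)
        show ?case
        proof
          assume t: "t \<in> {T - \<tau> i..<T}"
          have s: "t - a i \<in> {T - a (Suc i)..<T - a i}" using t by (auto simp: a_Suc)
          then have s': "t - a i \<in> {T - W..<T - W + W}" using a_mono[of "Suc i" h] a_mono[of 0 i] i by (auto simp: W_def a0)
          have "X i t = exp (- b i) * (periodize \<kappa> W \<Phi> (t - a i) + g (t - a i))"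
            using X(3) i t elim unfolding P by simp
          also have "\<dots> = exp (- b i) * \<Psi>' (t - a i)"
            unfolding g_def periodize_fundamental[OF W \<Psi>'(1) s'] by simp
          also have "\<Psi>' (t - a i) = exp (b i) * \<Psi> i (t - a i + a i)" unfolding \<Psi>'_def by (rule glue_eq[OF i s])
          finally show "X i t = \<Psi> i t" by (simp add: eb)
        qed
      qed
    qed
    ultimately show ?thesis by blast
  qed
  ultimately show ?thesis by blast
qed

section \<open>Characteristics of a single edge\<close>

lemma set_integrable_lebesgue_on:
  fixes f :: "real \<Rightarrow> real"
  shows "set_integrable lebesgue {0..1} f \<longleftrightarrow> integrable (lebesgue_on {0..1}) f"
  by (simp add: set_integrable_def integrable_restrict_space)

lemma AE_lebesgue_on_iff:
  "(AE x in lebesgue_on {0..1}. P x) \<longleftrightarrow> (AE x in lborel. x \<in> {0..1::real} \<longrightarrow> P x)"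
  by (simp add: AE_restrict_space_iff AE_completion_iff)

text \<open>Integrals up to the endpoint 1 become \<open>delay\<close> and \<open>damping\<close>;
  as a difference of two of them the formula covers both orientations.\<close>

lemma interval_integral_lebesgue:
  fixes f :: "real \<Rightarrow> real"
  assumes f: "set_integrable lebesgue {0..1} f" and x: "x \<in> {0..1}" and y: "y \<in> {0..1}"
  shows "(LINT \<xi>=ereal x..ereal y|lebesgue. f \<xi>) = integral {x..1} f - integral {y..1} f"
proof -
  have int: "f integrable_on {0..1}" using set_lebesgue_integral_eq_integral(1)[OF f] .
  have *: "(LINT \<xi>:{p<..<q}|lebesgue. f \<xi>) = integral {p..1} f - integral {q..1} f"
    if "0 \<le> p" "p \<le> q" "q \<le> 1" for p q
  proof -
    have "set_integrable lebesgue {p<..<q} f"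
      by (rule set_integrable_subset[OF f]) (use that in auto)
    then have "(LINT \<xi>:{p<..<q}|lebesgue. f \<xi>) = integral {p..q} f"
      by (simp add: set_lebesgue_integral_eq_integral integral_open_interval_real)
    moreover have "integral {p..q} f + integral {q..1} f = integral {p..1} f"
    proof (rule Henstock_Kurzweil_Integration.integral_combine)
      show "f integrable_on {p..1}" by (rule integrable_subinterval_real[OF int]) (use that in auto)
    qed (use that in auto)
    ultimately show ?thesis by simp
  qed
  show ?thesis
    unfolding interval_lebesgue_integral_def einterval_eq using *[of x y] *[of y x] x y by auto
qed

locale transport_edge =
  fixes lam d :: "real \<Rightarrow> real"
  assumes d_int: "d absolutely_integrable_on {0..1}"
    and lam_neg: "\<And>x. x \<in> {0..1} \<Longrightarrow> lam x < 0"
    and lam_bdd: "L_infinity lam"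
    and inv_lam_bdd: "L_infinity (\<lambda>x. 1 / lam x)"
begin

text \<open>Since \<open>lam\<close> is negative, waves run from x = 1 to x = 0; the travel time is
  counted from the entrance x = 1.\<close>

definition delay :: "real \<Rightarrow> real" where "delay x = integral {x..1} (\<lambda>\<xi>. 1 / \<bar>lam \<xi>\<bar>)"

definition damping :: "real \<Rightarrow> real" where "damping x = integral {x..1} (\<lambda>\<xi>. d \<xi> / \<bar>lam \<xi>\<bar>)"

lemma inv_measurable: "(\<lambda>x. 1 / \<bar>lam x\<bar>) \<in> borel_measurable (lebesgue_on {0..1})"
proof -
  have [measurable]: "lam \<in> borel_measurable (lebesgue_on {0..1})" using lam_bdd by (simp add: L_infinity_def)
  show ?thesis by measurable
qed

lemma inv_bound: "\<exists>C. AE x in lebesgue_on {0..1}. 1 / \<bar>lam x\<bar> \<le> C"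
proof -
  obtain C where "AE x in lebesgue_on {0..1}. \<bar>1 / lam x\<bar> \<le> C"
    using inv_lam_bdd unfolding L_infinity_def by (elim exE conjE)
  then have "AE x in lebesgue_on {0..1}. 1 / \<bar>lam x\<bar> \<le> C" by simp
  then show ?thesis ..
qed

lemma bounded_mult_integrable:
  assumes f: "set_integrable lebesgue {0..1} f"
  shows "set_integrable lebesgue {0..1} (\<lambda>x. f x / \<bar>lam x\<bar>)"
proof -
  obtain C where C: "AE x in lebesgue_on {0..1}. 1 / \<bar>lam x\<bar> \<le> C" using inv_bound ..
  have fi: "integrable (lebesgue_on {0..1}) f" using f by (simp only: set_integrable_lebesgue_on)
  have "integrable (lebesgue_on {0..1}) (\<lambda>x. f x * (1 / \<bar>lam x\<bar>))"
  proof (rule Bochner_Integration.integrable_bound)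
    show "integrable (lebesgue_on {0..1}) (\<lambda>x. C * f x)" using fi by (rule integrable_mult_right)
    show "(\<lambda>x. f x * (1 / \<bar>lam x\<bar>)) \<in> borel_measurable (lebesgue_on {0..1})"
      by (rule borel_measurable_times[OF borel_measurable_integrable[OF fi] inv_measurable])
    show "AE x in lebesgue_on {0..1}. norm (f x * (1 / \<bar>lam x\<bar>)) \<le> norm (C * f x)"
      using C
    proof eventually_elim
      case (elim x)
      have "\<bar>f x\<bar> * (1 / \<bar>lam x\<bar>) \<le> \<bar>f x\<bar> * \<bar>C\<bar>"
        using elim by (intro mult_left_mono) auto
      then show ?case by (simp add: abs_mult mult.commute)
    qed
  qed
  then show ?thesis by (simp add: set_integrable_lebesgue_on)
qed

lemma inv_integrable: "set_integrable lebesgue {0..1} (\<lambda>x. 1 / \<bar>lam x\<bar>)"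
  by (rule bounded_mult_integrable) simp

lemma ratio_integrable: "set_integrable lebesgue {0..1} (\<lambda>x. d x / \<bar>lam x\<bar>)"
  by (rule bounded_mult_integrable[OF d_int])

lemma delay_1: "delay 1 = 0" and damping_1: "damping 1 = 0"
  by (simp_all add: delay_def damping_def)

lemma interval_integral_eq:
  assumes x: "x \<in> {0..1}" and y: "y \<in> {0..1}"
  shows "(LINT \<xi>=ereal x..ereal y|lebesgue. (1 / lam \<xi>)) = delay y - delay x"
    and "(LINT \<xi>=ereal x..ereal y|lebesgue. (d \<xi> / lam \<xi>)) = damping y - damping x"
proof -
  have *: "(LINT \<xi>=ereal x..ereal y|lebesgue. (g \<xi> / lam \<xi>)) = integral {y..1} (\<lambda>\<xi>. g \<xi> / \<bar>lam \<xi>\<bar>) - integral {x..1} (\<lambda>\<xi>. g \<xi> / \<bar>lam \<xi>\<bar>)"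
    if g: "set_integrable lebesgue {0..1} (\<lambda>\<xi>. g \<xi> / \<bar>lam \<xi>\<bar>)" for g
  proof -
    have eq: "g \<xi> / lam \<xi> = - (g \<xi> / \<bar>lam \<xi>\<bar>)" if "\<xi> \<in> {0..1}" for \<xi>
      using lam_neg[OF that] by simp
    have "set_integrable lebesgue {0..1} (\<lambda>\<xi>. - (g \<xi> / \<bar>lam \<xi>\<bar>))"
      using g by (simp add: set_integrable_def)
    then have "set_integrable lebesgue {0..1} (\<lambda>\<xi>. g \<xi> / lam \<xi>)"
      by (subst set_integrable_cong[OF refl refl eq]) auto
    then have "(LINT \<xi>=ereal x..ereal y|lebesgue. (g \<xi> / lam \<xi>)) = integral {x..1} (\<lambda>\<xi>. g \<xi> / lam \<xi>) - integral {y..1} (\<lambda>\<xi>. g \<xi> / lam \<xi>)"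
      by (rule interval_integral_lebesgue[OF _ x y])
    moreover have "integral {p..1} (\<lambda>\<xi>. g \<xi> / lam \<xi>) = - integral {p..1} (\<lambda>\<xi>. g \<xi> / \<bar>lam \<xi>\<bar>)" if "p \<in> {0..1}" for p
    proof -
      have "integral {p..1} (\<lambda>\<xi>. g \<xi> / lam \<xi>) = integral {p..1} (\<lambda>\<xi>. - (g \<xi> / \<bar>lam \<xi>\<bar>))"
        by (rule Henstock_Kurzweil_Integration.integral_cong) (rule eq, use that in auto)
      then show ?thesis by simp
    qed
    ultimately show ?thesis using x y by simp
  qed
  show "(LINT \<xi>=ereal x..ereal y|lebesgue. (1 / lam \<xi>)) = delay y - delay x"
    unfolding delay_def by (rule *[OF inv_integrable])
  show "(LINT \<xi>=ereal x..ereal y|lebesgue. (d \<xi> / lam \<xi>)) = damping y - damping x"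
    unfolding damping_def by (rule *[OF ratio_integrable])
qed

lemma delay_0: "delay 0 = (LINT x=0..1|lebesgue. (1 / \<bar>lam x\<bar>))"
  and damping_0: "damping 0 = (LINT x=0..1|lebesgue. (d x / \<bar>lam x\<bar>))"
  using interval_integral_lebesgue[OF inv_integrable, of 0 1] interval_integral_lebesgue[OF ratio_integrable, of 0 1]
  by (simp_all add: delay_def damping_def zero_ereal_def one_ereal_def)

lemma delay_continuous: "continuous_on {0..1} delay" and damping_continuous: "continuous_on {0..1} damping"
  unfolding delay_def[abs_def] damping_def[abs_def]
  using set_lebesgue_integral_eq_integral(1)[OF inv_integrable] set_lebesgue_integral_eq_integral(1)[OF ratio_integrable]
  by (auto intro: indefinite_integral_continuous_1')

lemma nn_integral_inv:
  assumes "0 \<le> p" "p \<le> q" "q \<le> 1"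
  shows "(\<integral>\<^sup>+ x. ennreal (1 / \<bar>lam x\<bar>) * indicator {p..<q} x \<partial>lebesgue_on {0..1}) = ennreal (delay p - delay q)"
proof -
  have int: "(\<lambda>x. 1 / \<bar>lam x\<bar>) integrable_on {0..1}" using set_lebesgue_integral_eq_integral(1)[OF inv_integrable] .
  have si: "set_integrable lebesgue {p..<q} (\<lambda>x. 1 / \<bar>lam x\<bar>)"
    by (rule set_integrable_subset[OF inv_integrable]) (use assms in auto)
  have "(\<integral>\<^sup>+ x. ennreal (1 / \<bar>lam x\<bar>) * indicator {p..<q} x \<partial>lebesgue_on {0..1})
    = (\<integral>\<^sup>+ x. ennreal (indicator {p..<q} x *\<^sub>R (1 / \<bar>lam x\<bar>)) \<partial>lebesgue)"
    by (subst nn_integral_restrict_space) (use assms in \<open>auto intro!: nn_integral_cong simp: indicator_def\<close>)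
  also have "\<dots> = ennreal (LINT x:{p..<q}|lebesgue. 1 / \<bar>lam x\<bar>)"
    unfolding set_lebesgue_integral_def
    by (rule nn_integral_eq_integral) (use si in \<open>auto simp: set_integrable_def\<close>)
  also have "(LINT x:{p..<q}|lebesgue. 1 / \<bar>lam x\<bar>) = integral {p..<q} (\<lambda>x. 1 / \<bar>lam x\<bar>)"
    by (rule set_lebesgue_integral_eq_integral(2)[OF si])
  also have "\<dots> = integral {p..q} (\<lambda>x. 1 / \<bar>lam x\<bar>)"
    by (rule integral_subset_negligible[symmetric, symmetric]) (auto intro: negligible_subset[of "{q}"])
  also have "\<dots> = delay p - delay q"
  proof -
    have "integral {p..q} (\<lambda>x. 1 / \<bar>lam x\<bar>) + integral {q..1} (\<lambda>x. 1 / \<bar>lam x\<bar>) = integral {p..1} (\<lambda>x. 1 / \<bar>lam x\<bar>)"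
    proof (rule Henstock_Kurzweil_Integration.integral_combine)
      show "(\<lambda>x. 1 / \<bar>lam x\<bar>) integrable_on {p..1}" by (rule integrable_subinterval_real[OF int]) (use assms in auto)
    qed (use assms in auto)
    then show ?thesis by (simp add: delay_def)
  qed
  finally show ?thesis .
qed

text \<open>Otherwise the strictly positive function 1 / |lam| would have integral 0 over an
  interval of positive length.\<close>

lemma delay_strict_antimono:
  assumes "0 \<le> p" "p < q" "q \<le> 1" shows "delay q < delay p"
proof (rule ccontr)
  assume "\<not> delay q < delay p"
  then have "ennreal (delay p - delay q) = 0" by (simp add: ennreal_neg)
  then have "(\<integral>\<^sup>+ x. ennreal (1 / \<bar>lam x\<bar>) * indicator {p..<q} x \<partial>lebesgue_on {0..1}) = 0"
    using nn_integral_inv[of p q] assms by simp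
  moreover have "(\<lambda>x. ennreal (1 / \<bar>lam x\<bar>) * indicator {p..<q} x) \<in> borel_measurable (lebesgue_on {0..1})"
    by (intro borel_measurable_times_ennreal measurable_compose[OF inv_measurable measurable_ennreal]
      measurable_restrict_space1 borel_measurable_indicator) simp
  ultimately have "AE x in lebesgue_on {0..1}. ennreal (1 / \<bar>lam x\<bar>) * indicator {p..<q} x = 0"
    by (simp add: nn_integral_0_iff_AE)
  then have "AE x in lebesgue. x \<in> {0..1} \<longrightarrow> ennreal (1 / \<bar>lam x\<bar>) * indicator {p..<q} x = 0"
    by (simp add: AE_restrict_space_iff)
  then have "AE x in lebesgue. x \<notin> {p..<q}"
  proof eventually_elim
    case (elim x)
    show ?case
    proof
      assume x: "x \<in> {p..<q}"
      then have "x \<in> {0..1}" using assms by auto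
      with elim x lam_neg[of x] show False by (simp add: ennreal_eq_0_iff)
    qed
  qed
  then have "{p..<q} \<in> null_sets lebesgue" by (subst (asm) AE_iff_null_sets[symmetric]) auto
  then have "emeasure lborel {p..<q} = 0" by auto
  then show False using assms by simp
qed

lemma delay_nonneg: "x \<in> {0..1} \<Longrightarrow> 0 \<le> delay x" and delay_le: "x \<in> {0..1} \<Longrightarrow> delay x \<le> delay 0"
  using delay_strict_antimono[of x 1] delay_strict_antimono[of 0 x] by (auto simp: delay_1 le_less)

lemma delay_0_pos: "0 < delay 0"
  using delay_strict_antimono[of 0 1] by (simp add: delay_1)

lemma delay_onto:
  assumes "r \<in> {0..delay 0}" shows "\<exists>x\<in>{0..1}. delay x = r"
  using IVT2'[of delay 1 r 0] assms delay_continuous by (auto simp: delay_1)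

lemma delay_inj: "x \<in> {0..1} \<Longrightarrow> y \<in> {0..1} \<Longrightarrow> delay x = delay y \<Longrightarrow> x = y"
  using delay_strict_antimono[of x y] delay_strict_antimono[of y x] by (cases x y rule: linorder_cases) auto

text \<open>The clamping makes the inverse of \<open>delay\<close> total and continuous.\<close>

definition position :: "real \<Rightarrow> real" where
  "position r = the_inv_into {0..1} delay (max 0 (min (delay 0) r))"

lemma position_delay: "x \<in> {0..1} \<Longrightarrow> position (delay x) = x"
  using delay_nonneg[of x] delay_le[of x] delay_inj
  by (simp add: position_def min_absorb2 max_absorb2 the_inv_into_f_f inj_on_def)

lemma delay_image: "delay ` {0..1} = {0..delay 0}"
  using delay_onto delay_nonneg delay_le by (auto simp: image_iff) metis

lemma delay_position: "r \<in> {0..delay 0} \<Longrightarrow> delay (position r) = r"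
  and position_range: "position r \<in> {0..1}"
proof -
  have inj: "inj_on delay {0..1}" using delay_inj by (auto simp: inj_on_def)
  have "max 0 (min (delay 0) r) \<in> delay ` {0..1}" using delay_0_pos by (auto simp: delay_image)
  from the_inv_into_into[OF inj this subset_refl] f_the_inv_into_f[OF inj this]
  show "r \<in> {0..delay 0} \<Longrightarrow> delay (position r) = r" "position r \<in> {0..1}"
    by (auto simp: position_def)
qed

lemma position_continuous: "continuous_on UNIV position"
proof -
  have inj: "inj_on delay {0..1}" using delay_inj by (auto simp: inj_on_def)
  have "continuous_on (delay ` {0..1}) (the_inv_into {0..1} delay)"
    by (rule continuous_on_inv_into[OF delay_continuous _ inj]) simp
  then have "continuous_on {0..delay 0} (the_inv_into {0..1} delay)" by (simp only: delay_image)
  then show ?thesis unfolding position_def[abs_def]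
    by (rule continuous_on_compose2) (use delay_0_pos in \<open>auto intro!: continuous_intros\<close>)
qed

lemma position_measurable [measurable]: "position \<in> borel_measurable borel"
  by (rule borel_measurable_continuous_onI[OF position_continuous])

section \<open>Change of variables from position to delay\<close>

lemma delay_measurable: "delay \<in> borel_measurable (lebesgue_on {0..1})"
  by (rule continuous_imp_measurable_on_sets_lebesgue[OF delay_continuous]) simp

text \<open>As \<open>delay\<close> is the primitive of a merely bounded measurable function, the
  substitution rule is proved for measures: it suffices to compare half-lines, and by monotonicity
  the preimage of a half-line starting in {0..delay 0} is an interval {0..<y}.\<close>

lemma distr_delay:
  "distr (density (lebesgue_on {0..1}) (\<lambda>x. ennreal (1 / \<bar>lam x\<bar>))) borel delay
    = density lborel (indicator {0..delay 0})" (is "?M = ?N")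
proof (rule measure_eqI_lessThan)
  have w: "(\<lambda>x. ennreal (1 / \<bar>lam x\<bar>)) \<in> borel_measurable (lebesgue_on {0..1})"
    by (rule measurable_compose[OF inv_measurable measurable_ennreal])
  have dm: "delay \<in> measurable (density (lebesgue_on {0..1}) (\<lambda>x. ennreal (1 / \<bar>lam x\<bar>))) borel"
    using delay_measurable by simp
  have M: "emeasure ?M {r<..} = (\<integral>\<^sup>+ x. ennreal (1 / \<bar>lam x\<bar>) * indicator {x. r < delay x} x \<partial>lebesgue_on {0..1})" for r
  proof -
    have "{x. r < delay x} \<inter> {0..1} \<in> sets (lebesgue_on {0..1})"
      using measurable_sets[OF delay_measurable, of "{r<..}"] by (simp add: vimage_def space_restrict_space)
    then have "emeasure ?M {r<..} = (\<integral>\<^sup>+ x. ennreal (1 / \<bar>lam x\<bar>) * indicator ({x. r < delay x} \<inter> {0..1}) x \<partial>lebesgue_on {0..1})"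
      using w by (subst emeasure_distr[OF dm]) (simp_all add: emeasure_density vimage_def space_restrict_space)
    also have "\<dots> = (\<integral>\<^sup>+ x. ennreal (1 / \<bar>lam x\<bar>) * indicator {x. r < delay x} x \<partial>lebesgue_on {0..1})"
      by (intro nn_integral_cong) (auto simp: space_restrict_space indicator_def)
    finally show ?thesis .
  qed
  \<comment> \<open>For r < 0 the preimage of the half-line is all of {0..1}, while
    \<open>nn_integral_inv\<close> speaks of {0..<1}; the endpoint is a null set.\<close>
  have ends: "AE x in lebesgue_on {0..1::real}. x \<noteq> 1"
    unfolding AE_lebesgue_on_iff using AE_lborel_singleton[of "1::real"] by eventually_elim simp
  have full: "emeasure ?M {r<..} = ennreal (delay 0)" if "r < 0" for r
  proof -
    have "emeasure ?M {r<..} = (\<integral>\<^sup>+ x. ennreal (1 / \<bar>lam x\<bar>) * indicator {0..<1} x \<partial>lebesgue_on {0..1})"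
      unfolding M
    proof (rule nn_integral_cong_AE)
      show "AE x in lebesgue_on {0..1}. ennreal (1 / \<bar>lam x\<bar>) * indicator {x. r < delay x} x = ennreal (1 / \<bar>lam x\<bar>) * indicator {0..<1} x"
        using ends AE_space
      proof eventually_elim
        case (elim x)
        then have "x \<in> {0..1}" "x \<noteq> 1" by (auto simp: space_restrict_space)
        then show ?case using delay_nonneg[of x] \<open>r < 0\<close> by (simp add: indicator_def)
      qed
    qed
    then show ?thesis using nn_integral_inv[of 0 1] by (simp add: delay_1)
  qed
  have N: "emeasure ?N {r<..} = emeasure lborel ({0..delay 0} \<inter> {r<..})" for r
    by (simp add: emeasure_density nn_integral_set_ennreal flip: indicator_inter_arith)
  show "emeasure ?M {r<..} = emeasure ?N {r<..}" for r
  proof -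
    consider "r < 0" | "0 \<le> r" "r \<le> delay 0" | "delay 0 < r" by linarith
    then show ?thesis
    proof cases
      case 1
      then have "{0..delay 0} \<inter> {r<..} = {0..delay 0}" by auto
      then show ?thesis using full[OF 1] delay_0_pos by (simp add: N)
    next
      case 2
      then obtain y where y: "y \<in> {0..1}" "delay y = r" using delay_onto[of r] by auto
      have "emeasure ?M {r<..} = (\<integral>\<^sup>+ x. ennreal (1 / \<bar>lam x\<bar>) * indicator {0..<y} x \<partial>lebesgue_on {0..1})"
        unfolding M
      proof (rule nn_integral_cong)
        fix x :: real assume "x \<in> space (lebesgue_on {0..1})"
        then have x: "x \<in> {0..1}" by (simp add: space_restrict_space)
        have "r < delay x \<longleftrightarrow> x < y"
          using delay_strict_antimono[of x y] delay_strict_antimono[of y x] x y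
          by (cases x y rule: linorder_cases) auto
        then show "ennreal (1 / \<bar>lam x\<bar>) * indicator {x. r < delay x} x = ennreal (1 / \<bar>lam x\<bar>) * indicator {0..<y} x"
          using x by (simp add: indicator_def)
      qed
      also have "\<dots> = ennreal (delay 0 - r)" using nn_integral_inv[of 0 y] y by simp
      also have "\<dots> = emeasure lborel {r<..delay 0}" using 2 by simp
      also have "{r<..delay 0} = {0..delay 0} \<inter> {r<..}" using 2 by auto
      finally show ?thesis by (simp only: N)
    next
      case 3
      then have "{0..delay 0} \<inter> {r<..} = {}" by auto
      moreover have "emeasure ?M {r<..} = (\<integral>\<^sup>+ x. 0 \<partial>lebesgue_on {0..1::real})"
        unfolding M
      proof (rule nn_integral_cong)
        fix x :: real assume "x \<in> space (lebesgue_on {0..1})"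
        then have x: "x \<in> {0..1}" by (simp add: space_restrict_space)
        then show "ennreal (1 / \<bar>lam x\<bar>) * indicator {x. r < delay x} x = 0"
          using delay_le[OF x] 3 by (simp add: indicator_def)
      qed
      ultimately show ?thesis by (simp add: N)
    qed
  qed
  show "emeasure ?M {r<..} < \<infinity>" for r
  proof -
    have "emeasure ?M {r<..} \<le> emeasure ?M {min r (-1)<..}" by (rule emeasure_mono) auto
    also have "\<dots> < \<infinity>" by (subst full) auto
    finally show ?thesis .
  qed
qed simp_all

lemma nn_integral_delay:
  assumes g[measurable]: "g \<in> borel_measurable borel"
  shows "(\<integral>\<^sup>+ r. g r * indicator {0..delay 0} r \<partial>lborel) = (\<integral>\<^sup>+ x. ennreal (1 / \<bar>lam x\<bar>) * g (delay x) \<partial>lebesgue_on {0..1})"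
proof -
  have w: "(\<lambda>x. ennreal (1 / \<bar>lam x\<bar>)) \<in> borel_measurable (lebesgue_on {0..1})"
    by (rule measurable_compose[OF inv_measurable measurable_ennreal])
  have dm: "delay \<in> measurable (density (lebesgue_on {0..1}) (\<lambda>x. ennreal (1 / \<bar>lam x\<bar>))) borel"
    using delay_measurable by simp
  have "(\<integral>\<^sup>+ r. g r * indicator {0..delay 0} r \<partial>lborel) = (\<integral>\<^sup>+ r. g r \<partial>density lborel (indicator {0..delay 0}))"
    by (subst nn_integral_density) (simp_all add: mult.commute)
  also have "\<dots> = (\<integral>\<^sup>+ x. g (delay x) \<partial>density (lebesgue_on {0..1}) (\<lambda>x. ennreal (1 / \<bar>lam x\<bar>)))"
    unfolding distr_delay[symmetric] by (rule nn_integral_distr[OF dm]) simp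
  also have "\<dots> = (\<integral>\<^sup>+ x. ennreal (1 / \<bar>lam x\<bar>) * g (delay x) \<partial>lebesgue_on {0..1})"
    by (rule nn_integral_density[OF w]) (rule measurable_compose[OF delay_measurable g])
  finally show ?thesis .
qed

text \<open>The density 1 / |lam| is strictly positive, so sets that are null for the image measure
  have null preimages.\<close>

lemma AE_delay:
  assumes "AE r in lborel. r \<in> {0..delay 0} \<longrightarrow> P r"
  shows "AE x in lebesgue_on {0..1}. P (delay x)"
proof -
  obtain N where N: "{r \<in> space lborel. \<not> (r \<in> {0..delay 0} \<longrightarrow> P r)} \<subseteq> N" "emeasure lborel N = 0" "N \<in> sets lborel"
    using assms by (rule AE_E)
  have Nb: "N \<in> sets borel" using N(3) by simp
  have "(\<integral>\<^sup>+ r. indicator N r * indicator {0..delay 0} r \<partial>lborel) = (0::ennreal)"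
    using N AE_not_in[of N lborel] by (subst nn_integral_0_iff_AE) (auto simp: indicator_def null_sets_def)
  then have "(\<integral>\<^sup>+ x. ennreal (1 / \<bar>lam x\<bar>) * indicator N (delay x) \<partial>lebesgue_on {0..1}) = 0"
    using nn_integral_delay[of "indicator N"] Nb by simp
  then have "AE x in lebesgue_on {0..1}. ennreal (1 / \<bar>lam x\<bar>) * indicator N (delay x) = 0"
    using Nb by (subst (asm) nn_integral_0_iff_AE)
      (auto intro!: borel_measurable_times_ennreal measurable_compose[OF inv_measurable measurable_ennreal]
      measurable_compose[OF delay_measurable borel_measurable_indicator])
  then show ?thesis using AE_space
  proof eventually_elim
    case (elim x)
    then have x: "x \<in> {0..1}" by (simp add: space_restrict_space)
    have "delay x \<notin> N" using elim(1) lam_neg[OF x] by (auto simp: indicator_def ennreal_eq_0_iff)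
    then show ?case using N(1) delay_nonneg[OF x] delay_le[OF x] by auto
  qed
qed

text \<open>The exceptional set is carried over as the preimage of a Borel null set under the
  continuous map \<open>position\<close>, and therefore stays Borel.\<close>

lemma AE_delay_converse:
  assumes "AE x in lebesgue_on {0..1}. P (delay x)"
  shows "AE r in lborel. r \<in> {0..delay 0} \<longrightarrow> P r"
proof -
  have "AE x in lborel. x \<in> {0..1} \<longrightarrow> P (delay x)" using assms by (simp only: AE_lebesgue_on_iff)
  then obtain N where N: "{x \<in> space lborel. \<not> (x \<in> {0..1} \<longrightarrow> P (delay x))} \<subseteq> N" "emeasure lborel N = 0" "N \<in> sets lborel"
    by (rule AE_E)
  have Nb[measurable]: "N \<in> sets borel" using N(3) by simp
  have "AE x in lborel. x \<notin> N" using N by (intro AE_not_in) (simp add: null_sets_def)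
  then have "AE x in lebesgue_on {0..1}. ennreal (1 / \<bar>lam x\<bar>) * indicator N x = 0"
    unfolding AE_lebesgue_on_iff by eventually_elim (simp add: indicator_def)
  then have "AE x in lebesgue_on {0..1}. ennreal (1 / \<bar>lam x\<bar>) * indicator N (position (delay x)) = 0"
    using AE_space by eventually_elim (simp add: space_restrict_space position_delay)
  then have "(\<integral>\<^sup>+ x. ennreal (1 / \<bar>lam x\<bar>) * indicator N (position (delay x)) \<partial>lebesgue_on {0..1}) = (\<integral>\<^sup>+ x. 0 \<partial>lebesgue_on {0..1::real})"
    by (rule nn_integral_cong_AE)
  then have "(\<integral>\<^sup>+ r. indicator N (position r) * indicator {0..delay 0} r \<partial>lborel) = (0::ennreal)"
    using nn_integral_delay[of "\<lambda>r. indicator N (position r)"] by simp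
  then have "AE r in lborel. indicator N (position r) * indicator {0..delay 0} r = (0::ennreal)"
    by (subst (asm) nn_integral_0_iff_AE) auto
  then show ?thesis
  proof eventually_elim
    case (elim r)
    show ?case
    proof
      assume r: "r \<in> {0..delay 0}"
      then have "position r \<notin> N" using elim by (auto simp: indicator_def split: if_splits)
      then have "P (delay (position r))" using N(1) position_range[of r] by auto
      then show "P r" using delay_position[OF r] by simp
    qed
  qed
qed

text \<open>In the delay coordinate and multiplied by exp (damping x), a profile is transported
  without change. It is integrable since \<open>damping\<close> is bounded and the density of the
  change of variables turns |f| into |f| / |lam|; a Borel representative of \<open>f\<close> makes
  the composition with \<open>position\<close> measurable.\<close>

lemma pullback_locint:
  assumes f: "set_integrable lebesgue {0..1} f"
  shows "\<exists>F. locint F \<and> (AE x in lebesgue_on {0..1}. F (delay x) = exp (damping x) * f x)"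
proof -
  have "(\<lambda>x. indicat_real {0..1} x *\<^sub>R f x) \<in> borel_measurable lebesgue"
    using f unfolding set_integrable_def by (rule borel_measurable_integrable)
  then obtain f' where f'[measurable]: "f' \<in> borel_measurable lborel" and ae: "AE x in lborel. indicat_real {0..1} x *\<^sub>R f x = f' x"
    using completion_ex_borel_measurable_real by blast
  define D where "D r = damping (position r)" for r
  have "continuous_on UNIV D" unfolding D_def[abs_def]
    by (rule continuous_on_compose2[OF damping_continuous position_continuous]) (use position_range in auto)
  then have [measurable]: "D \<in> borel_measurable borel" by (rule borel_measurable_continuous_onI)
  define F where "F r = indicator {0..delay 0} r * (exp (D r) * f' (position r))" for r
  have [measurable]: "F \<in> borel_measurable borel" unfolding F_def[abs_def] using f' by measurable
  have ae': "AE x in lebesgue_on {0..1}. f' x = f x"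
    unfolding AE_lebesgue_on_iff using ae by eventually_elim (auto simp: indicator_def)
  have FD: "F (delay x) = exp (damping x) * f' x" if "x \<in> {0..1}" for x
    using delay_nonneg[OF that] delay_le[OF that] by (simp add: F_def D_def position_delay[OF that])
  have eq: "AE x in lebesgue_on {0..1}. F (delay x) = exp (damping x) * f x"
    using ae' AE_space by eventually_elim (simp add: FD space_restrict_space)
  have "compact (damping ` {0..1})" by (rule compact_continuous_image[OF damping_continuous]) simp
  then obtain B where B: "\<forall>y\<in>damping ` {0..1}. norm y \<le> B" by (meson bounded_iff compact_imp_bounded)
  have fi: "integrable (lebesgue_on {0..1}) (\<lambda>x. f x / \<bar>lam x\<bar>)"
    using bounded_mult_integrable[OF f] by (simp only: set_integrable_lebesgue_on)
  have "(\<integral>\<^sup>+ r. ennreal \<bar>F r\<bar> \<partial>lborel) = (\<integral>\<^sup>+ r. ennreal \<bar>F r\<bar> * indicator {0..delay 0} r \<partial>lborel)"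
    by (intro nn_integral_cong) (simp add: F_def indicator_def)
  also have "\<dots> = (\<integral>\<^sup>+ x. ennreal (1 / \<bar>lam x\<bar>) * ennreal \<bar>F (delay x)\<bar> \<partial>lebesgue_on {0..1})"
    by (rule nn_integral_delay) measurable
  also have "\<dots> \<le> (\<integral>\<^sup>+ x. ennreal (exp B) * ennreal (norm (f x / \<bar>lam x\<bar>)) \<partial>lebesgue_on {0..1})"
  proof (rule nn_integral_mono_AE)
    show "AE x in lebesgue_on {0..1}. ennreal (1 / \<bar>lam x\<bar>) * ennreal \<bar>F (delay x)\<bar> \<le> ennreal (exp B) * ennreal (norm (f x / \<bar>lam x\<bar>))"
      using eq AE_space
    proof eventually_elim
      case (elim x)
      then have x: "x \<in> {0..1}" by (simp add: space_restrict_space)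
      have "damping x \<le> B" using B x by force
      then have "exp (damping x) * (\<bar>f x\<bar> / \<bar>lam x\<bar>) \<le> exp B * (\<bar>f x\<bar> / \<bar>lam x\<bar>)"
        by (intro mult_right_mono) auto
      then show ?case unfolding elim(1)
        by (simp add: ennreal_mult'[symmetric] abs_mult ennreal_leI)
    qed
  qed
  also have "\<dots> = ennreal (exp B) * (\<integral>\<^sup>+ x. ennreal (norm (f x / \<bar>lam x\<bar>)) \<partial>lebesgue_on {0..1})"
    by (rule nn_integral_cmult) (use borel_measurable_integrable[OF fi] in measurable)
  also have "\<dots> < \<infinity>" using fi by (simp add: integrable_iff_bounded ennreal_mult_less_top)
  finally have "integrable lborel F" by (intro integrableI_bounded) auto
  then have "locint F" unfolding locint_def set_integrable_def
    using integrable_mult_indicator[of _ lborel F] by auto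
  with eq show ?thesis by blast
qed

end

section \<open>The closure of the matrices of the network\<close>

text \<open>The first row has only two nonzero entries. Deleting the one in column 0 leaves a lower
  triangular matrix with diagonal \<open>d\<close>, deleting the one in the last column an upper
  triangular matrix with diagonal - z; the signs cancel against that of the cofactor. For
  \<open>h = 1\<close> the two entries coincide.\<close>

lemma det_cyclic:
  fixes d z :: "nat \<Rightarrow> complex"
  assumes h: "1 \<le> h"
  defines "A \<equiv> Matrix.mat h h (\<lambda>(i, j). (if i = j then d i else 0) - (if i = Suc j mod h then z j else 0))"
  shows "Determinant.det A = (\<Prod>i<h. d i) - (\<Prod>i<h. z i)"
proof (cases "h = 1")
  case True
  then have "A \<in> carrier_mat 1 1" by (simp add: A_def)
  then show ?thesis using True by (simp add: det_single A_def)
next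
  case False
  with h obtain n where n: "h = Suc n" "1 \<le> n" by (cases h) auto
  have A: "A \<in> carrier_mat h h" by (simp add: A_def)
  have ent: "A $$ (i, j) = (if i = j then d i else 0) - (if i = Suc j mod h then z j else 0)" if "i < h" "j < h" for i j
    using that by (simp add: A_def)
  have modS: "Suc j mod h = (if j = n then 0 else Suc j)" if "j < h" for j
    using that n by auto
  have e1: "A $$ (Suc i, Suc j) = (if i = j then d (Suc i) else 0) - (if i = Suc j then z (Suc j) else 0)"
    if "i < n" "j < n" for i j
    using that n ent[of "Suc i" "Suc j"] modS[of "Suc j"] by auto
  have e2: "A $$ (Suc i, j) = (if Suc i = j then d j else 0) - (if i = j then z j else 0)"
    if "i < n" "j < n" for i j
    using that n ent[of "Suc i" j] modS[of j] by auto
  have e3: "A $$ (0, j) = (if j = 0 then d 0 else 0) - (if j = n then z n else 0)" if "j < h" for j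
    using that n ent[of 0 j] modS[of j] by auto
  have D0: "mat_delete A 0 0 = Matrix.mat n n (\<lambda>(i, j). A $$ (Suc i, Suc j))"
    unfolding mat_delete_def using A n by (intro eq_matI) auto
  have D1: "mat_delete A 0 n = Matrix.mat n n (\<lambda>(i, j). A $$ (Suc i, j))"
    unfolding mat_delete_def using A n by (intro eq_matI) auto
  have "Determinant.det (mat_delete A 0 0) = prod_list (diag_mat (mat_delete A 0 0))"
    by (rule det_lower_triangular[of n]) (auto simp: D0 e1)
  also have "\<dots> = (\<Prod>i<n. d (Suc i))"
    unfolding prod_list_diag_prod D0 by (auto simp: lessThan_atLeast0 e1 intro!: prod.cong)
  finally have det0: "Determinant.det (mat_delete A 0 0) = (\<Prod>i<n. d (Suc i))" .
  have "Determinant.det (mat_delete A 0 n) = prod_list (diag_mat (mat_delete A 0 n))"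
    by (rule det_upper_triangular[of _ n]) (auto simp: D1 e2 upper_triangular_def)
  also have "\<dots> = (\<Prod>i<n. - z i)"
    unfolding prod_list_diag_prod D1 by (auto simp: lessThan_atLeast0 e2 intro!: prod.cong)
  also have "\<dots> = (-1) ^ n * (\<Prod>i<n. z i)" by (simp add: prod_uminus)
  finally have det1: "Determinant.det (mat_delete A 0 n) = (-1) ^ n * (\<Prod>i<n. z i)" .
  have "Determinant.det A = (\<Sum>j<h. A $$ (0, j) * cofactor A 0 j)"
    by (rule laplace_expansion_row[OF A]) (simp add: n)
  also have "\<dots> = (\<Sum>j\<in>{0, n}. A $$ (0, j) * cofactor A 0 j)"
    by (rule sum.mono_neutral_right) (use n in \<open>auto simp: e3\<close>)
  also have "\<dots> = d 0 * cofactor A 0 0 - z n * cofactor A 0 n"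
    using n(2) e3[of 0] e3[of n] by (simp add: n(1))
  also have "\<dots> = d 0 * (\<Prod>i<n. d (Suc i)) - z n * (\<Prod>i<n. z i)"
    by (simp add: cofactor_def det0 det1 power_mult_distrib[symmetric] mult.assoc[symmetric])
  also have "\<dots> = (\<Prod>i<h. d i) - (\<Prod>i<h. z i)"
    by (simp only: n(1) prod.lessThan_Suc_shift[of d] prod.lessThan_Suc[of z]) (simp add: mult.commute)
  finally show ?thesis .
qed

lemma offset_Suc: "offset h (Suc l) = offset h l + h l"
  by (simp add: offset_def)

lemma offset_mono: "l \<le> l' \<Longrightarrow> offset h l \<le> offset h l'"
  unfolding offset_def by (rule sum_mono2) auto

lemma offset_block: "l < L \<Longrightarrow> i < h l \<Longrightarrow> offset h l + i < offset h L"
  using offset_mono[of "Suc l" L h] by (simp add: offset_Suc)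

section \<open>Block structure and convergence of the network matrices\<close>

definition cycle_block :: "(nat \<Rightarrow> real) \<Rightarrow> (nat \<Rightarrow> real) \<Rightarrow> (nat \<Rightarrow> nat) \<Rightarrow> complex \<Rightarrow> nat \<Rightarrow> complex mat" where
  "cycle_block \<tau> \<zeta> h p l = T_mat \<tau> h l p - cyclic_perm_mat (h l) * Z_mat \<zeta> h l"

lemma cycle_block_eq:
  "cycle_block \<tau> \<zeta> h p l = Matrix.mat (h l) (h l) (\<lambda>(i, j).
     (if i = j then exp (p * of_real (\<tau> (offset h l + i))) else 0)
     - (if i = Suc j mod h l then of_real (exp (- \<zeta> (offset h l + j))) else 0))"
proof -
  have "cyclic_perm_mat (h l) * Z_mat \<zeta> h l = Matrix.mat (h l) (h l) (\<lambda>(i, j). cyclic_perm_mat (h l) $$ (i, j) * of_real (exp (- \<zeta> (offset h l + j))))"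
    unfolding Z_mat_def by (rule mat_diag_mult_right) (simp add: cyclic_perm_mat_def)
  then show ?thesis unfolding cycle_block_def T_mat_def mat_diag_def
    by (intro eq_matI) (auto simp: cyclic_perm_mat_def)
qed

lemma Hnet_Suc:
  "Hnet \<tau> \<zeta> (Suc L) h p = (let A = Hnet \<tau> \<zeta> L h p; B = cycle_block \<tau> \<zeta> h p L
    in four_block_mat A (0\<^sub>m (dim_row A) (dim_col B)) (0\<^sub>m (dim_row B) (dim_col A)) B)"
  by (simp add: Hnet_def cycle_block_def diag_block_mat_last Let_def)

lemma cycle_block_dim [simp]:
  "dim_row (cycle_block \<tau> \<zeta> h p l) = h l" "dim_col (cycle_block \<tau> \<zeta> h p l) = h l"
  by (simp_all add: cycle_block_eq)

lemma Hnet_dim [simp]: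
  "dim_row (Hnet \<tau> \<zeta> L h p) = offset h L" "dim_col (Hnet \<tau> \<zeta> L h p) = offset h L"
proof (induction L)
  case 0
  { case 1 show ?case by (simp add: Hnet_def offset_def) }
  { case 2 show ?case by (simp add: Hnet_def offset_def) }
next
  case (Suc L)
  { case 1 show ?case using Suc by (simp add: Hnet_Suc Let_def offset_Suc) }
  { case 2 show ?case using Suc by (simp add: Hnet_Suc Let_def offset_Suc) }
qed

lemma Hnet_carrier: "Hnet \<tau> \<zeta> L h p \<in> carrier_mat (offset h L) (offset h L)"
  by (rule carrier_matI) (rule Hnet_dim)+

text \<open>The parameter enters through the diagonal only, so convergence of the matrices is
  convergence of the exponentials. With \<open>q = 0\<close> they are isolated up to the constant
  1.\<close>

lemma Hnet_diff:
  assumes "r < offset h L" "c < offset h L"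
  shows "Hnet \<tau> \<zeta> L h p $$ (r, c) - Hnet \<tau> \<zeta> L h q $$ (r, c)
    = (if r = c then exp (p * of_real (\<tau> r)) - exp (q * of_real (\<tau> r)) else 0)"
  using assms
proof (induction L)
  case (Suc L)
  show ?case
  proof (cases "r < offset h L \<and> c < offset h L")
    case True
    then show ?thesis using Suc by (simp add: Hnet_Suc Let_def)
  next
    case False
    then show ?thesis using Suc.prems
      by (auto simp: Hnet_Suc Let_def offset_Suc cycle_block_eq)
  qed
qed (simp add: offset_def)

lemma Hnet_block:
  assumes "l < L" "i < h l" "j < h l"
  shows "Hnet \<tau> \<zeta> L h p $$ (offset h l + i, offset h l + j) = cycle_block \<tau> \<zeta> h p l $$ (i, j)"
  using assms
proof (induction L)
  case (Suc L)
  show ?case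
  proof (cases "l = L")
    case True
    then show ?thesis using Suc.prems by (simp add: Hnet_Suc Let_def)
  next
    case False
    then have "l < L" using Suc.prems by simp
    then show ?thesis using Suc offset_block[of l L i h] offset_block[of l L j h]
      by (simp add: Hnet_Suc Let_def)
  qed
qed simp

lemma sum_J: "(\<Sum>j\<in>J h l. f j) = (\<Sum>i<h l. f (offset h l + i))"
  unfolding J_def offset_Suc
  by (rule sum.reindex_bij_witness[where i = "\<lambda>i. offset h l + i" and j = "\<lambda>j. j - offset h l"]) auto

lemma y_vec_exp:
  "y_vec \<tau> \<zeta> h l p j = exp (p * of_real (\<Sum>t<j. \<tau> (offset h l + t)) + of_real (\<Sum>t<j. \<zeta> (offset h l + t)))"
proof (induction j)
  case (Suc j)
  have "{offset h l..<offset h l + Suc j} = insert (offset h l + j) {offset h l..<offset h l + j}" by auto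
  then have "y_vec \<tau> \<zeta> h l p (Suc j) = exp (p * of_real (\<tau> (offset h l + j)) + of_real (\<zeta> (offset h l + j))) * y_vec \<tau> \<zeta> h l p j"
    by (simp add: y_vec_def)
  then show ?case by (simp add: Suc exp_add[symmetric] algebra_simps)
qed (simp add: y_vec_def)

definition cycle_row :: "(nat \<Rightarrow> real) \<Rightarrow> (nat \<Rightarrow> real) \<Rightarrow> (nat \<Rightarrow> nat) \<Rightarrow> (nat \<Rightarrow> 'k::finite) \<Rightarrow> real ^ 'm::finite ^ 'k \<Rightarrow> nat \<Rightarrow> complex \<Rightarrow> 'm \<Rightarrow> complex" where
  "cycle_row \<tau> \<zeta> h v \<Gamma> l p c = (\<Sum>i<h l. y_vec \<tau> \<zeta> h l p i * of_real (\<Gamma> $ v (offset h l + i) $ c))"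

lemma Hnet_diagonal_tendsto:
  assumes "mat_tendsto (offset h L) (\<lambda>\<nu>. Hnet \<tau> \<zeta> L h (p \<nu>)) N" and r: "r < offset h L"
  shows "(\<lambda>\<nu>. exp (p \<nu> * of_real (\<tau> r))) \<longlonglongrightarrow> N $$ (r, r) - Hnet \<tau> \<zeta> L h 0 $$ (r, r) + 1"
proof -
  have "(\<lambda>\<nu>. Hnet \<tau> \<zeta> L h (p \<nu>) $$ (r, r) - Hnet \<tau> \<zeta> L h 0 $$ (r, r) + 1) \<longlonglongrightarrow> N $$ (r, r) - Hnet \<tau> \<zeta> L h 0 $$ (r, r) + 1"
    using assms by (intro tendsto_intros) (auto simp: mat_tendsto_def)
  then show ?thesis using Hnet_diff[OF r r, of \<tau> \<zeta> _ 0] by simp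
qed

lemma y_vec_tendsto:
  assumes "\<And>t. t \<in> {offset h l..<offset h l + j} \<Longrightarrow> (\<lambda>\<nu>. exp (p \<nu> * of_real (\<tau> t))) \<longlonglongrightarrow> E t"
  shows "(\<lambda>\<nu>. y_vec \<tau> \<zeta> h l (p \<nu>) j) \<longlonglongrightarrow> (\<Prod>t\<in>{offset h l..<offset h l + j}. E t * exp (of_real (\<zeta> t)))"
  unfolding y_vec_def exp_add by (intro tendsto_prod tendsto_mult assms tendsto_const)

text \<open>The limit is a polynomial in the diagonal entries of \<open>N\<close>, hence the same
  for all sequences, and the given sequence makes it unique. This evaluates the definite description
  in \<open>Y_vec\<close>.\<close>

lemma Y_vec_tendsto:
  assumes l: "l < L" "j < h l" and N: "mat_tendsto (offset h L) (\<lambda>\<nu>. Hnet \<tau> \<zeta> L h (p \<nu>)) N"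
  shows "(\<lambda>\<nu>. y_vec \<tau> \<zeta> h l (p \<nu>) j) \<longlonglongrightarrow> Y_vec \<tau> \<zeta> L h l N j"
proof -
  define c where "c = (\<Prod>t\<in>{offset h l..<offset h l + j}. (N $$ (t, t) - Hnet \<tau> \<zeta> L h 0 $$ (t, t) + 1) * exp (of_real (\<zeta> t)))"
  have c: "(\<lambda>\<nu>. y_vec \<tau> \<zeta> h l (p \<nu>) j) \<longlonglongrightarrow> c"
    if "mat_tendsto (offset h L) (\<lambda>\<nu>. Hnet \<tau> \<zeta> L h (p \<nu>)) N" for p
    unfolding c_def
  proof (rule y_vec_tendsto, rule Hnet_diagonal_tendsto[OF that])
    fix t assume "t \<in> {offset h l..<offset h l + j}"
    then show "t < offset h L" using offset_block[of l L j h] l by auto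
  qed
  have "Y_vec \<tau> \<zeta> L h l N j = c" unfolding Y_vec_def
    by (rule the_equality) (use c N in \<open>auto intro: LIMSEQ_unique\<close>)
  then show ?thesis using c[OF N] by simp
qed

lemma row_times_Gamma_tendsto:
  assumes l: "l < L" and N: "mat_tendsto (offset h L) (\<lambda>\<nu>. Hnet \<tau> \<zeta> L h (p \<nu>)) N"
  shows "(\<lambda>\<nu>. cycle_row \<tau> \<zeta> h v \<Gamma> l (p \<nu>) c) \<longlonglongrightarrow> row_times_Gamma (offset h L) v (Y_tilde \<tau> \<zeta> L h l N) \<Gamma> $ c"
proof -
  have J: "J h l \<subseteq> {..<offset h L}" using offset_mono[of "Suc l" L h] l by (auto simp: J_def)
  have "row_times_Gamma (offset h L) v (Y_tilde \<tau> \<zeta> L h l N) \<Gamma> $ c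
    = (\<Sum>j<offset h L. Y_tilde \<tau> \<zeta> L h l N j * of_real (\<Gamma> $ v j $ c))"
    by (simp add: row_times_Gamma_def)
  also have "\<dots> = (\<Sum>j\<in>J h l. Y_tilde \<tau> \<zeta> L h l N j * of_real (\<Gamma> $ v j $ c))"
    by (rule sum.mono_neutral_right) (use J in \<open>auto simp: Y_tilde_def\<close>)
  also have "\<dots> = (\<Sum>i<h l. Y_vec \<tau> \<zeta> L h l N i * of_real (\<Gamma> $ v (offset h l + i) $ c))"
    unfolding sum_J by (rule sum.cong) (auto simp: Y_tilde_def J_def offset_Suc)
  finally have eq: "row_times_Gamma (offset h L) v (Y_tilde \<tau> \<zeta> L h l N) \<Gamma> $ c = \<dots>" .
  show ?thesis unfolding eq cycle_row_def
    by (intro tendsto_sum tendsto_mult Y_vec_tendsto[OF l _ N] tendsto_const) auto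
qed

text \<open>By \<open>det_cyclic\<close> the determinant of a block is exp (p * W) minus the gain of
  the cycle, \<open>W\<close> being its total delay. Singularity in the limit thus says that these
  exponentials tend to the gain.\<close>

lemma det_block_tendsto:
  assumes l: "l < L" "1 \<le> h l" and N: "mat_tendsto (offset h L) (\<lambda>\<nu>. Hnet \<tau> \<zeta> L h (p \<nu>)) N"
  shows "(\<lambda>\<nu>. exp (p \<nu> * of_real (\<Sum>j\<in>J h l. \<tau> j)) - of_real (exp (- (\<Sum>j\<in>J h l. \<zeta> j))))
     \<longlonglongrightarrow> Determinant.det (diagonal_block h N l)"
proof -
  define E where "E r = N $$ (r, r) - Hnet \<tau> \<zeta> L h 0 $$ (r, r) + 1" for r
  have E: "(\<lambda>\<nu>. exp (p \<nu> * of_real (\<tau> (offset h l + i)))) \<longlonglongrightarrow> E (offset h l + i)" if "i < h l" for i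
    unfolding E_def using Hnet_diagonal_tendsto[OF N offset_block[of l L _ h, OF l(1) that]] .
  let ?z = "\<lambda>j. of_real (exp (- \<zeta> (offset h l + j)))"
  have "N $$ (offset h l + i, offset h l + j) = (if i = j then E (offset h l + i) else 0) - (if i = Suc j mod h l then ?z j else 0)"
    if ij: "i < h l" "j < h l" for i j
  proof -
    have "(\<lambda>\<nu>. Hnet \<tau> \<zeta> L h (p \<nu>) $$ (offset h l + i, offset h l + j)) \<longlonglongrightarrow> N $$ (offset h l + i, offset h l + j)"
      using N offset_block[of l L _ h, OF l(1) ij(1)] offset_block[of l L _ h, OF l(1) ij(2)] by (simp add: mat_tendsto_def)
    moreover have "Hnet \<tau> \<zeta> L h (p \<nu>) $$ (offset h l + i, offset h l + j) =
      (if i = j then exp (p \<nu> * of_real (\<tau> (offset h l + i))) else 0) - (if i = Suc j mod h l then ?z j else 0)" for \<nu>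
      unfolding Hnet_block[where h = h and l = l and L = L, OF l(1) ij] cycle_block_eq using ij by simp
    moreover have "(\<lambda>\<nu>. (if i = j then exp (p \<nu> * of_real (\<tau> (offset h l + i))) else 0) - (if i = Suc j mod h l then ?z j else 0)) \<longlonglongrightarrow>
       (if i = j then E (offset h l + i) else 0) - (if i = Suc j mod h l then ?z j else 0)"
      using E[OF ij(1)] E[OF ij(2)] by (intro tendsto_diff tendsto_const) simp
    ultimately show ?thesis by (simp only: LIMSEQ_unique)
  qed
  then have "diagonal_block h N l = Matrix.mat (h l) (h l) (\<lambda>(i, j). (if i = j then E (offset h l + i) else 0) - (if i = Suc j mod h l then ?z j else 0))"
    unfolding diagonal_block_def by (intro eq_matI) simp_all
  then have "Determinant.det (diagonal_block h N l) = (\<Prod>i<h l. E (offset h l + i)) - (\<Prod>i<h l. ?z i)"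
    by (simp only: det_cyclic[OF l(2)])
  also have "(\<Prod>i<h l. ?z i) = of_real (exp (- (\<Sum>j\<in>J h l. \<zeta> j)))"
    by (simp add: sum_J exp_sum[symmetric] sum_negf flip: of_real_prod)
  finally have d: "Determinant.det (diagonal_block h N l) = (\<Prod>i<h l. E (offset h l + i)) - of_real (exp (- (\<Sum>j\<in>J h l. \<zeta> j)))" .
  have "exp (p \<nu> * of_real (\<Sum>j\<in>J h l. \<tau> j)) = (\<Prod>i<h l. exp (p \<nu> * of_real (\<tau> (offset h l + i))))" for \<nu>
    by (simp add: sum_J exp_sum[symmetric] sum_distrib_left)
  then show ?thesis unfolding d by (simp only:) (intro tendsto_intros E, simp)
qed

section \<open>Singular blocks and the critical frequencies\<close>

lemma common_convergent_subsequence: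
  fixes f :: "nat \<Rightarrow> nat \<Rightarrow> complex"
  assumes "\<And>j. j < n \<Longrightarrow> bounded (range (f j))"
  shows "\<exists>r. strict_mono (r :: nat \<Rightarrow> nat) \<and> (\<forall>j<n. convergent (\<lambda>\<nu>. f j (r \<nu>)))"
  using assms
proof (induction n)
  case 0
  show ?case by (intro exI[of _ id]) (simp add: strict_mono_def)
next
  case (Suc n)
  then obtain r where r: "strict_mono r" "\<forall>j<n. convergent (\<lambda>\<nu>. f j (r \<nu>))" by auto
  have "bounded (range (f n \<circ> r))" by (rule bounded_subset[OF Suc.prems[of n]]) auto
  then obtain x s where s: "strict_mono s" "((f n \<circ> r) \<circ> s) \<longlonglongrightarrow> x"
    using bounded_imp_convergent_subsequence by blast
  have "convergent (\<lambda>\<nu>. f j (r (s \<nu>)))" if "j < Suc n" for j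
  proof (cases "j = n")
    case True
    then show ?thesis using s(2) by (auto simp: convergent_def o_def)
  next
    case False
    with that r(2) have "convergent (\<lambda>\<nu>. f j (r \<nu>))" by simp
    from convergent_subseq_convergent[OF this s(1)] show ?thesis by (simp add: o_def)
  qed
  then show ?case using strict_mono_o[OF r(1) s(1)] by (intro exI[of _ "\<lambda>\<nu>. r (s \<nu>)"]) (simp add: o_def)
qed

lemma y_vec_vertical:
  "y_vec \<tau> \<zeta> h l (of_real \<sigma> + \<i> * of_real \<theta>) i = exp ((\<Sum>t<i. \<zeta> (offset h l + t)) + \<sigma> * (\<Sum>t<i. \<tau> (offset h l + t))) *\<^sub>R cis (\<theta> * (\<Sum>t<i. \<tau> (offset h l + t)))"
  unfolding y_vec_exp cis_conv_exp scaleR_conv_of_real exp_of_real[symmetric] exp_add[symmetric]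
  by (rule arg_cong[where f = exp]) (simp add: algebra_simps)

lemma cycle_row_vertical_cnj:
  "cycle_row \<tau> \<zeta> h v \<Gamma> l (of_real \<sigma> + \<i> * of_real (- \<theta>)) c = cnj (cycle_row \<tau> \<zeta> h v \<Gamma> l (of_real \<sigma> + \<i> * of_real \<theta>) c)"
  unfolding cycle_row_def y_vec_vertical by (simp add: cis_cnj)

text \<open>The exponentials of (p \<nu> - \<sigma>) * W tend to 1, so their principal logarithms
  tend to 0. The difference between the exponent and its logarithm is a multiple of 2 * pi * \<i>
  and determines \<open>k \<nu>\<close>.\<close>

lemma vertical_line_approximation:
  assumes W: "W > 0" and lim: "(\<lambda>\<nu>. exp (p \<nu> * of_real W)) \<longlonglongrightarrow> of_real (exp (\<sigma> * W))"
  shows "\<exists>k :: nat \<Rightarrow> int. (\<lambda>\<nu>. p \<nu> - (of_real \<sigma> + \<i> * of_real (2 * pi * of_int (k \<nu>) / W))) \<longlonglongrightarrow> 0"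
proof -
  define w where "w \<nu> = (p \<nu> - of_real \<sigma>) * of_real W" for \<nu>
  have "exp (w \<nu>) = exp (p \<nu> * of_real W) / of_real (exp (\<sigma> * W))" for \<nu>
    by (simp add: w_def left_diff_distrib exp_diff exp_of_real[symmetric])
  moreover have "(\<lambda>\<nu>. exp (p \<nu> * of_real W) / of_real (exp (\<sigma> * W))) \<longlonglongrightarrow> of_real (exp (\<sigma> * W)) / of_real (exp (\<sigma> * W))"
    by (intro tendsto_divide lim tendsto_const) simp
  ultimately have "(\<lambda>\<nu>. exp (w \<nu>)) \<longlonglongrightarrow> 1" by simp
  then have Ln: "(\<lambda>\<nu>. Ln (exp (w \<nu>))) \<longlonglongrightarrow> 0"
    using tendsto_Ln[of "\<lambda>\<nu>. exp (w \<nu>)" 1 sequentially] by simp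
  have "\<exists>n::int. w \<nu> = Ln (exp (w \<nu>)) + of_real (2 * of_int n * pi) * \<i>" for \<nu>
    using exp_eq[of "w \<nu>" "Ln (exp (w \<nu>))"] by simp
  then obtain k :: "nat \<Rightarrow> int" where k: "\<And>\<nu>. w \<nu> = Ln (exp (w \<nu>)) + of_real (2 * of_int (k \<nu>) * pi) * \<i>" by metis
  have "p \<nu> - (of_real \<sigma> + \<i> * of_real (2 * pi * of_int (k \<nu>) / W)) = Ln (exp (w \<nu>)) / of_real W" for \<nu>
  proof -
    have "Ln (exp (w \<nu>)) = (p \<nu> - of_real \<sigma>) * of_real W - of_real (2 * of_int (k \<nu>) * pi) * \<i>"
      using k[of \<nu>] unfolding w_def[of \<nu>] by (simp add: algebra_simps)
    then show ?thesis using W by (simp add: field_simps)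
  qed
  moreover have "(\<lambda>\<nu>. Ln (exp (w \<nu>)) / of_real W) \<longlonglongrightarrow> 0 / of_real W"
    by (intro tendsto_divide Ln tendsto_const) (use W in simp)
  ultimately show ?thesis by (intro exI[of _ k]) simp
qed

text \<open>The sum of squares is continuous along convergent matrices. If its infimum over the
  critical frequencies is 0, a subsequence along which it tends to 0 and all exponentials converge
  yields a matrix with singular block and zero row. Conversely, a singular block forces its sequence
  towards critical frequencies, where the sum is at least \<delta>.\<close>

theorem closure_criterion:
  fixes \<Gamma> :: "real ^ 'm::finite ^ 'k::finite" and v :: "nat \<Rightarrow> 'k" and \<tau> \<zeta> :: "nat \<Rightarrow> real"
  assumes h: "1 \<le> h l" and l: "l < L" and \<tau>: "\<And>j. j < offset h L \<Longrightarrow> \<tau> j > 0"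
  defines "W \<equiv> \<Sum>j\<in>J h l. \<tau> j"
  defines "\<sigma> \<equiv> - (\<Sum>j\<in>J h l. \<zeta> j) / W"
  shows "(\<forall>N\<in>mat_closure (offset h L) (range (Hnet \<tau> \<zeta> L h)). Determinant.det (diagonal_block h N l) = 0 \<longrightarrow>
      row_times_Gamma (offset h L) v (Y_tilde \<tau> \<zeta> L h l N) \<Gamma> \<noteq> 0) \<longleftrightarrow>
    (\<exists>\<delta>>0. \<forall>k::nat. \<delta> \<le> (\<Sum>c\<in>UNIV. (cmod (cycle_row \<tau> \<zeta> h v \<Gamma> l (of_real \<sigma> + \<i> * of_real (2 * pi * of_nat k / W)) c))\<^sup>2))"
    (is "?closure \<longleftrightarrow> ?lower")
proof -
  define n where "n = offset h L"
  define Q where "Q p = (\<Sum>c\<in>UNIV. (cmod (cycle_row \<tau> \<zeta> h v \<Gamma> l p c))\<^sup>2)" for p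
  define pt where "pt k = of_real \<sigma> + \<i> * of_real (2 * pi * of_int k / W)" for k :: int
  have "0 \<in> {..<h l}" using h by simp
  then have ne: "{..<h l} \<noteq> {}" by (rule ex_in_conv[THEN iffD1, OF exI])
  have W: "W > 0" unfolding W_def sum_J
    using offset_block[of l L _ h, OF l] \<tau> by (intro sum_pos ne) auto
  have \<sigma>W: "\<sigma> * W = - (\<Sum>j\<in>J h l. \<zeta> j)" using W by (simp add: \<sigma>_def)
  have Q_tendsto: "(\<lambda>\<nu>. Q (p \<nu>)) \<longlonglongrightarrow> (\<Sum>c\<in>UNIV. (cmod (row_times_Gamma n v (Y_tilde \<tau> \<zeta> L h l N) \<Gamma> $ c))\<^sup>2)"
    if "mat_tendsto n (\<lambda>\<nu>. Hnet \<tau> \<zeta> L h (p \<nu>)) N" for p N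
    unfolding Q_def using row_times_Gamma_tendsto[OF l that[unfolded n_def]] unfolding n_def
    by (intro tendsto_sum tendsto_power tendsto_norm) auto
  have exp_pt: "exp (pt k * of_real W) = of_real (exp (\<sigma> * W))" for k
  proof -
    have "pt k * of_real W = of_real (\<sigma> * W) + \<i> * of_real (2 * pi * of_int k)"
      using W by (simp add: pt_def distrib_right)
    then have "exp (pt k * of_real W) = exp (of_real (\<sigma> * W)) * exp (\<i> * of_real (2 * pi * of_int k))"
      by (simp only: exp_add)
    moreover have "exp (\<i> * of_real (2 * pi * of_int k)) = 1"
      unfolding cis_conv_exp[symmetric] by (rule cis_multiple_2pi) simp
    ultimately show ?thesis by (simp only: exp_of_real mult_1_right)
  qed
  have Q_neg: "Q (pt (- k)) = Q (pt k)" for k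
    using cycle_row_vertical_cnj[of \<tau> \<zeta> h v \<Gamma> l \<sigma> "2 * pi * of_int k / W"] unfolding Q_def pt_def by simp
  show ?thesis
  proof
    assume closure: ?closure
    show ?lower
    proof (rule ccontr)
      assume neg: "\<not> ?lower"
      have "\<exists>k::nat. Q (pt (int k)) < inverse (of_nat (Suc \<nu>))" for \<nu>
      proof (rule ccontr)
        assume "\<nexists>k::nat. Q (pt (int k)) < inverse (of_nat (Suc \<nu>))"
        then have "\<forall>k::nat. inverse (of_nat (Suc \<nu>)) \<le> Q (pt (int k))" by (simp add: not_less)
        then have ?lower unfolding Q_def pt_def of_int_of_nat_eq
          by (intro exI[of _ "inverse (of_nat (Suc \<nu>))"]) simp
        with neg show False ..
      qed
      then have "\<forall>\<nu>. \<exists>k::nat. Q (pt (int k)) < inverse (of_nat (Suc \<nu>))" by (rule allI)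
      from choice[OF this] obtain k where k: "\<forall>\<nu>. Q (pt (int (k \<nu>))) < inverse (of_nat (Suc \<nu>))" ..
      \<comment> \<open>On the line Re p = \<sigma> each exponential has constant modulus; this is
        the source of compactness.\<close>
      have "bounded (range (\<lambda>\<nu>. exp (pt (int (k \<nu>)) * of_real (\<tau> j))))" for j
        unfolding bounded_iff by (intro exI[of _ "exp (\<sigma> * \<tau> j)"]) (simp add: pt_def)
      then obtain r where r: "strict_mono (r :: nat \<Rightarrow> nat)" "\<forall>j<n. convergent (\<lambda>\<nu>. exp (pt (int (k (r \<nu>))) * of_real (\<tau> j)))"
        using common_convergent_subsequence[of n "\<lambda>j \<nu>. exp (pt (int (k \<nu>)) * of_real (\<tau> j))"] by auto
      define p where "p \<nu> = pt (int (k (r \<nu>)))" for \<nu>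
      \<comment> \<open>For a loop the diagonal also contains a constant term. Writing the limit
        relative to the matrix at p = 0, where the exponentials are 1, accounts for it.\<close>
      define N where "N = Matrix.mat n n (\<lambda>(i, j). Hnet \<tau> \<zeta> L h 0 $$ (i, j) + (if i = j then lim (\<lambda>\<nu>. exp (p \<nu> * of_real (\<tau> i))) - 1 else 0))"
      have N: "mat_tendsto n (\<lambda>\<nu>. Hnet \<tau> \<zeta> L h (p \<nu>)) N"
        unfolding mat_tendsto_def
      proof (intro conjI allI impI)
        fix i j assume ij: "i < n" "j < n"
        have "Hnet \<tau> \<zeta> L h (p \<nu>) $$ (i, j) = Hnet \<tau> \<zeta> L h 0 $$ (i, j) + (if i = j then exp (p \<nu> * of_real (\<tau> i)) - 1 else 0)" for \<nu>
          using Hnet_diff[of i h L j \<tau> \<zeta> "p \<nu>" 0] ij unfolding n_def by (simp add: algebra_simps)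
        moreover have "(\<lambda>\<nu>. exp (p \<nu> * of_real (\<tau> i))) \<longlonglongrightarrow> lim (\<lambda>\<nu>. exp (p \<nu> * of_real (\<tau> i)))"
          using r(2) ij(1) unfolding p_def by (simp add: convergent_LIMSEQ_iff)
        ultimately show "(\<lambda>\<nu>. Hnet \<tau> \<zeta> L h (p \<nu>) $$ (i, j)) \<longlonglongrightarrow> N $$ (i, j)"
          using ij by (cases "i = j") (simp_all add: N_def, intro tendsto_intros)
      qed (simp_all add: N_def Hnet_carrier n_def)
      have Ncl: "N \<in> mat_closure n (range (Hnet \<tau> \<zeta> L h))" unfolding mat_closure_def
        by (intro CollectI exI[of _ "\<lambda>\<nu>. Hnet \<tau> \<zeta> L h (p \<nu>)"] conjI allI rangeI N)
      have "Determinant.det (diagonal_block h N l) = 0"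
      proof -
        have "(\<lambda>\<nu>. exp (p \<nu> * of_real W) - of_real (exp (- (\<Sum>j\<in>J h l. \<zeta> j)))) \<longlonglongrightarrow> Determinant.det (diagonal_block h N l)"
          unfolding W_def by (rule det_block_tendsto[OF l h N[unfolded n_def]])
        then have "(\<lambda>\<nu>. 0) \<longlonglongrightarrow> Determinant.det (diagonal_block h N l)"
          by (simp add: p_def exp_pt \<sigma>W)
        then show ?thesis by (simp add: LIMSEQ_const_iff)
      qed
      with bspec[OF closure Ncl[unfolded n_def]]
      have "row_times_Gamma n v (Y_tilde \<tau> \<zeta> L h l N) \<Gamma> \<noteq> 0" unfolding n_def by (rule mp)
      moreover have "(\<lambda>\<nu>. Q (p \<nu>)) \<longlonglongrightarrow> 0"
      proof (rule tendsto_sandwich[OF _ _ tendsto_const])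
        show "\<forall>\<^sub>F \<nu> in sequentially. 0 \<le> Q (p \<nu>)" by (simp add: Q_def sum_nonneg)
        show "\<forall>\<^sub>F \<nu> in sequentially. Q (p \<nu>) \<le> inverse (of_nat (Suc (r \<nu>)))"
          using k by (simp add: p_def less_imp_le)
        show "(\<lambda>\<nu>. inverse (of_nat (Suc (r \<nu>)))) \<longlonglongrightarrow> (0::real)"
          using LIMSEQ_subseq_LIMSEQ[OF LIMSEQ_inverse_real_of_nat r(1)] by (simp add: o_def)
      qed
      then have "(\<Sum>c\<in>UNIV. (cmod (row_times_Gamma n v (Y_tilde \<tau> \<zeta> L h l N) \<Gamma> $ c))\<^sup>2) = 0"
        using LIMSEQ_unique[OF Q_tendsto[OF N]] by simp
      then have "row_times_Gamma n v (Y_tilde \<tau> \<zeta> L h l N) \<Gamma> = 0"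
        by (simp add: sum_nonneg_eq_0_iff Finite_Cartesian_Product.vec_eq_iff)
      ultimately show False by simp
    qed
  next
    assume ?lower
    then obtain \<delta> where \<delta>: "\<delta> > 0" "\<And>k::nat. \<delta> \<le> Q (pt (int k))" unfolding Q_def pt_def by auto
    have \<delta>': "\<delta> \<le> Q (pt k)" for k
    proof (cases "0 \<le> k")
      case True
      then show ?thesis using \<delta>(2)[of "nat k"] by simp
    next
      case False
      then show ?thesis using \<delta>(2)[of "nat (- k)"] Q_neg[of k] by simp
    qed
    show ?closure
    proof (intro ballI impI notI)
      fix N assume "N \<in> mat_closure (offset h L) (range (Hnet \<tau> \<zeta> L h))" and det: "Determinant.det (diagonal_block h N l) = 0"
        and zero: "row_times_Gamma (offset h L) v (Y_tilde \<tau> \<zeta> L h l N) \<Gamma> = 0"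
      then obtain X where X: "\<forall>\<nu>. X \<nu> \<in> range (Hnet \<tau> \<zeta> L h)" "mat_tendsto n X N"
        unfolding mat_closure_def n_def by auto
      from X(1) have "\<forall>\<nu>. \<exists>p. X \<nu> = Hnet \<tau> \<zeta> L h p" by (simp add: image_iff)
      from choice[OF this] obtain p where "\<forall>\<nu>. X \<nu> = Hnet \<tau> \<zeta> L h (p \<nu>)" ..
      then have "X = (\<lambda>\<nu>. Hnet \<tau> \<zeta> L h (p \<nu>))" by (simp add: fun_eq_iff)
      with X(2) have N: "mat_tendsto n (\<lambda>\<nu>. Hnet \<tau> \<zeta> L h (p \<nu>)) N" by simp
      have "(\<lambda>\<nu>. exp (p \<nu> * of_real W) - of_real (exp (\<sigma> * W))) \<longlonglongrightarrow> 0"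
        using det_block_tendsto[OF l h N[unfolded n_def]] unfolding det W_def[symmetric] \<sigma>W[symmetric] .
      then have "(\<lambda>\<nu>. exp (p \<nu> * of_real W)) \<longlonglongrightarrow> of_real (exp (\<sigma> * W))" by (rule LIM_zero_cancel)
      from vertical_line_approximation[OF W this] obtain k where k: "(\<lambda>\<nu>. p \<nu> - pt (k \<nu>)) \<longlonglongrightarrow> 0"
        unfolding pt_def ..
      have "mat_tendsto n (\<lambda>\<nu>. Hnet \<tau> \<zeta> L h (pt (k \<nu>))) N"
        unfolding mat_tendsto_def
      proof (intro conjI allI impI)
        show "N \<in> carrier_mat n n" using N by (simp add: mat_tendsto_def)
        show "Hnet \<tau> \<zeta> L h (pt (k \<nu>)) \<in> carrier_mat n n" for \<nu> by (simp add: Hnet_carrier n_def)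
        fix i j assume ij: "i < n" "j < n"
        have N': "(\<lambda>\<nu>. Hnet \<tau> \<zeta> L h (p \<nu>) $$ (i, j)) \<longlonglongrightarrow> N $$ (i, j)" using N ij by (simp add: mat_tendsto_def)
        \<comment> \<open>The sequence \<open>p\<close> may be unbounded, but its exponentials
          converge; factoring them out leaves a difference that tends to 0 because p \<nu> - pt (k
          \<nu>) does.\<close>
        have "(\<lambda>\<nu>. exp (p \<nu> * of_real (\<tau> i)) * (exp (- (p \<nu> - pt (k \<nu>)) * of_real (\<tau> i)) - 1))
          \<longlonglongrightarrow> (N $$ (i, i) - Hnet \<tau> \<zeta> L h 0 $$ (i, i) + 1) * (exp (- 0 * of_real (\<tau> i)) - 1)"
          using Hnet_diagonal_tendsto[OF N[unfolded n_def]] ij unfolding n_def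
          by (intro tendsto_intros k) auto
        moreover have "exp (p \<nu> * of_real (\<tau> i)) * (exp (- (p \<nu> - pt (k \<nu>)) * of_real (\<tau> i)) - 1) = exp (pt (k \<nu>) * of_real (\<tau> i)) - exp (p \<nu> * of_real (\<tau> i))" for \<nu>
          by (simp add: right_diff_distrib exp_add[symmetric] algebra_simps)
        ultimately have "(\<lambda>\<nu>. exp (pt (k \<nu>) * of_real (\<tau> i)) - exp (p \<nu> * of_real (\<tau> i))) \<longlonglongrightarrow> 0" by simp
        then have "(\<lambda>\<nu>. Hnet \<tau> \<zeta> L h (p \<nu>) $$ (i, j) + (if i = j then exp (pt (k \<nu>) * of_real (\<tau> i)) - exp (p \<nu> * of_real (\<tau> i)) else 0)) \<longlonglongrightarrow> N $$ (i, j) + 0"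
          by (intro tendsto_add N') (cases "i = j", simp_all)
        moreover have "Hnet \<tau> \<zeta> L h (pt (k \<nu>)) $$ (i, j) = Hnet \<tau> \<zeta> L h (p \<nu>) $$ (i, j) + (if i = j then exp (pt (k \<nu>) * of_real (\<tau> i)) - exp (p \<nu> * of_real (\<tau> i)) else 0)" for \<nu>
          using Hnet_diff[of i h L j \<tau> \<zeta> "pt (k \<nu>)" "p \<nu>"] ij unfolding n_def by (simp add: algebra_simps)
        ultimately show "(\<lambda>\<nu>. Hnet \<tau> \<zeta> L h (pt (k \<nu>)) $$ (i, j)) \<longlonglongrightarrow> N $$ (i, j)" by simp
      qed
      from Q_tendsto[OF this] have "(\<lambda>\<nu>. Q (pt (k \<nu>))) \<longlonglongrightarrow> 0" using zero by (simp add: n_def)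
      then have "\<delta> \<le> 0" by (rule LIMSEQ_le_const) (use \<delta>' in auto)
      with \<delta>(1) show False by simp
    qed
  qed
qed

section \<open>The network as a system of delay equations\<close>

lemma AE_lborel_reflect:
  fixes P :: "real \<Rightarrow> bool"
  assumes "AE s in lborel. P s" shows "AE s in lborel. P (c - s)"
proof -
  obtain N where N: "{x \<in> space lborel. \<not> P x} \<subseteq> N" "emeasure lborel N = 0" "N \<in> sets lborel"
    using assms by (rule AE_E)
  then have [measurable]: "N \<in> sets borel" by simp
  have "(\<integral>\<^sup>+ s. indicator N (c - s) \<partial>lborel) = (0 :: ennreal)"
    using N nn_integral_real_affine[of "indicator N" "-1" c] by simp
  then have "AE s in lborel. indicator N (c - s) = (0 :: ennreal)"
    by (subst (asm) nn_integral_0_iff_AE) auto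
  then show ?thesis
    by (rule AE_mp) (use N(1) in \<open>auto intro!: AE_I2 simp: indicator_def\<close>)
qed

lemma locint_reflect:
  assumes "locint f" shows "locint (\<lambda>s. f (c - s))"
proof -
  have "set_integrable lborel {a..b} (\<lambda>s. f (c - s))" for a b
  proof -
    have "integrable lborel (\<lambda>x. indicat_real {c - b..c - a} x *\<^sub>R f x)"
      using assms by (simp add: locint_def set_integrable_def)
    from lborel_integrable_real_affine[OF this, of "-1" c]
    have "integrable lborel (\<lambda>x. indicat_real {c - b..c - a} (c - x) *\<^sub>R f (c - x))" by simp
    moreover have "indicat_real {c - b..c - a} (c - x) = indicat_real {a..b} x" for x
      by (auto simp: indicator_def)
    ultimately show ?thesis by (simp add: set_integrable_def)
  qed
  moreover have "(\<lambda>s. f (c - s)) \<in> borel_measurable borel"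
    using locint_measurable[OF assms] by measurable
  ultimately show ?thesis by (simp add: locint_def)
qed

text \<open>Completion supplies a Borel function equal almost everywhere; dropping the right
  endpoint makes its support half-open.\<close>

lemma lebesgue_integrable_representative:
  fixes f :: "real \<Rightarrow> real"
  assumes f: "set_integrable lebesgue {p..q} f"
  shows "\<exists>F. locint F \<and> supported p q F \<and> (AE t in lborel. t \<in> {p..q} \<longrightarrow> f t = F t)"
proof -
  have fi: "integrable lebesgue (\<lambda>x. indicat_real {p..q} x *\<^sub>R f x)" using f by (simp add: set_integrable_def)
  then obtain f' where f': "f' \<in> borel_measurable lborel" and ae: "AE x in lborel. indicat_real {p..q} x *\<^sub>R f x = f' x"
    using completion_ex_borel_measurable_real[OF borel_measurable_integrable] by blast
  have [measurable]: "f' \<in> borel_measurable borel" using f' by simp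
  define F where "F x = indicator {p..<q} x * f' x" for x
  have "integrable lebesgue f'"
  proof (rule integrable_cong_AE_imp[OF fi])
    show "f' \<in> borel_measurable lebesgue" using f' by (rule measurable_completion)
    show "AE x in lebesgue. indicat_real {p..q} x *\<^sub>R f x = f' x" using ae by (simp only: AE_completion_iff)
  qed
  then have "integrable lborel f'" using f' by (simp add: integrable_completion)
  then have "integrable lborel (\<lambda>x. indicat_real {a..b} x *\<^sub>R F x)" for a b
    by (rule Bochner_Integration.integrable_bound) (auto simp: F_def indicator_def)
  moreover have "F \<in> borel_measurable borel" unfolding F_def[abs_def] by measurable
  ultimately have "locint F" by (simp add: locint_def set_integrable_def)
  moreover have "supported p q F" by (auto simp: supported_def F_def)
  moreover have "AE t in lborel. t \<in> {p..q} \<longrightarrow> f t = F t"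
    using ae AE_lborel_singleton[of q] by eventually_elim (auto simp: F_def indicator_def split: if_splits)
  ultimately show ?thesis by blast
qed

section \<open>Edges and vertices of disjoint cycles\<close>

lemma offset_decompose: "j < offset h L \<Longrightarrow> \<exists>l<L. \<exists>i<h l. j = offset h l + i"
proof (induction L)
  case (Suc L)
  show ?case
  proof (cases "j < offset h L")
    case True
    then show ?thesis using Suc.IH less_SucI by blast
  next
    case False
    then show ?thesis using Suc.prems by (intro exI[of _ L] conjI exI[of _ "j - offset h L"]) (auto simp: offset_Suc)
  qed
qed (simp add: offset_def)

lemma offset_unique:
  assumes "offset h l + i = offset h l' + i'" "i < h l" "i' < h l'"
  shows "l = l'" "i = i'"
proof -
  have "\<not> l < l'" using offset_mono[of "Suc l" l' h] assms by (auto simp: offset_Suc)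
  moreover have "\<not> l' < l" using offset_mono[of "Suc l'" l h] assms by (auto simp: offset_Suc)
  ultimately show "l = l'" by simp
  with assms show "i = i'" by simp
qed

lemma sum_offset: "(\<Sum>j<offset h L. f j) = (\<Sum>l<L. \<Sum>i<h l. f (offset h l + i))"
proof (induction L)
  case (Suc L)
  have "(\<Sum>j<offset h (Suc L). f j) = (\<Sum>j<offset h L. f j) + (\<Sum>j\<in>J h L. f j)"
    unfolding J_def by (subst sum.union_disjoint[symmetric]) (auto simp: offset_Suc ivl_disj_un intro!: sum.cong)
  then show ?case by (simp add: Suc sum_J)
qed (simp add: offset_def)

lemma disjoint_cycles_edge:
  assumes "disjoint_cycles src tgt L h \<epsilon>"
  shows "\<exists>l<L. \<exists>i<h l. e = \<epsilon> (offset h l + i)"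
proof -
  have "e \<in> \<epsilon> ` {..<offset h L}" using assms by (simp add: disjoint_cycles_def bij_betw_def)
  then obtain j where "j < offset h L" "e = \<epsilon> j" by auto
  then show ?thesis using offset_decompose[of j h L] by auto
qed

lemma disjoint_cycles_src_inj:
  assumes C: "disjoint_cycles src tgt L h \<epsilon>" and l: "l < L" "i < h l" and l': "l' < L" "i' < h l'"
    and eq: "src (\<epsilon> (offset h l + i)) = src (\<epsilon> (offset h l' + i'))"
  shows "l = l' \<and> i = i'"
proof -
  have "inj_on (\<lambda>j. src (\<epsilon> j)) {..<offset h L}" using C by (simp add: disjoint_cycles_def bij_betw_def)
  from inj_onD[OF this eq] offset_block[of l L i h, OF l] offset_block[of l' L i' h, OF l']
  have "offset h l + i = offset h l' + i'" by simp
  from offset_unique[OF this l(2) l'(2)] show ?thesis by simp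
qed

lemma disjoint_cycles_tgt:
  assumes C: "disjoint_cycles src tgt L h \<epsilon>" and l: "l < L" "i < h l"
  shows "tgt (\<epsilon> (offset h l + cycle_prev (h l) i)) = src (\<epsilon> (offset h l + i))"
proof -
  let ?j = "offset h l + cycle_prev (h l) i"
  have J: "J h l = {offset h l..<offset h l + h l}" by (simp add: J_def offset_Suc)
  have "Max (J h l) = offset h l + h l - 1" unfolding J
    by (rule Max_eqI) (use l in auto)
  moreover have "Min (J h l) = offset h l" unfolding J
    by (rule Min_eqI) (use l in auto)
  moreover have "?j \<in> J h l" using l by (auto simp: J cycle_prev_def)
  ultimately have "tgt (\<epsilon> ?j) = (if ?j = offset h l + h l - 1 then src (\<epsilon> (offset h l)) else src (\<epsilon> (Suc ?j)))"
    using C l unfolding disjoint_cycles_def by auto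
  then show ?thesis using l by (cases i) (auto simp: cycle_prev_def)
qed

lemma disjoint_cycles_tgt_inj:
  assumes C: "disjoint_cycles src tgt L h \<epsilon>"
    and l: "l < L" "i < h l" and t: "tgt e = src (\<epsilon> (offset h l + i))"
  shows "e = \<epsilon> (offset h l + cycle_prev (h l) i)"
proof -
  obtain l' i' where l': "l' < L" "i' < h l'" "e = \<epsilon> (offset h l' + i')" using disjoint_cycles_edge[OF C, of e] by auto
  define n where "n = (if i' = h l' - 1 then 0 else Suc i')"
  have n: "n < h l'" "cycle_prev (h l') n = i'" using l'(2) by (auto simp: n_def cycle_prev_def)
  have "src (\<epsilon> (offset h l' + n)) = src (\<epsilon> (offset h l + i))"
    using disjoint_cycles_tgt[OF C l'(1) n(1)] t l'(3) n(2) by simp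
  from disjoint_cycles_src_inj[OF C l'(1) n(1) l this] show ?thesis using l' n by simp
qed

text \<open>Distinct edges have distinct sources, so each row contains one nonzero weight, and the
  row sum makes it 1.\<close>

lemma disjoint_cycles_weights:
  fixes src tgt :: "'n::finite \<Rightarrow> 'k::finite"
  assumes C: "disjoint_cycles src tgt L h \<epsilon>" and w: "admissible_weights src w"
  shows "w $ i $ j = (if i = src j then 1 else 0)"
proof (cases "i = src j")
  case True
  have "e = j" if "src e = src j" for e
  proof -
    obtain l p where e: "l < L" "p < h l" "e = \<epsilon> (offset h l + p)" using disjoint_cycles_edge[OF C, of e] by auto
    obtain l' p' where j: "l' < L" "p' < h l'" "j = \<epsilon> (offset h l' + p')" using disjoint_cycles_edge[OF C, of j] by auto
    show ?thesis using disjoint_cycles_src_inj[OF C e(1,2) j(1,2)] that e(3) j(3) by simp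
  qed
  then have z: "w $ i $ e = 0" if "e \<noteq> j" for e
    using w that True unfolding admissible_weights_def Iminus_def by auto
  have "1 = (\<Sum>e\<in>UNIV. w $ i $ e)" using w by (simp add: admissible_weights_def)
  also have "\<dots> = (\<Sum>e\<in>{j}. w $ i $ e)" by (rule sum.mono_neutral_right) (use z in auto)
  finally show ?thesis using True by simp
next
  case False
  then show ?thesis using w unfolding admissible_weights_def Iminus_def by simp
qed

text \<open>Each vertex has exactly one outgoing and one incoming edge, so the weights and the sum
  over the edges collapse.\<close>

lemma network_boundary_condition:
  fixes src tgt :: "'n::finite \<Rightarrow> 'k::finite" and z0 z1 :: "real ^ 'n" and U :: "real ^ 'm::finite"
  assumes C: "disjoint_cycles src tgt L h \<epsilon>" and w: "admissible_weights src w"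
  shows "(\<forall>i j. Iminus src $ i $ j * z1 $ j = w $ i $ j * (\<Sum>e\<in>UNIV. Iplus tgt $ i $ e * z0 $ e)
      + w $ i $ j * (\<Sum>c\<in>UNIV. \<Gamma> $ i $ c * U $ c)) \<longleftrightarrow>
    (\<forall>l<L. \<forall>i<h l. z1 $ \<epsilon> (offset h l + i) = z0 $ \<epsilon> (offset h l + cycle_prev (h l) i)
      + (\<Sum>c\<in>UNIV. \<Gamma> $ src (\<epsilon> (offset h l + i)) $ c * U $ c))"
    (is "?L \<longleftrightarrow> ?R")
proof -
  have plus: "(\<Sum>e\<in>UNIV. Iplus tgt $ src (\<epsilon> (offset h l + i)) $ e * z0 $ e) = z0 $ \<epsilon> (offset h l + cycle_prev (h l) i)"
    if l: "l < L" "i < h l" for l i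
  proof -
    have "(\<Sum>e\<in>UNIV. Iplus tgt $ src (\<epsilon> (offset h l + i)) $ e * z0 $ e)
      = (\<Sum>e\<in>UNIV. if e = \<epsilon> (offset h l + cycle_prev (h l) i) then z0 $ e else 0)"
    proof (rule sum.cong[OF refl])
      fix e
      have "src (\<epsilon> (offset h l + i)) = tgt e \<longleftrightarrow> e = \<epsilon> (offset h l + cycle_prev (h l) i)"
        using disjoint_cycles_tgt[OF C l] disjoint_cycles_tgt_inj[OF C l, of e] by metis
      then show "Iplus tgt $ src (\<epsilon> (offset h l + i)) $ e * z0 $ e = (if e = \<epsilon> (offset h l + cycle_prev (h l) i) then z0 $ e else 0)"
        by (simp add: Iplus_def)
    qed
    then show ?thesis by simp
  qed
  have one: "Iminus src $ i $ j * x = w $ i $ j * y + w $ i $ j * y' \<longleftrightarrow> (i = src j \<longrightarrow> x = y + y')" for i j and x y y' :: real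
    unfolding disjoint_cycles_weights[OF C w] Iminus_def by simp
  have "?L \<longleftrightarrow> (\<forall>j. z1 $ j = (\<Sum>e\<in>UNIV. Iplus tgt $ src j $ e * z0 $ e) + (\<Sum>c\<in>UNIV. \<Gamma> $ src j $ c * U $ c))"
    unfolding one by blast
  also have "\<dots> \<longleftrightarrow> (\<forall>l<L. \<forall>i<h l. z1 $ \<epsilon> (offset h l + i) = (\<Sum>e\<in>UNIV. Iplus tgt $ src (\<epsilon> (offset h l + i)) $ e * z0 $ e)
      + (\<Sum>c\<in>UNIV. \<Gamma> $ src (\<epsilon> (offset h l + i)) $ c * U $ c))" (is "?A \<longleftrightarrow> ?B")
  proof
    assume B: ?B
    show ?A
    proof
      fix j
      obtain l i where "l < L" "i < h l" "j = \<epsilon> (offset h l + i)" using disjoint_cycles_edge[OF C, of j] by auto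
      then show "z1 $ j = (\<Sum>e\<in>UNIV. Iplus tgt $ src j $ e * z0 $ e) + (\<Sum>c\<in>UNIV. \<Gamma> $ src j $ c * U $ c)"
        using B by blast
    qed
  next
    assume ?A
    then show ?B by blast
  qed
  also have "\<dots> \<longleftrightarrow> ?R"
    by (intro arg_cong[where f = All] ext imp_cong refl) (simp only: plus)
  finally show ?thesis .
qed

section \<open>Solutions of the network and their traces\<close>

abbreviation "edge_delay lam e \<equiv> transport_edge.delay (lam e)"
abbreviation "edge_damping lam d e \<equiv> transport_edge.damping (lam e) (d e)"

lemma tau_delay: "transport_edge (lam e) (d e) \<Longrightarrow> tau lam e = edge_delay lam e 0"
  by (simp add: tau_def transport_edge.delay_0)

lemma zeta_damping: "transport_edge (lam e) (d e) \<Longrightarrow> zeta lam d e = edge_damping lam d e 0"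
  by (simp add: zeta_def transport_edge.damping_0)

text \<open>The trace at \<open>x = 1\<close>; negative times encode the initial state, transported back along the
  characteristics.\<close>

definition edge_wave :: "('n \<Rightarrow> real \<Rightarrow> real) \<Rightarrow> ('n \<Rightarrow> real \<Rightarrow> real) \<Rightarrow> (real \<Rightarrow> real ^ 'n::finite) \<Rightarrow> (real \<Rightarrow> real \<Rightarrow> real ^ 'n) \<Rightarrow> 'n \<Rightarrow> real \<Rightarrow> real" where
  "edge_wave lam d \<phi> z e r = (if 0 \<le> r then z r 1 $ e
     else exp (edge_damping lam d e (transport_edge.position (lam e) (- r))) * \<phi> (transport_edge.position (lam e) (- r)) $ e)"

text \<open>The characteristic through (t, x) is followed back to x = 1 if it starts there at a
  nonnegative time, and otherwise to the initial state at the point with delay equal to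
  \<open>delay x - t\<close>.\<close>

lemma network_solution_wave:
  fixes src tgt :: "'n::finite \<Rightarrow> 'k::finite" and \<Gamma> :: "real ^ 'm::finite ^ 'k"
  assumes te: "transport_edge (lam e) (d e)"
    and sol: "network_solution src tgt w \<Gamma> lam d T \<phi> u z" and T: "0 \<le> T"
    and t: "t \<in> {0..T}" and x: "x \<in> {0..1}"
  shows "z t x $ e = exp (- edge_damping lam d e x) * edge_wave lam d \<phi> z e (t - edge_delay lam e x)"
proof -
  let ?dl = "edge_delay lam e" and ?dm = "edge_damping lam d e"
  have char: "z (t0 + (?dl y - ?dl x0)) y $ e = exp (- (?dm y - ?dm x0)) * z t0 x0 $ e"
    if "t0 \<in> {0..T}" "x0 \<in> {0..1}" "y \<in> {0..1}" "t0 + (?dl y - ?dl x0) \<in> {0..T}" for t0 x0 y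
  proof -
    have "\<forall>h. t0 + (LINT \<xi>=ereal x0..ereal (x0 + h)|lebesgue. (1 / lam e \<xi>)) \<in> {0..T} \<longrightarrow>
        x0 + h \<in> {0..1} \<longrightarrow>
        z (t0 + (LINT \<xi>=ereal x0..ereal (x0 + h)|lebesgue. (1 / lam e \<xi>))) (x0 + h) $ e =
          exp (- (LINT \<xi>=ereal x0..ereal (x0 + h)|lebesgue. (d e \<xi> / lam e \<xi>))) * z t0 x0 $ e"
      using sol that(1,2) unfolding network_solution_def by blast
    from spec[OF this, of "y - x0"] show ?thesis
      using that by (simp add: transport_edge.interval_integral_eq[OF te])
  qed
  show ?thesis
  proof (cases "0 \<le> t - ?dl x")
    case True
    have "t - ?dl x \<in> {0..T}" using True t transport_edge.delay_nonneg[OF te x] by auto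
    then have "z t x $ e = exp (- (?dm x - ?dm 1)) * z (t - ?dl x) 1 $ e"
      using char[of "t - ?dl x" 1 x] x t by (simp add: transport_edge.delay_1[OF te])
    then show ?thesis using True by (simp add: edge_wave_def transport_edge.damping_1[OF te])
  next
    case False
    define y where "y = transport_edge.position (lam e) (- (t - ?dl x))"
    have y: "y \<in> {0..1}" unfolding y_def by (rule transport_edge.position_range[OF te])
    have "- (t - ?dl x) \<in> {0..?dl 0}" using False t transport_edge.delay_le[OF te x] by auto
    then have "?dl y = - (t - ?dl x)" unfolding y_def by (rule transport_edge.delay_position[OF te])
    then have "z t x $ e = exp (- (?dm x - ?dm y)) * z 0 y $ e"
      using char[of 0 y x] x y t T by simp
    moreover have "z 0 y = \<phi> y" using sol y by (simp add: network_solution_def)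
    moreover have "exp (- (?dm x - ?dm y)) = exp (- ?dm x) * exp (?dm y)" by (simp add: exp_add[symmetric])
    ultimately show ?thesis using False by (simp add: edge_wave_def y_def)
  qed
qed

lemma network_solution_delay:
  fixes src tgt :: "'n::finite \<Rightarrow> 'k::finite" and \<Gamma> :: "real ^ 'm::finite ^ 'k"
  assumes C: "disjoint_cycles src tgt L h \<epsilon>" and w: "admissible_weights src w"
    and te: "\<And>e. transport_edge (lam e) (d e)"
    and sol: "network_solution src tgt w \<Gamma> lam d T \<phi> u z" and T: "0 \<le> T" and t: "t \<in> {0..T}"
    and l: "l < L" "i < h l"
  defines "e' \<equiv> \<epsilon> (offset h l + cycle_prev (h l) i)" and "e \<equiv> \<epsilon> (offset h l + i)"
  shows "edge_wave lam d \<phi> z e t = exp (- zeta lam d e') * edge_wave lam d \<phi> z e' (t - tau lam e') + (\<Sum>c\<in>UNIV. \<Gamma> $ src e $ c * u t $ c)"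
proof -
  have "\<forall>i j. Iminus src $ i $ j * z t 1 $ j = w $ i $ j * (\<Sum>e\<in>UNIV. Iplus tgt $ i $ e * z t 0 $ e) +
          w $ i $ j * (\<Sum>c\<in>UNIV. \<Gamma> $ i $ c * u t $ c)"
    using sol t unfolding network_solution_def by blast
  then have "z t 1 $ e = z t 0 $ e' + (\<Sum>c\<in>UNIV. \<Gamma> $ src e $ c * u t $ c)"
    unfolding network_boundary_condition[OF C w] e_def e'_def using l by blast
  moreover have "edge_wave lam d \<phi> z e t = z t 1 $ e" using t by (simp add: edge_wave_def)
  moreover have "z t 0 $ e' = exp (- zeta lam d e') * edge_wave lam d \<phi> z e' (t - tau lam e')"
    using network_solution_wave[OF te sol T t, of 0 e'] by (simp add: tau_delay[where lam = lam and d = d, OF te] zeta_damping[OF te])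
  ultimately show ?thesis by simp
qed

text \<open>Since the delay equations hold at every real time, the initial state \<open>z 0\<close>
  read off from \<open>X\<close> is compatible with the boundary condition at time 0. It has to
  match the prescribed data only almost everywhere.\<close>

lemma delay_network_solution:
  fixes src tgt :: "'n::finite \<Rightarrow> 'k::finite" and \<Gamma> :: "real ^ 'm::finite ^ 'k" and X :: "'n \<Rightarrow> real \<Rightarrow> real"
  assumes C: "disjoint_cycles src tgt L h \<epsilon>" and w: "admissible_weights src w"
    and te: "\<And>e. transport_edge (lam e) (d e)"
    and X: "\<And>l i t. l < L \<Longrightarrow> i < h l \<Longrightarrow> X (\<epsilon> (offset h l + i)) t
      = exp (- zeta lam d (\<epsilon> (offset h l + cycle_prev (h l) i))) * X (\<epsilon> (offset h l + cycle_prev (h l) i)) (t - tau lam (\<epsilon> (offset h l + cycle_prev (h l) i)))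
        + (\<Sum>c\<in>UNIV. \<Gamma> $ src (\<epsilon> (offset h l + i)) $ c * u t $ c)"
  defines "z \<equiv> \<lambda>t x. \<chi> e. exp (- edge_damping lam d e x) * X e (t - edge_delay lam e x)"
  shows "network_solution src tgt w \<Gamma> lam d T (z 0) u z"
  unfolding network_solution_def
proof (intro conjI ballI)
  fix t assume "t \<in> {0..T}"
  have "\<forall>l<L. \<forall>i<h l. z t 1 $ \<epsilon> (offset h l + i) = z t 0 $ \<epsilon> (offset h l + cycle_prev (h l) i)
      + (\<Sum>c\<in>UNIV. \<Gamma> $ src (\<epsilon> (offset h l + i)) $ c * u t $ c)"
  proof (intro allI impI)
    fix l i assume "l < L" "i < h l"
    from X[OF this, of t] show "z t 1 $ \<epsilon> (offset h l + i) = z t 0 $ \<epsilon> (offset h l + cycle_prev (h l) i)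
      + (\<Sum>c\<in>UNIV. \<Gamma> $ src (\<epsilon> (offset h l + i)) $ c * u t $ c)"
      by (simp add: z_def transport_edge.delay_1[OF te] transport_edge.damping_1[OF te]
        tau_delay[where lam = lam and d = d, OF te] zeta_damping[OF te])
  qed
  then show "\<forall>i j. Iminus src $ i $ j * z t 1 $ j = w $ i $ j * (\<Sum>e\<in>UNIV. Iplus tgt $ i $ e * z t 0 $ e) +
          w $ i $ j * (\<Sum>c\<in>UNIV. \<Gamma> $ i $ c * u t $ c)"
    unfolding network_boundary_condition[OF C w] .
next
  show "\<forall>j. \<forall>t\<in>{0..T}. \<forall>x\<in>{0..1}. \<forall>h.
        t + (LINT \<xi>=ereal x..ereal (x + h)|lebesgue. (1 / lam j \<xi>)) \<in> {0..T} \<longrightarrow>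
        x + h \<in> {0..1} \<longrightarrow>
        z (t + (LINT \<xi>=ereal x..ereal (x + h)|lebesgue. (1 / lam j \<xi>))) (x + h) $ j =
          exp (- (LINT \<xi>=ereal x..ereal (x + h)|lebesgue. (d j \<xi> / lam j \<xi>))) * z t x $ j"
  proof (intro allI ballI impI)
    fix e t x h
    assume x: "x \<in> {0..1::real}" and y: "x + h \<in> {0..1}"
    have "exp (- edge_damping lam d e (x + h)) = exp (- (edge_damping lam d e (x + h) - edge_damping lam d e x)) * exp (- edge_damping lam d e x)"
      by (simp add: exp_add[symmetric])
    then show "z (t + (LINT \<xi>=ereal x..ereal (x + h)|lebesgue. (1 / lam e \<xi>))) (x + h) $ e =
          exp (- (LINT \<xi>=ereal x..ereal (x + h)|lebesgue. (d e \<xi> / lam e \<xi>))) * z t x $ e"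
      unfolding transport_edge.interval_integral_eq[OF te x y] z_def by simp
  qed
qed simp

section \<open>Controllability\<close>

text \<open>Conjugation exchanges \<open>k\<close> and \<open>- k\<close>, so natural frequencies suffice.\<close>

definition symbol_bounded_below ::
  "real ^ 'm::finite ^ 'k::finite \<Rightarrow> (nat \<Rightarrow> 'k) \<Rightarrow> nat \<Rightarrow> (nat \<Rightarrow> real) \<Rightarrow> (nat \<Rightarrow> real) \<Rightarrow> bool" where
  "symbol_bounded_below \<Gamma> v n \<tau> \<zeta> \<longleftrightarrow> (\<exists>\<delta>>0. \<forall>k::nat. \<delta> \<le> (\<Sum>c\<in>UNIV. (cmod (\<Sum>i<n.
      (exp (\<Sum>t<i. \<zeta> t) * \<Gamma> $ v i $ c * exp (- (\<Sum>t<n. \<zeta> t) / (\<Sum>t<n. \<tau> t) * (\<Sum>t<i. \<tau> t)))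
        *\<^sub>R cis (2 * pi * of_nat k / (\<Sum>t<n. \<tau> t) * (\<Sum>t<i. \<tau> t))))\<^sup>2))"

lemma cycle_row_vertical:
  "cycle_row \<tau> \<zeta> h v \<Gamma> l (of_real \<sigma> + \<i> * of_real \<theta>) c = (\<Sum>i<h l.
     (exp (\<Sum>t<i. \<zeta> (offset h l + t)) * \<Gamma> $ v (offset h l + i) $ c * exp (\<sigma> * (\<Sum>t<i. \<tau> (offset h l + t))))
       *\<^sub>R cis (\<theta> * (\<Sum>t<i. \<tau> (offset h l + t))))"
  unfolding cycle_row_def y_vec_vertical by (simp add: exp_add scaleR_conv_of_real mult_ac)

lemma closure_iff_symbol_bounded_below:
  fixes \<Gamma> :: "real ^ 'm::finite ^ 'k::finite" and v :: "nat \<Rightarrow> 'k" and \<tau> \<zeta> :: "nat \<Rightarrow> real"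
  assumes "1 \<le> h l" "l < L" "\<And>j. j < offset h L \<Longrightarrow> \<tau> j > 0"
  shows "(\<forall>N\<in>mat_closure (offset h L) (range (Hnet \<tau> \<zeta> L h)). Determinant.det (diagonal_block h N l) = 0 \<longrightarrow>
      row_times_Gamma (offset h L) v (Y_tilde \<tau> \<zeta> L h l N) \<Gamma> \<noteq> 0) \<longleftrightarrow>
    symbol_bounded_below \<Gamma> (\<lambda>i. v (offset h l + i)) (h l) (\<lambda>i. \<tau> (offset h l + i)) (\<lambda>i. \<zeta> (offset h l + i))"
  using closure_criterion[where h = h and l = l and L = L and \<tau> = \<tau> and \<zeta> = \<zeta> and v = v and \<Gamma> = \<Gamma>, OF assms]
  unfolding symbol_bounded_below_def cycle_row_vertical sum_J .

lemma sum_edges: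
  assumes "disjoint_cycles src tgt L h \<epsilon>"
  shows "(\<Sum>e\<in>UNIV. f e) = (\<Sum>l<L. \<Sum>i<h l. f (\<epsilon> (offset h l + i)))"
proof -
  have "bij_betw \<epsilon> {..<offset h L} UNIV" using assms by (simp add: disjoint_cycles_def)
  then have "(\<Sum>e\<in>UNIV. f e) = (\<Sum>j<offset h L. f (\<epsilon> j))" by (rule sum.reindex_bij_betw[symmetric])
  then show ?thesis by (simp only: sum_offset)
qed

lemma exp_weight:
  assumes "(W::real) > 0" shows "exp (- Z) = exp (- Z / W * W)"
  using assms by simp

lemma AE_lebesgue_on_vec:
  fixes f g :: "real \<Rightarrow> real ^ 'n::finite"
  assumes "\<And>e. AE x in lebesgue_on {p..q}. f x $ e = g x $ e"
  shows "AE x in lebesgue_on {p..q}. f x = g x"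
proof -
  have "AE x in lebesgue_on {p..q}. \<forall>e\<in>UNIV. f x $ e = g x $ e"
    using assms by (intro AE_finite_allI) auto
  then show ?thesis by eventually_elim (simp add: Finite_Cartesian_Product.vec_eq_iff)
qed

lemma set_integrable_vec_nth:
  fixes f :: "real \<Rightarrow> real ^ 'n::finite"
  assumes "f absolutely_integrable_on S" shows "set_integrable lebesgue S (\<lambda>x. f x $ e)"
proof -
  have "integrable lebesgue (\<lambda>x. (indicat_real S x *\<^sub>R f x) $ e)"
    by (rule integrable_bounded_linear[OF bounded_linear_vec_nth]) (use assms in \<open>simp add: set_integrable_def\<close>)
  then show ?thesis by (simp add: set_integrable_def)
qed

lemma absolutely_integrable_vec:
  fixes f :: "'n::finite \<Rightarrow> real \<Rightarrow> real"
  assumes "\<And>e. locint (f e)" shows "(\<lambda>x. \<chi> e. f e x) absolutely_integrable_on {p..q}"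
proof -
  have "(\<chi> e. f e x) = (\<Sum>e\<in>UNIV. f e x *\<^sub>R axis e 1)" for x
    by (simp add: Finite_Cartesian_Product.vec_eq_iff axis_def if_distrib cong: if_cong)
  moreover have "integrable lebesgue (\<lambda>x. \<Sum>e\<in>UNIV. (indicat_real {p..q} x *\<^sub>R f e x) *\<^sub>R (axis e 1 :: real ^ 'n))"
  proof (intro Bochner_Integration.integrable_sum integrable_scaleR_left)
    fix e
    have "integrable lborel (\<lambda>x. indicat_real {p..q} x *\<^sub>R f e x)" using assms[of e] by (simp add: locint_def set_integrable_def)
    then show "integrable lebesgue (\<lambda>x. indicat_real {p..q} x *\<^sub>R f e x)"
      by (subst integrable_completion) (auto dest: borel_measurable_integrable)
  qed
  ultimately show ?thesis by (simp add: set_integrable_def scaleR_sum_right)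
qed

text \<open>The network is steered from 0 to a state that is a continuous quasiperiodic wave on
  cycle \<open>l\<close> and zero elsewhere. The periodizations of the control then solve the
  convolution system for this wave, so \<open>convolution_system_lower_bound\<close>
  applies.\<close>

theorem controllable_imp_symbol_bounded_below:
  fixes src tgt :: "'n::finite \<Rightarrow> 'k::finite" and \<Gamma> :: "real ^ 'm::finite ^ 'k"
  assumes C: "disjoint_cycles src tgt L h \<epsilon>" and w: "admissible_weights src w"
    and te: "\<And>e. transport_edge (lam e) (d e)"
    and ctrl: "L1_exactly_controllable src tgt w \<Gamma> lam d (\<Sum>j\<in>UNIV. tau lam j)"
    and l: "l < L"
  shows "symbol_bounded_below \<Gamma> (\<lambda>i. src (\<epsilon> (offset h l + i))) (h l)
     (\<lambda>i. tau lam (\<epsilon> (offset h l + i))) (\<lambda>i. zeta lam d (\<epsilon> (offset h l + i)))"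
proof -
  define E where "E i = \<epsilon> (offset h l + i)" for i
  define \<tau> where "\<tau> i = tau lam (E i)" for i
  define \<zeta> where "\<zeta> i = zeta lam d (E i)" for i
  define a where "a i = (\<Sum>t<i. \<tau> t)" for i
  define b where "b i = (\<Sum>t<i. \<zeta> t)" for i
  define W where "W = a (h l)"
  define \<kappa> where "\<kappa> = exp (- b (h l))"
  define \<sigma> where "\<sigma> = - b (h l) / W"
  define T where "T = (\<Sum>j\<in>UNIV. tau lam j)"
  have h: "1 \<le> h l" using C l by (simp add: disjoint_cycles_def)
  have tau_pos: "tau lam e > 0" for e
    unfolding tau_delay[where lam = lam and d = d, OF te] by (rule transport_edge.delay_0_pos[OF te])
  have \<tau>: "\<tau> i > 0" for i by (simp add: \<tau>_def tau_pos)
  have W: "W > 0" unfolding W_def a_def using \<tau> h by (intro sum_pos) (auto simp: lessThan_empty_iff)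
  have \<kappa>: "\<kappa> = exp (\<sigma> * W)" unfolding \<kappa>_def \<sigma>_def by (rule exp_weight[OF W])
  have WT: "W \<le> T"
  proof -
    have "W = (\<Sum>i<h l. tau lam (\<epsilon> (offset h l + i)))" by (simp add: W_def a_def \<tau>_def E_def)
    also have "\<dots> \<le> (\<Sum>l<L. \<Sum>i<h l. tau lam (\<epsilon> (offset h l + i)))"
      by (rule member_le_sum[where f = "\<lambda>l. \<Sum>i<h l. tau lam (\<epsilon> (offset h l + i))"])
        (use l tau_pos in \<open>auto intro!: sum_nonneg simp: less_imp_le\<close>)
    also have "\<dots> = T" by (simp only: T_def sum_edges[OF C])
    finally show ?thesis .
  qed
  have T0: "0 \<le> T" using W WT by simp
  have E_inj: "i = j" if "E i = E j" "i < h l" "j < h l" for i j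
    using disjoint_cycles_src_inj[OF C l that(2) l that(3)] that(1) by (simp add: E_def)
  have "\<exists>\<delta>>0. \<forall>k::nat. \<delta> \<le> (\<Sum>c\<in>UNIV. (cmod (\<Sum>i\<in>{..<h l}. (exp (b i) * \<Gamma> $ src (E i) $ c * exp (\<sigma> * a i)) *\<^sub>R cis (2 * pi * of_nat k / W * a i)))\<^sup>2)"
  proof (rule convolution_system_lower_bound[OF W \<kappa>])
    fix f :: "real \<Rightarrow> real"
    assume fc: "continuous_on UNIV f" and fq: "quasiperiodic \<kappa> W f"
    \<comment> \<open>The exponential factors cancel the normalisations by the damping along the
      edge and by \<open>b i\<close> along the cycle: in the moving frame this final state is
      \<open>f\<close>.\<close>
    define \<psi> :: "real \<Rightarrow> real ^ 'n" where "\<psi> x = (\<chi> e. \<Sum>i<h l. if e = E i then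
        exp (- edge_damping lam d e x) * (exp (- b i) * f (T - edge_delay lam e x - a i)) else 0)" for x
    have \<psi>E: "\<psi> x $ E i = exp (- edge_damping lam d (E i) x) * (exp (- b i) * f (T - edge_delay lam (E i) x - a i))"
      if i: "i < h l" for i x
    proof -
      have "\<psi> x $ E i = (\<Sum>j<h l. if j = i then exp (- edge_damping lam d (E i) x) * (exp (- b i) * f (T - edge_delay lam (E i) x - a i)) else 0)"
        unfolding \<psi>_def vec_lambda_beta
      proof (rule sum.cong[OF refl])
        fix j assume "j \<in> {..<h l}"
        then have "E i = E j \<longleftrightarrow> j = i" using E_inj[of i j] i by auto
        then show "(if E i = E j then exp (- edge_damping lam d (E i) x) * (exp (- b j) * f (T - edge_delay lam (E i) x - a j)) else 0)
          = (if j = i then exp (- edge_damping lam d (E i) x) * (exp (- b i) * f (T - edge_delay lam (E i) x - a i)) else 0)"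
          by simp
      qed
      then show ?thesis using i by simp
    qed
    have "continuous_on {0..1} (\<lambda>x. if e = E i then
        exp (- edge_damping lam d e x) * (exp (- b i) * f (T - edge_delay lam e x - a i)) else 0)" for e i
      by (cases "e = E i") (auto intro!: continuous_intros continuous_on_compose2[OF fc]
          transport_edge.damping_continuous[OF te] transport_edge.delay_continuous[OF te])
    then have "continuous_on {0..1} \<psi>" unfolding \<psi>_def[abs_def]
      by (intro continuous_on_vec_lambda continuous_on_sum)
    then have \<psi>: "\<psi> absolutely_integrable_on {0..1}" by (rule absolutely_integrable_continuous_real)
    have zero: "(\<lambda>x. 0 :: real ^ 'n) absolutely_integrable_on {0..1}" by simp
    obtain u z where u: "u absolutely_integrable_on {0..T}"
      and z: "L1_network_solution src tgt w \<Gamma> lam d T (\<lambda>x. 0) u z"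
      and z\<psi>: "AE x in lebesgue_on {0..1}. z T x = \<psi> x"
      using ctrl[unfolded L1_exactly_controllable_def, folded T_def, rule_format, OF zero \<psi>] by (elim exE conjE)
    from z obtain \<phi>' u' where \<phi>': "AE x in lebesgue_on {0..1}. \<phi>' x = 0"
      and u': "AE t in lebesgue_on {0..T}. u' t = u t" and sol: "network_solution src tgt w \<Gamma> lam d T \<phi>' u' z"
      unfolding L1_network_solution_def by (elim exE conjE)
    have "\<forall>c. \<exists>F. locint F \<and> supported 0 T F \<and> (AE t in lborel. t \<in> {0..T} \<longrightarrow> u t $ c = F t)"
      using lebesgue_integrable_representative[OF set_integrable_vec_nth[OF u]] by (rule allI)
    from choice[OF this] obtain F where F: "\<forall>c. locint (F c) \<and> supported 0 T (F c) \<and> (AE t in lborel. t \<in> {0..T} \<longrightarrow> u t $ c = F c t)" ..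
    define X where "X i = edge_wave lam d \<phi>' z (E i)" for i
    have "AE s in lborel. (\<Sum>c\<in>UNIV. \<Sum>j<h l. exp (b j) * \<Gamma> $ src (E j) $ c * periodize \<kappa> W (F c) (s + a j)) = f s"
      unfolding \<kappa>_def W_def b_def a_def
    proof (rule cycle_final_state_necessary[OF h \<tau>, where X = X and u = "\<lambda>c t. u' t $ c" and T = T])
      show "(\<Sum>t<h l. \<tau> t) \<le> T" using WT by (simp only: W_def a_def)
      show "supported 0 T (F c)" for c using F by blast
      show "quasiperiodic (exp (- (\<Sum>t<h l. \<zeta> t))) (\<Sum>t<h l. \<tau> t) f" using fq by (simp only: \<kappa>_def W_def a_def b_def)
    next
      fix i t assume "i < h l" "t \<in> {0..T}"
      then show "X i t = exp (- \<zeta> (cycle_prev (h l) i)) * X (cycle_prev (h l) i) (t - \<tau> (cycle_prev (h l) i)) + (\<Sum>c\<in>UNIV. \<Gamma> $ src (E i) $ c * u' t $ c)"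
        unfolding X_def \<zeta>_def \<tau>_def E_def using network_solution_delay[OF C w te sol T0 _ l] by blast
    next
      fix c
      have "AE t in lborel. t \<in> {0..T} \<longrightarrow> u' t = u t" using u' by (simp add: AE_restrict_space_iff AE_completion_iff)
      moreover have "AE t in lborel. t \<in> {0..T} \<longrightarrow> u t $ c = F c t" using F by blast
      ultimately show "AE t in lborel. t \<in> {0..T} \<longrightarrow> u' t $ c = F c t" by eventually_elim auto
    next
      fix i assume i: "i < h l"
      have "AE x in lebesgue_on {0..1}. edge_wave lam d \<phi>' z (E i) (- edge_delay lam (E i) x) = 0"
        using \<phi>' AE_space
      proof eventually_elim
        case (elim x)
        then have x: "x \<in> {0..1}" by (simp add: space_restrict_space)
        have "z 0 x $ E i = 0" using sol x elim(1) by (simp add: network_solution_def)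
        then show ?case using network_solution_wave[OF te sol T0 _ x, of 0 "E i"] T0 by simp
      qed
      \<comment> \<open>Reflection turns the delay coordinate of a point into the time at which its
        wave passed x = 1.\<close>
      from AE_lborel_reflect[OF transport_edge.AE_delay_converse[OF te this], of 0]
      show "AE t in lborel. t \<in> {- \<tau> i..<0} \<longrightarrow> X i t = 0"
        by eventually_elim (auto simp: X_def \<tau>_def tau_delay[where lam = lam and d = d, OF te])
      have "AE x in lebesgue_on {0..1}. edge_wave lam d \<phi>' z (E i) (T - edge_delay lam (E i) x)
          = exp (- b i) * f (T - edge_delay lam (E i) x - a i)"
        using z\<psi> AE_space
      proof eventually_elim
        case (elim x)
        then have x: "x \<in> {0..1}" by (simp add: space_restrict_space)
        have "z T x $ E i = exp (- edge_damping lam d (E i) x) * (exp (- b i) * f (T - edge_delay lam (E i) x - a i))"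
          unfolding elim(1) by (rule \<psi>E[OF i])
        then show ?case using network_solution_wave[OF te sol T0 _ x, of T "E i"] T0 by simp
      qed
      from AE_lborel_reflect[OF transport_edge.AE_delay_converse[OF te this], of T]
      show "AE t in lborel. t \<in> {T - \<tau> i..<T} \<longrightarrow> X i t = exp (- (\<Sum>t<i. \<zeta> t)) * f (t - (\<Sum>t<i. \<tau> t))"
        by eventually_elim (auto simp: X_def \<tau>_def tau_delay[where lam = lam and d = d, OF te] a_def b_def)
    qed
    moreover have "\<forall>c. quasiperiodic \<kappa> W (periodize \<kappa> W (F c)) \<and> locint (periodize \<kappa> W (F c))"
      using F by (auto intro!: periodize_quasiperiodic locint_periodize[OF W] simp: \<kappa>_def)
    ultimately show "\<exists>v. (\<forall>c. quasiperiodic \<kappa> W (v c) \<and> locint (v c)) \<and>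
     (AE s in lborel. (\<Sum>c\<in>UNIV. \<Sum>i\<in>{..<h l}. exp (b i) * \<Gamma> $ src (E i) $ c * v c (s + a i)) = f s)"
      by (intro exI[of _ "\<lambda>c. periodize \<kappa> W (F c)"]) simp
  qed simp
  then show ?thesis
    unfolding symbol_bounded_below_def \<sigma>_def W_def a_def b_def \<tau>_def \<zeta>_def E_def .
qed

text \<open>The lower bounds fix the wanted periodizations cycle by cycle, without reference to the
  control. Interpolation then provides one control realising all of them, and \<open>T\<close>,
  regrouped by cycles, is the length of its support interval.\<close>

theorem symbol_bounded_below_imp_controllable:
  fixes src tgt :: "'n::finite \<Rightarrow> 'k::finite" and \<Gamma> :: "real ^ 'm::finite ^ 'k"
  assumes C: "disjoint_cycles src tgt L h \<epsilon>" and w: "admissible_weights src w"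
    and te: "\<And>e. transport_edge (lam e) (d e)"
    and ratios: "\<And>l1 l2. l1 < L \<Longrightarrow> l2 < L \<Longrightarrow> l1 \<noteq> l2 \<Longrightarrow>
      (\<Sum>i<h l1. zeta lam d (\<epsilon> (offset h l1 + i))) / (\<Sum>i<h l1. tau lam (\<epsilon> (offset h l1 + i)))
        \<noteq> (\<Sum>i<h l2. zeta lam d (\<epsilon> (offset h l2 + i))) / (\<Sum>i<h l2. tau lam (\<epsilon> (offset h l2 + i)))"
    and lower: "\<And>l. l < L \<Longrightarrow> symbol_bounded_below \<Gamma> (\<lambda>i. src (\<epsilon> (offset h l + i))) (h l)
     (\<lambda>i. tau lam (\<epsilon> (offset h l + i))) (\<lambda>i. zeta lam d (\<epsilon> (offset h l + i)))"
  shows "L1_exactly_controllable src tgt w \<Gamma> lam d (\<Sum>j\<in>UNIV. tau lam j)"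
proof -
  define E where "E l i = \<epsilon> (offset h l + i)" for l i
  define \<tau> where "\<tau> l i = tau lam (E l i)" for l i
  define \<zeta> where "\<zeta> l i = zeta lam d (E l i)" for l i
  define a where "a l i = (\<Sum>t<i. \<tau> l t)" for l i
  define b where "b l i = (\<Sum>t<i. \<zeta> l t)" for l i
  define W where "W l = a l (h l)" for l
  define \<kappa> where "\<kappa> l = exp (- b l (h l))" for l
  define \<sigma> where "\<sigma> l = - b l (h l) / W l" for l
  define T where "T = (\<Sum>j\<in>UNIV. tau lam j)"
  have h: "1 \<le> h l" if "l < L" for l using C that by (simp add: disjoint_cycles_def)
  have tau_pos: "tau lam e > 0" for e
    unfolding tau_delay[where lam = lam and d = d, OF te] by (rule transport_edge.delay_0_pos[OF te])
  have \<tau>: "\<tau> l i > 0" for l i by (simp add: \<tau>_def tau_pos)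
  have W: "W l > 0" if "l < L" for l unfolding W_def a_def using \<tau> h[OF that] by (intro sum_pos) (auto simp: lessThan_empty_iff)
  have \<kappa>: "\<kappa> l = exp (\<sigma> l * W l)" if "l < L" for l unfolding \<kappa>_def \<sigma>_def by (rule exp_weight[OF W[OF that]])
  have TW: "T = (\<Sum>l<L. W l)" by (simp only: T_def sum_edges[OF C] W_def a_def \<tau>_def E_def)
  have \<sigma>: "\<sigma> i \<noteq> \<sigma> j" if "i < L" "j < L" "i \<noteq> j" for i j
    using ratios[OF that] by (simp add: \<sigma>_def W_def a_def b_def \<tau>_def \<zeta>_def E_def)
  have E_inj: "l = l' \<and> i = i'" if "l < L" "i < h l" "l' < L" "i' < h l'" "E l i = E l' i'" for l i l' i'
    using disjoint_cycles_src_inj[OF C that(1-4)] that(5) by (simp add: E_def)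
  have "\<exists>u. u absolutely_integrable_on {0..T} \<and> (\<exists>z. L1_network_solution src tgt w \<Gamma> lam d T \<phi> u z \<and>
               (AE x in lebesgue_on {0..1}. z T x = \<psi> x))"
    if \<phi>: "\<phi> absolutely_integrable_on {0..1}" and \<psi>: "\<psi> absolutely_integrable_on {0..1}" for \<phi> \<psi>
  proof -
    have "\<forall>e. \<exists>F. locint F \<and> (AE x in lebesgue_on {0..1}. F (edge_delay lam e x) = exp (edge_damping lam d e x) * \<phi> x $ e)"
      using transport_edge.pullback_locint[OF te set_integrable_vec_nth[OF \<phi>]] by (rule allI)
    from choice[OF this] obtain F where F: "\<forall>e. locint (F e) \<and> (AE x in lebesgue_on {0..1}. F e (edge_delay lam e x) = exp (edge_damping lam d e x) * \<phi> x $ e)" ..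
    have "\<forall>e. \<exists>F. locint F \<and> (AE x in lebesgue_on {0..1}. F (edge_delay lam e x) = exp (edge_damping lam d e x) * \<psi> x $ e)"
      using transport_edge.pullback_locint[OF te set_integrable_vec_nth[OF \<psi>]] by (rule allI)
    from choice[OF this] obtain H where H: "\<forall>e. locint (H e) \<and> (AE x in lebesgue_on {0..1}. H e (edge_delay lam e x) = exp (edge_damping lam d e x) * \<psi> x $ e)" ..
    \<comment> \<open>The arguments 0 - t and T - t convert times into the delay coordinate in which
      \<open>F\<close> and \<open>H\<close> are given.\<close>
    define reach where "reach l u X \<longleftrightarrow> (\<forall>i<h l. \<forall>t. X i t = exp (- \<zeta> l (cycle_prev (h l) i)) * X (cycle_prev (h l) i) (t - \<tau> l (cycle_prev (h l) i)) + (\<Sum>c\<in>UNIV. \<Gamma> $ src (E l i) $ c * u c t)) \<and>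
        (\<forall>i<h l. \<forall>t\<in>{- \<tau> l i..<0}. X i t = F (E l i) (0 - t)) \<and>
        (\<forall>i<h l. AE t in lborel. t \<in> {T - \<tau> l i..<T} \<longrightarrow> X i t = H (E l i) (T - t))" for l and u :: "'m \<Rightarrow> real \<Rightarrow> real" and X
    have "\<exists>v. (\<forall>c. quasiperiodic (\<kappa> l) (W l) (v c) \<and> locint (v c)) \<and>
        (\<forall>u. (\<forall>c. supported 0 T (u c)) \<longrightarrow> (\<forall>c. AE s in lborel. periodize (\<kappa> l) (W l) (u c) s = v c s) \<longrightarrow> (\<exists>X. reach l u X))"
      if l: "l \<in> {..<L}" for l
    proof -
      have l: "l < L" using l by simp
      have "\<exists>g. quasiperiodic (\<kappa> l) (W l) g \<and> locint g \<and>
        (\<forall>u. (\<forall>c. supported 0 T (u c)) \<longrightarrow>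
          (AE s in lborel. (\<Sum>c\<in>UNIV. \<Sum>j<h l. exp (b l j) * \<Gamma> $ src (E l j) $ c * periodize (\<kappa> l) (W l) (u c) (s + a l j)) = g s) \<longrightarrow>
          (\<exists>X. reach l u X))"
        unfolding reach_def \<kappa>_def W_def a_def b_def
        by (rule cycle_steering[OF h[OF l] \<tau>]) (use F H locint_reflect in blast)+
      then obtain g where g: "quasiperiodic (\<kappa> l) (W l) g" "locint g"
        and g_reach: "\<forall>u. (\<forall>c. supported 0 T (u c)) \<longrightarrow>
          (AE s in lborel. (\<Sum>c\<in>UNIV. \<Sum>j<h l. exp (b l j) * \<Gamma> $ src (E l j) $ c * periodize (\<kappa> l) (W l) (u c) (s + a l j)) = g s) \<longrightarrow>
          (\<exists>X. reach l u X)" by (elim exE conjE)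
      obtain \<delta> where \<delta>: "\<delta> > 0" "\<forall>k::nat. \<delta> \<le> (\<Sum>c\<in>UNIV. (cmod (\<Sum>i\<in>{..<h l}. (exp (b l i) * \<Gamma> $ src (E l i) $ c * exp (\<sigma> l * a l i)) *\<^sub>R cis (2 * pi * of_nat k / W l * a l i)))\<^sup>2)"
        using lower[OF l] unfolding symbol_bounded_below_def \<sigma>_def W_def a_def b_def \<tau>_def \<zeta>_def E_def by (elim exE conjE)
      have "\<exists>v. (\<forall>c. quasiperiodic (\<kappa> l) (W l) (v c) \<and> locint (v c)) \<and>
         (AE s in lborel. (\<Sum>c\<in>UNIV. \<Sum>i\<in>{..<h l}. exp (b l i) * \<Gamma> $ src (E l i) $ c * v c (s + a l i)) = g s)"
        by (rule quasiperiodic_convolution_system[OF W[OF l] \<kappa>[OF l] finite_lessThan \<delta>(1) spec[OF \<delta>(2)] g])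
      then obtain v where v: "\<forall>c. quasiperiodic (\<kappa> l) (W l) (v c) \<and> locint (v c)"
        and vg: "AE s in lborel. (\<Sum>c\<in>UNIV. \<Sum>i\<in>{..<h l}. exp (b l i) * \<Gamma> $ src (E l i) $ c * v c (s + a l i)) = g s" by (elim exE conjE)
      have "\<exists>X. reach l u X" if u: "\<forall>c. supported 0 T (u c)" "\<forall>c. AE s in lborel. periodize (\<kappa> l) (W l) (u c) s = v c s" for u
      proof -
        have "AE s in lborel. \<forall>c\<in>UNIV. \<forall>j\<in>{..<h l}. periodize (\<kappa> l) (W l) (u c) (s + a l j) = v c (s + a l j)"
          using u(2) by (intro AE_finite_allI AE_lborel_shift) auto
        then have "AE s in lborel. (\<Sum>c\<in>UNIV. \<Sum>j<h l. exp (b l j) * \<Gamma> $ src (E l j) $ c * periodize (\<kappa> l) (W l) (u c) (s + a l j)) = g s"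
          using vg by eventually_elim simp
        with g_reach u(1) show ?thesis by simp
      qed
      with v show ?thesis by (intro exI[of _ v]) simp
    qed
    then have "\<forall>l\<in>{..<L}. \<exists>v. (\<forall>c. quasiperiodic (\<kappa> l) (W l) (v c) \<and> locint (v c)) \<and>
        (\<forall>u. (\<forall>c. supported 0 T (u c)) \<longrightarrow> (\<forall>c. AE s in lborel. periodize (\<kappa> l) (W l) (u c) s = v c s) \<longrightarrow> (\<exists>X. reach l u X))"
      by (rule ballI)
    from bchoice[OF this] obtain v where v: "\<forall>l\<in>{..<L}. (\<forall>c. quasiperiodic (\<kappa> l) (W l) (v l c) \<and> locint (v l c)) \<and>
        (\<forall>u. (\<forall>c. supported 0 T (u c)) \<longrightarrow> (\<forall>c. AE s in lborel. periodize (\<kappa> l) (W l) (u c) s = v l c s) \<longrightarrow> (\<exists>X. reach l u X))" ..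
    have "\<exists>u. locint u \<and> supported 0 T u \<and> (\<forall>l<L. AE s in lborel. periodize (exp (\<sigma> l * W l)) (W l) u s = v l c s)" for c
      unfolding TW
    proof (rule simultaneous_interpolation[OF W \<sigma>])
      fix l assume l: "l < L"
      show "quasiperiodic (exp (\<sigma> l * W l)) (W l) (v l c)" "locint (v l c)"
        using bspec[OF v, of l] l \<kappa>[OF l] by simp_all
    qed
    then have "\<forall>c. \<exists>u. locint u \<and> supported 0 T u \<and> (\<forall>l<L. AE s in lborel. periodize (exp (\<sigma> l * W l)) (W l) u s = v l c s)" by (rule allI)
    from choice[OF this] obtain u where u: "\<forall>c. locint (u c) \<and> supported 0 T (u c) \<and> (\<forall>l<L. AE s in lborel. periodize (exp (\<sigma> l * W l)) (W l) (u c) s = v l c s)" ..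
    have "\<forall>l\<in>{..<L}. \<exists>X. reach l u X"
    proof
      fix l assume l: "l \<in> {..<L}"
      have "\<forall>c. AE s in lborel. periodize (\<kappa> l) (W l) (u c) s = v l c s" using u l \<kappa>[of l] by simp
      moreover have "\<forall>c. supported 0 T (u c)" using u by blast
      ultimately show "\<exists>X. reach l u X" using bspec[OF v l] by blast
    qed
    from bchoice[OF this] obtain X where X: "\<forall>l\<in>{..<L}. reach l u (X l)" ..
    have "\<forall>e. \<exists>li. fst li < L \<and> snd li < h (fst li) \<and> e = E (fst li) (snd li)"
      using disjoint_cycles_edge[OF C] by (force simp: E_def)
    from choice[OF this] obtain ix where ix: "\<forall>e. fst (ix e) < L \<and> snd (ix e) < h (fst (ix e)) \<and> e = E (fst (ix e)) (snd (ix e))" ..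
    define Y where "Y e = X (fst (ix e)) (snd (ix e))" for e
    have YE: "Y (E l i) = X l i" if "l < L" "i < h l" for l i
      using E_inj[OF that, of "fst (ix (E l i))" "snd (ix (E l i))"] ix by (simp add: Y_def)
    have X1: "X l i t = exp (- \<zeta> l (cycle_prev (h l) i)) * X l (cycle_prev (h l) i) (t - \<tau> l (cycle_prev (h l) i)) + (\<Sum>c\<in>UNIV. \<Gamma> $ src (E l i) $ c * u c t)"
      and X2: "t \<in> {- \<tau> l i..<0} \<Longrightarrow> X l i t = F (E l i) (0 - t)"
      and X3: "AE t in lborel. t \<in> {T - \<tau> l i..<T} \<longrightarrow> X l i t = H (E l i) (T - t)"
      if "l < L" "i < h l" for l i t
      using bspec[OF X, of l] that unfolding reach_def by blast+
    define u' where "u' t = (\<chi> c. u c t)" for t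
    define z where "z t x = (\<chi> e. exp (- edge_damping lam d e x) * Y e (t - edge_delay lam e x))" for t x
    have sol: "network_solution src tgt w \<Gamma> lam d T (z 0) u' z"
      unfolding z_def[abs_def]
    proof (rule delay_network_solution[OF C w te])
      fix l i t assume l: "l < L" "i < h l"
      have p: "cycle_prev (h l) i < h l" by (rule cycle_prev_less[OF h[OF l(1)] l(2)])
      show "Y (\<epsilon> (offset h l + i)) t = exp (- zeta lam d (\<epsilon> (offset h l + cycle_prev (h l) i))) * Y (\<epsilon> (offset h l + cycle_prev (h l) i)) (t - tau lam (\<epsilon> (offset h l + cycle_prev (h l) i)))
        + (\<Sum>c\<in>UNIV. \<Gamma> $ src (\<epsilon> (offset h l + i)) $ c * u' t $ c)"
        using X1[OF l, of t] unfolding YE[OF l, unfolded E_def] YE[OF l(1) p, unfolded E_def] \<zeta>_def \<tau>_def E_def u'_def vec_lambda_beta .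
    qed
    have init: "AE x in lebesgue_on {0..1}. z 0 x = \<phi> x"
    proof (rule AE_lebesgue_on_vec)
      fix e
      obtain l i where l: "l < L" "i < h l" and e: "e = E l i" using ix by blast
      have "AE x in lebesgue_on {0..1}. F e (edge_delay lam e x) = exp (edge_damping lam d e x) * \<phi> x $ e" using F by blast
      \<comment> \<open>The point x = 1 corresponds to time 0, which does not belong to the
        half-open initial interval.\<close>
      moreover have "AE x in lebesgue_on {0..1::real}. x \<noteq> 1"
        unfolding AE_lebesgue_on_iff using AE_lborel_singleton[of "1::real"] by eventually_elim simp
      ultimately show "AE x in lebesgue_on {0..1}. z 0 x $ e = \<phi> x $ e" using AE_space
      proof eventually_elim
        case (elim x)
        then have x: "x \<in> {0..1}" "0 \<le> x" "x < 1" by (auto simp: space_restrict_space)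
        have "0 < edge_delay lam e x"
          using transport_edge.delay_strict_antimono[OF te x(2,3), of e] by (simp add: transport_edge.delay_1[OF te])
        moreover have "edge_delay lam e x \<le> \<tau> l i"
          using transport_edge.delay_le[OF te x(1), of e] by (simp add: \<tau>_def e[symmetric] tau_delay[where lam = lam and d = d, OF te])
        ultimately have "Y e (0 - edge_delay lam e x) = F e (edge_delay lam e x)"
          unfolding e YE[OF l] by (subst X2[OF l]) auto
        also have "\<dots> = exp (edge_damping lam d e x) * \<phi> x $ e" by (rule elim(1))
        finally show ?case by (simp add: z_def mult.assoc[symmetric] exp_add[symmetric])
      qed
    qed
    have final: "AE x in lebesgue_on {0..1}. z T x = \<psi> x"
    proof (rule AE_lebesgue_on_vec)
      fix e
      obtain l i where l: "l < L" "i < h l" and e: "e = E l i" using ix by blast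
      have "AE r in lborel. r \<in> {0..edge_delay lam e 0} \<longrightarrow> Y e (T - r) = H e r"
        using AE_lborel_reflect[OF X3[OF l], of T] AE_lborel_singleton[of "0::real"]
      proof eventually_elim
        case (elim r)
        then show ?case
          by (auto simp: e YE[OF l] \<tau>_def tau_delay[where lam = lam and d = d, OF te])
      qed
      from transport_edge.AE_delay[OF te this]
      have "AE x in lebesgue_on {0..1}. Y e (T - edge_delay lam e x) = H e (edge_delay lam e x)" .
      moreover have "AE x in lebesgue_on {0..1}. H e (edge_delay lam e x) = exp (edge_damping lam d e x) * \<psi> x $ e" using H by blast
      ultimately show "AE x in lebesgue_on {0..1}. z T x $ e = \<psi> x $ e"
        by eventually_elim (simp add: z_def mult.assoc[symmetric] exp_add[symmetric])
    qed
    have "u' absolutely_integrable_on {0..T}" unfolding u'_def[abs_def]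
      using u by (intro absolutely_integrable_vec) blast
    moreover have "L1_network_solution src tgt w \<Gamma> lam d T \<phi> u' z"
      unfolding L1_network_solution_def using init sol by (intro exI[of _ "z 0"] exI[of _ u']) simp
    ultimately show ?thesis using final by (intro exI[of _ u'] exI[of _ z] conjI)
  qed
  then show ?thesis unfolding L1_exactly_controllable_def T_def by simp
qed

theorem corollary6p10:
  fixes src tgt :: "'n::finite \<Rightarrow> 'k::finite"
    and w :: "real ^ 'n ^ 'k"
    and \<Gamma> :: "real ^ 'm::finite ^ 'k"
    and lam d :: "'n \<Rightarrow> real \<Rightarrow> real"
    and L :: nat and h :: "nat \<Rightarrow> nat" and \<epsilon> :: "nat \<Rightarrow> 'n"
  assumes weights: "admissible_weights src w"
    and d_L1: "\<And>j. d j absolutely_integrable_on {0..1}"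
    and lam_neg: "\<And>j x. x \<in> {0..1} \<Longrightarrow> lam j x < 0"
    and lam_Linf: "\<And>j. L_infinity (lam j)"
    and inv_lam_Linf: "\<And>j. L_infinity (\<lambda>x. 1 / lam j x)"
    and cycles: "disjoint_cycles src tgt L h \<epsilon>"
    and ratios: "\<And>l1 l2. l1 < L \<Longrightarrow> l2 < L \<Longrightarrow> l1 \<noteq> l2 \<Longrightarrow>
      (\<Sum>j\<in>J h l1. zeta lam d (\<epsilon> j)) / (\<Sum>j\<in>J h l1. tau lam (\<epsilon> j))
        \<noteq> (\<Sum>j\<in>J h l2. zeta lam d (\<epsilon> j)) / (\<Sum>j\<in>J h l2. tau lam (\<epsilon> j))"
  shows "L1_exactly_controllable src tgt w \<Gamma> lam d (\<Sum>j\<in>UNIV. tau lam j) \<longleftrightarrow>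
    (\<forall>l<L. \<forall>N\<in>mat_closure (offset h L) (range (Hnet (tau lam \<circ> \<epsilon>) (zeta lam d \<circ> \<epsilon>) L h)).
       Determinant.det (diagonal_block h N l) = 0 \<longrightarrow>
       row_times_Gamma (offset h L) (src \<circ> \<epsilon>)
         (Y_tilde (tau lam \<circ> \<epsilon>) (zeta lam d \<circ> \<epsilon>) L h l N) \<Gamma> \<noteq> 0)"
proof -
  have te: "transport_edge (lam e) (d e)" for e
    by unfold_locales (use d_L1 lam_neg lam_Linf inv_lam_Linf in auto)
  have \<tau>: "(tau lam \<circ> \<epsilon>) j > 0" for j
    using transport_edge.delay_0_pos[OF te[of "\<epsilon> j"]] by (simp add: tau_delay[where lam = lam and d = d, OF te])
  have h: "1 \<le> h l" if "l < L" for l using cycles that by (simp add: disjoint_cycles_def)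
  have closure: "(\<forall>N\<in>mat_closure (offset h L) (range (Hnet (tau lam \<circ> \<epsilon>) (zeta lam d \<circ> \<epsilon>) L h)).
       Determinant.det (diagonal_block h N l) = 0 \<longrightarrow>
       row_times_Gamma (offset h L) (src \<circ> \<epsilon>) (Y_tilde (tau lam \<circ> \<epsilon>) (zeta lam d \<circ> \<epsilon>) L h l N) \<Gamma> \<noteq> 0) \<longleftrightarrow>
    symbol_bounded_below \<Gamma> (\<lambda>i. src (\<epsilon> (offset h l + i))) (h l)
     (\<lambda>i. tau lam (\<epsilon> (offset h l + i))) (\<lambda>i. zeta lam d (\<epsilon> (offset h l + i)))" if l: "l < L" for l
    using closure_iff_symbol_bounded_below[where h = h and l = l and L = L and \<tau> = "tau lam \<circ> \<epsilon>" and \<zeta> = "zeta lam d \<circ> \<epsilon>"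
        and v = "src \<circ> \<epsilon>" and \<Gamma> = \<Gamma>, OF h[OF l] l \<tau>] unfolding o_def .
  show ?thesis
  proof
    assume ctrl: "L1_exactly_controllable src tgt w \<Gamma> lam d (\<Sum>j\<in>UNIV. tau lam j)"
    show "\<forall>l<L. \<forall>N\<in>mat_closure (offset h L) (range (Hnet (tau lam \<circ> \<epsilon>) (zeta lam d \<circ> \<epsilon>) L h)).
       Determinant.det (diagonal_block h N l) = 0 \<longrightarrow>
       row_times_Gamma (offset h L) (src \<circ> \<epsilon>) (Y_tilde (tau lam \<circ> \<epsilon>) (zeta lam d \<circ> \<epsilon>) L h l N) \<Gamma> \<noteq> 0"
    proof (intro allI impI)
      fix l assume l: "l < L"
      show "\<forall>N\<in>mat_closure (offset h L) (range (Hnet (tau lam \<circ> \<epsilon>) (zeta lam d \<circ> \<epsilon>) L h)).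
       Determinant.det (diagonal_block h N l) = 0 \<longrightarrow>
       row_times_Gamma (offset h L) (src \<circ> \<epsilon>) (Y_tilde (tau lam \<circ> \<epsilon>) (zeta lam d \<circ> \<epsilon>) L h l N) \<Gamma> \<noteq> 0"
        unfolding closure[OF l] by (rule controllable_imp_symbol_bounded_below[OF cycles weights te ctrl l])
    qed
  next
    assume N: "\<forall>l<L. \<forall>N\<in>mat_closure (offset h L) (range (Hnet (tau lam \<circ> \<epsilon>) (zeta lam d \<circ> \<epsilon>) L h)).
       Determinant.det (diagonal_block h N l) = 0 \<longrightarrow>
       row_times_Gamma (offset h L) (src \<circ> \<epsilon>) (Y_tilde (tau lam \<circ> \<epsilon>) (zeta lam d \<circ> \<epsilon>) L h l N) \<Gamma> \<noteq> 0"
    show "L1_exactly_controllable src tgt w \<Gamma> lam d (\<Sum>j\<in>UNIV. tau lam j)"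
    proof (rule symbol_bounded_below_imp_controllable[OF cycles weights te])
      fix l assume l: "l < L"
      show "symbol_bounded_below \<Gamma> (\<lambda>i. src (\<epsilon> (offset h l + i))) (h l)
         (\<lambda>i. tau lam (\<epsilon> (offset h l + i))) (\<lambda>i. zeta lam d (\<epsilon> (offset h l + i)))"
        unfolding closure[OF l, symmetric] using spec[OF N, of l] l by (rule mp)
    qed (use ratios in \<open>simp only: sum_J\<close>)
  qed
qed

end
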